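(* Let $\mathbb{K}$ be an algebraically closed field of characteristic $0$. Let $r=f/g\in\mathbb{K}(X,Y)$ be a non-composite reduced rational function and set $d=\deg(r)=\max(\deg f,\deg g)$. Then $$0\le \rho(f,g)\le m(f,g)+\omega(f,g)+\theta(f,g)\le d^2-1 .$$
   Context: A rational function $r=f/g$ with $f,g\in\mathbb{K}[X,Y]$ is reduced if $\gcd(f,g)=1$; its degree is $\max(\deg f,\deg g)$ (total degrees). It is non-composite if it cannot be written $r=u\circ h$ with $h\in\mathbb{K}(X,Y)$ and $u\in\mathbb{K}(T)$ of degree $\ge 2$. Put $f^\sharp(X,Y,Z)=Z^d f(X/Z,Y/Z)$ and $g^\sharp(X,Y,Z)=Z^d g(X/Z,Y/Z)$, homogeneous of degree $d$. For $(\mu:\lambda)\in\mathbb{P}^1_{\mathbb{K}}$ write a complete factorization $\mu f^\sharp+\lambda g^\sharp=\prod_{i=1}^{n(\mu:\lambda)}P_{(\mu:\lambda),i}^{e_{(\mu:\lambda),i}}$ with the $P_{(\mu:\lambda),i}$ pairwise non-proportional irreducible homogeneous polynomials in $\mathbb{K}[X,Y,Z]$. Define $m(\mu:\lambda)=\sum_i e_{(\mu:\lambda),i}$, $\omega(\mu:\lambda)=\sum_i \deg(P_{(\mu:\lambda),i})(e_{(\mu:\lambda),i}-1)$, and $\theta(\mu:\lambda)=\binom{\omega(\mu:\lambda)+1}{2}-\sum_i(e_{(\mu:\lambda),i}-1)$. Then $\rho(f,g)=\sum_{(\mu:\lambda)\in\mathbb{P}^1}(n(\mu:\lambda)-1)$,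 $m(f,g)=\sum_{(\mu:\lambda)\in\mathbb{P}^1}(m(\mu:\lambda)-1)$, $\omega(f,g)=\sum_{(\mu:\lambda)\in\mathbb{P}^1}\omega(\mu:\lambda)$, $\theta(f,g)=\sum_{(\mu:\lambda)\in\mathbb{P}^1}\theta(\mu:\lambda)$ (all these sums are finite since $r$ is non-composite). *)

theory Defs
  imports "HOL-Computational_Algebra.Computational_Algebra"
begin

text \<open>Conventions.
  K[X,Y] is represented as \<open>'k poly poly\<close> (outer variable Y, inner variable X);
  K[X,Y,Z] as \<open>'k poly poly poly\<close> (outer Z, then Y, inner X);
  K(X,Y) as \<open>'k poly poly fract\<close>; K(T) elements as quotients of \<open>'k poly\<close>.\<close>

definition alg_closed_field :: "'k::field itself \<Rightarrow> bool" where
  "alg_closed_field _ \<longleftrightarrow> (\<forall>p::'k poly. degree p \<ge> 1 \<longrightarrow> (\<exists>x. poly p x = 0))"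

definition tdeg2 :: "'k::zero poly poly \<Rightarrow> nat" where
  "tdeg2 p = Max ({degree (coeff p i) + i | i. coeff p i \<noteq> 0} \<union> {0})"

definition tdeg3 :: "'k::zero poly poly poly \<Rightarrow> nat" where
  "tdeg3 p = Max ({tdeg2 (coeff p i) + i | i. coeff p i \<noteq> 0} \<union> {0})"

text \<open>Homogenisation \<open>f\<^sup>\<sharp>(X,Y,Z) = Z^d f(X/Z,Y/Z)\<close> (for \<open>d \<ge> tdeg2 f\<close>).\<close>
definition homog :: "nat \<Rightarrow> 'k::comm_semiring_1 poly poly \<Rightarrow> 'k poly poly poly" where
  "homog d f = (\<Sum>i\<le>degree f. \<Sum>j\<le>degree (coeff f i).
      monom (monom (monom (coeff (coeff f i) j) j) i) (d - i - j))"

definition const3 :: "'k::zero \<Rightarrow> 'k poly poly poly" where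
  "const3 c = [:[:[:c:]:]:]"

definition pencil :: "'k::comm_semiring_1 poly poly \<Rightarrow> 'k poly poly \<Rightarrow> 'k \<Rightarrow> 'k \<Rightarrow> 'k poly poly poly" where
  "pencil f g a b = (let d = max (tdeg2 f) (tdeg2 g) in
      const3 a * homog d f + const3 b * homog d g)"

text \<open>Local invariants of a homogeneous polynomial P, read off its complete factorisation
  into pairwise non-proportional irreducibles (the normalised prime factors).\<close>
definition n_inv :: "'k::field_gcd poly poly poly \<Rightarrow> int" where
  "n_inv P = int (card (prime_factors P))"

definition m_inv :: "'k::field_gcd poly poly poly \<Rightarrow> int" where
  "m_inv P = int (size (prime_factorization P))"

definition omega_inv :: "'k::field_gcd poly poly poly \<Rightarrow> int" where
  "omega_inv P = (\<Sum>q\<in>prime_factors P. int (tdeg3 q) * (int (multiplicity q P) - 1))"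

definition theta_inv :: "'k::field_gcd poly poly poly \<Rightarrow> int" where
  "theta_inv P = int ((nat (omega_inv P) + 1) choose 2)
                 - (\<Sum>q\<in>prime_factors P. int (multiplicity q P) - 1)"

text \<open>Sum over the points of \<open>\<P>\<^sup>1\<close>: the points are \<open>(1:\<lambda>)\<close>, \<open>\<lambda>\<in>K\<close>, and \<open>(0:1)\<close>.
  The sum is taken over the support (which is finite in the situation of the theorem).\<close>
definition P1_sum :: "('k::{zero,one} \<Rightarrow> 'k \<Rightarrow> int) \<Rightarrow> int" where
  "P1_sum F = F 0 1 + (\<Sum>t\<in>{t. F 1 t \<noteq> 0}. F 1 t)"

definition rho_fg :: "'k::{field_gcd} poly poly \<Rightarrow> 'k poly poly \<Rightarrow> int" where
  "rho_fg f g = P1_sum (\<lambda>a b. n_inv (pencil f g a b) - 1)"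

definition m_fg :: "'k::{field_gcd} poly poly \<Rightarrow> 'k poly poly \<Rightarrow> int" where
  "m_fg f g = P1_sum (\<lambda>a b. m_inv (pencil f g a b) - 1)"

definition omega_fg :: "'k::{field_gcd} poly poly \<Rightarrow> 'k poly poly \<Rightarrow> int" where
  "omega_fg f g = P1_sum (\<lambda>a b. omega_inv (pencil f g a b))"

definition theta_fg :: "'k::{field_gcd} poly poly \<Rightarrow> 'k poly poly \<Rightarrow> int" where
  "theta_fg f g = P1_sum (\<lambda>a b. theta_inv (pencil f g a b))"

definition const_fract :: "'k::field \<Rightarrow> 'k poly poly fract" where
  "const_fract c = to_fract [:[:c:]:]"

definition eval_fract :: "'k::field poly \<Rightarrow> 'k poly poly fract \<Rightarrow> 'k poly poly fract" where
  "eval_fract a h = poly (map_poly const_fract a) h"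

definition non_composite :: "'k::field poly poly \<Rightarrow> 'k poly poly \<Rightarrow> bool" where
  "non_composite f g \<longleftrightarrow>
     \<not> (\<exists>(a::'k poly) b h. coprime a b \<and> max (degree a) (degree b) \<ge> 2 \<and>
          eval_fract b h \<noteq> 0 \<and> Fract f g = eval_fract a h / eval_fract b h)"

end

theory Submission
  imports Defs
begin

text \<open>For a member \<open>H = \<Prod> P\<^sup>e\<close> of the pencil with \<open>R = \<Prod> P\<^sup>e\<^sup>-\<^sup>1\<close>, the closed 1-forms
  \<open>\<Sum> \<lambda>\<^sub>P dP/P + d(A/R)\<close> on the projective plane (with \<open>\<Sum> \<lambda>\<^sub>P deg P = 0\<close> and \<open>A\<close> of degree \<open>deg R = \<omega>\<close>,
  modulo multiples of \<open>R\<close>) form a space of dimension \<open>n - 1 + (\<omega> + 2 choose 2) - 1\<close>, which is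
  \<open>m - 1 + \<omega> + \<theta>\<close>. Multiplied by \<open>H\<close>, they become triples of forms of degree \<open>d - 1\<close> annihilated by
  the Euler vector field, and the space of these triples has dimension \<open>d\<^sup>2 - 1\<close>. So it suffices that
  the spaces attached to different members of the pencil are independent.

  A relation \<open>\<Sum> H\<^sub>t \<eta>\<^sub>t = 0\<close> with \<open>H\<^sub>t = F + t G\<close>, divided by \<open>G\<close> and differentiated, says that the closed
  form \<open>\<eta> = \<Sum> \<eta>\<^sub>t\<close> satisfies \<open>\<eta> \<and> dr = 0\<close>. Hence \<open>\<eta> = \<psi> dr\<close> with \<open>d\<psi> \<and> dr = 0\<close>. The rational functions
  \<open>\<psi>\<close> with this property form a field, which restriction to a general line embeds into a field of
  rational functions in one variable; by Lueroth's theorem it is generated by one element, and this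
  is \<open>r\<close> up to a Moebius transformation because \<open>r\<close> is non-composite. Thus \<open>\<psi>\<close> is a rational function of
  \<open>r\<close>, and comparing \<open>\<eta>\<close> with \<open>\<psi>(r) dr\<close> modulo \<open>H\<^sub>t\<close> shows that \<open>\<eta>\<^sub>t\<close> is a multiple of \<open>dH\<^sub>t/H\<^sub>t\<close>; it
  vanishes because the Euler field annihilates it.\<close>

section \<open>Derivations and homogeneous polynomials in three variables\<close>

text \<open>The number d^2 - 1 is 3 (d+1 choose 2) - (d+2 choose 2): contraction with the Euler
  field maps the triples of forms of degree d - 1 onto the forms of degree d. Independence gives the
  bound for every finite set of members; the finiteness of the set of reducible members is a
  consequence of it and not an ingredient. The member \<open>G\<close> is treated unlike the others:
  being the denominator of r = F/G, it has its form replaced by minus the sum of the others. All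
  denominators are cleared: closedness of v/F is the identity F dv = dF wedge v, and D(p/q) = 0 is
  \<open>csts\<close>. Homogeneity becomes an eigenvalue equation of the Euler derivation, so that
  the Leibniz rule governs it as well. The function psi is constructed in the chart Z = 1 from two
  of the three components; the Euler relation returns the third. This needs the Y-component of dr to
  be nonzero; otherwise r depends on X only and non-compositeness forces d = 1, where every member
  contributes 0.\<close>

locale derivation =
  fixes D :: "'a::comm_ring_1 \<Rightarrow> 'a"
  assumes add: "D (x + y) = D x + D y"
    and mult: "D (x * y) = D x * y + x * D y"
begin

lemma zero [simp]: "D 0 = 0"
  using add[of 0 0] by simp

lemma one [simp]: "D 1 = 0"
  using mult[of 1 1] by simp

lemma uminus: "D (- x) = - D x"
  using add[of x "- x"] by (simp add: eq_neg_iff_add_eq_0 add.commute)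

lemma diff: "D (x - y) = D x - D y"
  using add[of x "- y"] by (simp add: uminus)

lemma sum: "D (sum f A) = (\<Sum>x\<in>A. D (f x))"
  by (induction A rule: infinite_finite_induct) (simp_all add: add)

lemma of_nat [simp]: "D (of_nat n) = 0"
  by (induction n) (simp_all add: add)

text \<open>Multiplied by \<open>x\<close> to avoid the exponent \<open>n - 1\<close>.\<close>
lemma power: "x * D (x ^ n) = of_nat n * x ^ n * D x"
  by (induction n) (simp_all add: mult algebra_simps)

end

lemma derivation_pderiv: "derivation (pderiv :: 'a::idom poly \<Rightarrow> 'a poly)"
  by unfold_locales (simp_all add: pderiv_add pderiv_mult)

lemma derivation_map_poly:
  assumes "derivation (D :: 'a::comm_ring_1 \<Rightarrow> 'a)"
  shows "derivation (map_poly D)"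
proof -
  interpret derivation D by fact
  show ?thesis
    by unfold_locales
      (simp_all add: poly_eq_iff coeff_map_poly add coeff_mult sum mult sum.distrib)
qed

section \<open>Coefficients of polynomials in three variables\<close>

definition cf :: "'a::zero poly poly poly \<Rightarrow> nat \<Rightarrow> nat \<Rightarrow> nat \<Rightarrow> 'a" where
  "cf P i j k = coeff (coeff (coeff P i) j) k"

lemma cf_eqI: "(\<And>i j k. cf P i j k = cf Q i j k) \<Longrightarrow> P = Q"
  by (simp add: cf_def poly_eq_iff)

lemma cf_0 [simp]: "cf 0 i j k = 0"
  by (simp add: cf_def)

lemma cf_nonzeroE:
  assumes "P \<noteq> 0"
  obtains i j k where "cf P i j k \<noteq> 0"
  using assms by (auto simp: cf_def poly_eq_iff)

lemma cf_add: "cf (P + Q) i j k = cf P i j k + cf Q i j k"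
  by (simp add: cf_def)

lemma cf_diff: "cf (P - Q) i j k = cf P i j k - cf Q i j k"
  for P :: "'a::ab_group_add poly poly poly"
  by (simp add: cf_def)

lemma cf_sum: "cf (sum f A) i j k = (\<Sum>x\<in>A. cf (f x) i j k)"
  by (simp add: cf_def coeff_sum)

lemma cf_const3_mult: "cf (const3 c * P) i j k = c * cf P i j k"
  by (simp add: cf_def const3_def)

lemma coeff_of_nat_mult: "coeff (of_nat n * p) i = of_nat n * coeff p i"
  for p :: "'a::comm_semiring_1 poly"
  by (induction n) (simp_all add: algebra_simps)

lemma cf_of_nat_mult: "cf (of_nat n * P) i j k = of_nat n * cf P i j k"
  for P :: "'a::comm_semiring_1 poly poly poly"
  by (simp add: cf_def coeff_of_nat_mult)

lemma const3_simps [simp]: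
  "const3 0 = 0" "const3 1 = 1"
  by (simp_all add: const3_def one_pCons)

lemma const3_mult: "const3 (a * b) = const3 a * const3 b"
  and const3_add: "const3 (a + b) = const3 a + const3 b"
  and const3_diff: "const3 (a' - b') = const3 a' - const3 b'"
  for a b :: "'a::comm_semiring_1" and a' b' :: "'b::comm_ring_1"
  by (simp_all add: const3_def mult.commute)

lemma const3_eq_0_iff [simp]: "const3 a = 0 \<longleftrightarrow> a = 0"
  by (simp add: const3_def)

lemma const3_sum: "const3 (sum f A) = (\<Sum>x\<in>A. const3 (f x))"
  for f :: "'b \<Rightarrow> 'a::comm_semiring_1"
  by (induction A rule: infinite_finite_induct) (simp_all add: const3_add)

lemma const3_of_nat: "const3 (of_nat n) = of_nat n"
  by (induction n) (simp_all add: const3_add)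

lemma is_unit_const3: "c \<noteq> 0 \<Longrightarrow> is_unit (const3 (c::'a::field))"
  by (simp add: const3_def is_unit_const_poly_iff dvd_field_iff)

lemma is_unit_imp_const3:
  assumes "is_unit (P :: 'a::field poly poly poly)"
  obtains c where "c \<noteq> 0" "P = const3 c"
  using assms unfolding const3_def is_unit_poly_iff by (auto simp: dvd_field_iff)

text \<open>The coordinates are numbered so that \<open>xv 0, xv 1, xv 2\<close> are X, Y, Z, hence reversed
  with respect to the nesting of the polynomial types and to the indices of \<open>cf\<close>.\<close>
definition xv :: "nat \<Rightarrow> 'a::comm_semiring_1 poly poly poly" where
  "xv i = (if i = 0 then [:[:[:0, 1:]:]:] else if i = 1 then [:[:0, 1:]:] else [:0, 1:])"

definition pd :: "nat \<Rightarrow> 'a::idom poly poly poly \<Rightarrow> 'a poly poly poly" where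
  "pd i = (if i = 0 then map_poly (map_poly pderiv) else if i = 1 then map_poly pderiv else pderiv)"

lemma derivation_pd: "derivation (pd i)"
  by (simp add: pd_def derivation_pderiv derivation_map_poly)

lemma pd_ge_2: "i \<ge> 2 \<Longrightarrow> pd i P = pd 2 P"
  by (simp add: pd_def)

lemma cf_pd:
  "cf (pd 0 P) i j k = of_nat (Suc k) * cf P i j (Suc k)"
  "cf (pd (Suc 0) P) i j k = of_nat (Suc j) * cf P i (Suc j) k"
  "cf (pd 2 P) i j k = of_nat (Suc i) * cf P (Suc i) j k"
  by (simp_all only: pd_def cf_def coeff_map_poly coeff_pderiv coeff_of_nat_mult
      if_True if_False pderiv_0 map_poly_0 simp_thms refl numeral_2_eq_2 nat.simps One_nat_def
      coeff_0 split: if_splits)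

lemma cf_xv_mult:
  "cf (xv 0 * P) i j k = (if k = 0 then 0 else cf P i j (k - 1))"
  "cf (xv (Suc 0) * P) i j k = (if j = 0 then 0 else cf P i (j - 1) k)"
  "cf (xv 2 * P) i j k = (if i = 0 then 0 else cf P (i - 1) j k)"
  by (simp_all add: cf_def xv_def coeff_pCons split: nat.split)

lemma pd_const3 [simp]: "pd i (const3 c) = 0"
  by (simp add: pd_def const3_def map_poly_pCons pderiv_pCons)

lemma pd_const3_mult: "pd i (const3 c * P) = const3 c * pd i P"
  by (simp add: derivation.mult[OF derivation_pd])

lemma pd_commute: "pd i (pd j P) = pd j (pd i P)"
  by (intro cf_eqI, unfold pd_def, auto simp: cf_def coeff_map_poly coeff_pderiv coeff_of_nat_mult
    simp del: of_nat_Suc)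

definition euler :: "'a::idom poly poly poly \<Rightarrow> 'a poly poly poly" where
  "euler P = (\<Sum>i<3. xv i * pd i P)"

lemma cf_euler: "cf (euler P) i j k = of_nat (i + j + k) * cf P i j k"
proof -
  have "{..<3} = {0, Suc 0, 2::nat}" by auto
  then show ?thesis
    by (cases i; cases j; cases k)
      (simp_all add: euler_def cf_add cf_xv_mult cf_pd algebra_simps)
qed

lemma derivation_euler: "derivation euler"
proof
  fix x y :: "'a poly poly poly"
  note [simp] = derivation.add[OF derivation_pd] derivation.mult[OF derivation_pd]
  show "euler (x + y) = euler x + euler y"
    by (simp add: euler_def algebra_simps sum.distrib)
  show "euler (x * y) = euler x * y + x * euler y"
    by (simp add: euler_def algebra_simps sum.distrib sum_distrib_left sum_distrib_right)
qed

section \<open>Homogeneity\<close>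

definition hom :: "nat \<Rightarrow> 'a::zero poly poly poly \<Rightarrow> bool" where
  "hom n P \<longleftrightarrow> (\<forall>i j k. cf P i j k \<noteq> 0 \<longrightarrow> i + j + k = n)"

text \<open>\<open>euler\<close> multiplies the coefficient of each monomial by its total degree,
  and distinct degrees stay distinct in characteristic 0. In this form homogeneity passes to
  products by the Leibniz rule.\<close>

lemma hom_iff_euler: "hom n P \<longleftrightarrow> euler P = of_nat n * P"
  for P :: "'a::{idom, ring_char_0} poly poly poly"
proof
  assume "hom n P"
  then show "euler P = of_nat n * P"
    unfolding hom_def by (intro cf_eqI, unfold cf_euler cf_of_nat_mult) fastforce
next
  assume *: "euler P = of_nat n * P"
  show "hom n P" unfolding hom_def
  proof (intro allI impI)
    fix i j k assume "cf P i j k \<noteq> 0"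
    moreover have "of_nat (i + j + k) * cf P i j k = of_nat n * cf P i j k"
      using * by (metis cf_euler cf_of_nat_mult)
    ultimately show "i + j + k = n"
      by (simp only: mult_cancel_right of_nat_eq_iff simp_thms)
  qed
qed

lemma hom_0 [simp]: "hom n 0"
  by (simp add: hom_def)

lemma hom_add: "hom n P \<Longrightarrow> hom n Q \<Longrightarrow> hom n (P + Q)"
  for P :: "'a::comm_monoid_add poly poly poly"
  unfolding hom_def cf_add by (metis add_0)

lemma hom_diff: "hom n P \<Longrightarrow> hom n Q \<Longrightarrow> hom n (P - Q)"
  for P :: "'a::ab_group_add poly poly poly"
  unfolding hom_def cf_diff by (metis diff_zero)

lemma hom_sum: "(\<And>x. x \<in> A \<Longrightarrow> hom n (f x)) \<Longrightarrow> hom n (sum f A)"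
  for f :: "'b \<Rightarrow> 'a::comm_monoid_add poly poly poly"
  by (induction A rule: infinite_finite_induct) (simp_all add: hom_add)

lemma hom_const3_mult: "hom n P \<Longrightarrow> hom n (const3 c * P)"
  unfolding hom_def cf_const3_mult by (metis mult_zero_right)

lemma hom_const3: "hom 0 (const3 c)"
  by (auto simp: hom_def cf_def const3_def coeff_pCons split: nat.splits)

lemma hom_1 [simp]: "hom 0 (1 :: 'a::comm_semiring_1 poly poly poly)"
  using hom_const3[of "1::'a"] by simp

lemma hom_mult: "hom m P \<Longrightarrow> hom n Q \<Longrightarrow> hom (m + n) (P * Q)"
  for P :: "'a::{idom, ring_char_0} poly poly poly"
  unfolding hom_iff_euler by (simp add: derivation.mult[OF derivation_euler] algebra_simps)

lemma hom_power: "hom m P \<Longrightarrow> hom (n * m) (P ^ n)"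
  for P :: "'a::{idom, ring_char_0} poly poly poly"
  by (induction n) (simp_all add: hom_mult)

lemma hom_prod: "(\<And>x. x \<in> A \<Longrightarrow> hom (n x) (f x)) \<Longrightarrow> hom (sum n A) (prod f A)"
  for f :: "'b \<Rightarrow> 'a::{idom, ring_char_0} poly poly poly"
  by (induction A rule: infinite_finite_induct) (simp_all add: hom_mult)

lemma hom_prod_mset: "(\<And>x. x \<in># A \<Longrightarrow> hom n (f x)) \<Longrightarrow> hom (size A * n) (prod_mset (image_mset f A))"
  for f :: "'b \<Rightarrow> 'a::{idom, ring_char_0} poly poly poly"
  by (induction A) (simp_all add: hom_mult)

lemma hom_unique: "hom m P \<Longrightarrow> hom n P \<Longrightarrow> P \<noteq> 0 \<Longrightarrow> m = n"
  unfolding hom_def by (erule cf_nonzeroE) blast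

lemma cf_pd_nonzero:
  assumes "cf (pd i P) a b c \<noteq> 0"
  shows "\<exists>a' b' c'. cf P a' b' c' \<noteq> 0 \<and> a' + b' + c' = Suc (a + b + c)"
proof -
  consider "i = 0" | "i = Suc 0" | "i \<ge> 2" by linarith
  then show ?thesis
  proof cases
    case 1
    then have "cf P a b (Suc c) \<noteq> 0" using assms by (auto simp: cf_pd)
    then show ?thesis by (intro exI[of _ a] exI[of _ b] exI[of _ "Suc c"]) simp
  next
    case 2
    then have "cf P a (Suc b) c \<noteq> 0" using assms by (auto simp: cf_pd)
    then show ?thesis by (intro exI[of _ a] exI[of _ "Suc b"] exI[of _ c]) simp
  next
    case 3
    then have "cf (pd 2 P) a b c \<noteq> 0" using assms by (metis pd_ge_2)
    then have "cf P (Suc a) b c \<noteq> 0" by (auto simp: cf_pd)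
    then show ?thesis by (intro exI[of _ "Suc a"] exI[of _ b] exI[of _ c]) simp
  qed
qed

lemma hom_pd: "hom n P \<Longrightarrow> hom (n - 1) (pd i P)"
  unfolding hom_def by (intro allI impI, drule cf_pd_nonzero) fastforce

lemma hom_0_pd: "hom 0 P \<Longrightarrow> pd i P = 0"
  unfolding hom_def by (rule ccontr, erule cf_nonzeroE, drule cf_pd_nonzero) fastforce

text \<open>For n = 0 the subtraction in \<open>hom_pd\<close> is truncated; the derivative is then
  0, which is homogeneous of every degree.\<close>

lemma hom_mult_pd: "hom m Q \<Longrightarrow> hom n P \<Longrightarrow> hom (m + n - 1) (Q * pd i P)"
  for P :: "'a::{idom, ring_char_0} poly poly poly"
  using hom_mult[of m Q "n - 1" "pd i P"] hom_pd[of n P] hom_0_pd[of P i] by (cases n) auto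

lemma hom_0_imp_const3:
  assumes "hom 0 P"
  obtains c where "P = const3 c"
proof -
  have "P = const3 (cf P 0 0 0)"
    by (rule cf_eqI) (use assms in \<open>auto simp: hom_def cf_def const3_def coeff_pCons split: nat.splits\<close>)
  then show ?thesis using that by blast
qed

text \<open>Applying \<open>euler\<close> to A * B and cancelling A makes B an eigenvector with
  eigenvalue n - m in the ring. The conclusion speaks of single exponents, so that m \<le> n comes
  with it and no truncated subtraction occurs.\<close>

lemma hom_cofactor:
  fixes A :: "'a::{idom, ring_char_0} poly poly poly"
  assumes "hom n (A * B)" "hom m A" "A \<noteq> 0" "cf B i j k \<noteq> 0"
  shows "i + j + k + m = n"
proof -
  have "A * euler B = A * ((of_nat n - of_nat m) * B)"
    using assms(1,2) unfolding hom_iff_euler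
    by (simp add: derivation.mult[OF derivation_euler] algebra_simps)
  then have "euler B = (of_nat n - of_nat m) * B"
    using assms(3) by simp
  then have "euler B + of_nat m * B = of_nat n * B"
    by (simp add: algebra_simps)
  then have "of_nat (i + j + k) * cf B i j k + of_nat m * cf B i j k = of_nat n * cf B i j k"
    by (metis cf_euler cf_of_nat_mult cf_add)
  then have "of_nat (i + j + k + m) * cf B i j k = of_nat n * cf B i j k"
    by (simp add: algebra_simps)
  then show ?thesis using assms(4) by (simp only: mult_cancel_right of_nat_eq_iff simp_thms)
qed

text \<open>Turns congruences into equations: forms of degree d - 1 that are congruent modulo a form
  of degree d are equal.\<close>

lemma hom_dvd_lt_imp_0:
  fixes A :: "'a::{idom, ring_char_0} poly poly poly"
  assumes "hom m A" "A dvd B" "hom n B" "n < m"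
  shows "B = 0"
proof (rule ccontr)
  assume B: "B \<noteq> 0"
  from assms(2) obtain C where C: "B = A * C" ..
  with B have "C \<noteq> 0" "A \<noteq> 0" by auto
  then obtain i j k where "cf C i j k \<noteq> 0" by (blast elim: cf_nonzeroE)
  then have "i + j + k + m = n" using hom_cofactor[of n A C m] assms C \<open>A \<noteq> 0\<close> by simp
  then show False using assms by simp
qed

lemma hom_div:
  fixes A :: "'a::{idom, ring_char_0} poly poly poly"
  assumes "hom n (A * B)" "hom m A" "A \<noteq> 0"
  shows "hom (n - m) B"
  unfolding hom_def using hom_cofactor[OF assms] by fastforce

section \<open>Total degree\<close>

lemma tdeg2_set: "{degree (coeff p i) + i | i. coeff p i \<noteq> 0} = (\<lambda>i. degree (coeff p i) + i) ` {i. coeff p i \<noteq> 0}"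
  by auto

lemma finite_coeff_nonzero: "finite {i. coeff p i \<noteq> 0}"
  by (rule finite_subset[of _ "{..degree p}"]) (auto intro: le_degree)

lemma tdeg2_ge: "coeff (coeff p i) j \<noteq> 0 \<Longrightarrow> i + j \<le> tdeg2 p"
proof -
  assume *: "coeff (coeff p i) j \<noteq> 0"
  then have "degree (coeff p i) + i \<le> tdeg2 p" unfolding tdeg2_def tdeg2_set
    by (intro Max_ge) (auto simp: finite_coeff_nonzero)
  then show ?thesis using le_degree[OF *] by simp
qed

lemma tdeg2_attained:
  assumes "tdeg2 p > 0"
  obtains i j where "coeff (coeff p i) j \<noteq> 0" "i + j = tdeg2 p"
proof -
  have "tdeg2 p \<in> {degree (coeff p i) + i | i. coeff p i \<noteq> 0} \<union> {0}" unfolding tdeg2_def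
    by (rule Max_in) (auto simp: finite_coeff_nonzero tdeg2_set)
  then obtain i where "tdeg2 p = degree (coeff p i) + i" "coeff p i \<noteq> 0" using assms by auto
  then show ?thesis using that[of i "degree (coeff p i)"] by simp
qed

lemma tdeg2_le: "(\<And>i j. coeff (coeff p i) j \<noteq> 0 \<Longrightarrow> i + j \<le> n) \<Longrightarrow> tdeg2 p \<le> n"
  by (metis gr0I le0 tdeg2_attained)

lemma tdeg3_set: "{tdeg2 (coeff p i) + i | i. coeff p i \<noteq> 0} = (\<lambda>i. tdeg2 (coeff p i) + i) ` {i. coeff p i \<noteq> 0}"
  by auto

lemma hom_tdeg3: "hom n P \<Longrightarrow> P \<noteq> 0 \<Longrightarrow> tdeg3 P = n"
proof -
  assume P: "hom n P" "P \<noteq> 0"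
  have fin: "finite ({tdeg2 (coeff P i) + i | i. coeff P i \<noteq> 0} \<union> {0})"
    by (auto simp: finite_coeff_nonzero tdeg3_set)
  have mem: "tdeg3 P \<in> {tdeg2 (coeff P i) + i | i. coeff P i \<noteq> 0} \<union> {0}" unfolding tdeg3_def
    by (rule Max_in) (use fin in auto)
  have eq: "tdeg2 (coeff P i) + i = n" if nz: "coeff P i \<noteq> 0" for i
  proof -
    obtain j k where jk: "coeff (coeff (coeff P i) j) k \<noteq> 0" using nz by (auto simp: poly_eq_iff)
    have "i + j + k = n" using P(1) jk unfolding hom_def cf_def by blast
    moreover have "j + k \<le> tdeg2 (coeff P i)" using jk by (rule tdeg2_ge)
    moreover have "tdeg2 (coeff P i) \<le> n - i"
    proof (rule tdeg2_le)
      fix j k assume "coeff (coeff (coeff P i) j) k \<noteq> 0"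
      then have "i + j + k = n" using P(1) unfolding hom_def cf_def by blast
      then show "j + k \<le> n - i" by simp
    qed
    ultimately show ?thesis by simp
  qed
  obtain i where i: "coeff P i \<noteq> 0" using P(2) by (auto simp: poly_eq_iff)
  have "tdeg2 (coeff P i) + i \<le> tdeg3 P"
    unfolding tdeg3_def by (rule Max_ge[OF fin]) (use i in auto)
  then have "n \<le> tdeg3 P" using eq[OF i] by simp
  moreover have "tdeg3 P = n \<or> tdeg3 P = 0" using mem eq by auto
  ultimately show ?thesis by linarith
qed

section \<open>Closed forms attached to a factorization\<close>

text \<open>The support of q lies in that of p, so degree q \<le> degree p and no room is left for
  r.\<close>

lemma cofactor_const:
  fixes p q r :: "'a::idom poly"
  assumes "q = p * r" "p \<noteq> 0" "\<And>i. coeff p i = 0 \<Longrightarrow> coeff q i = 0"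
  obtains c where "r = [:c:]"
proof -
  have "degree q \<le> degree p"
    by (rule degree_le) (auto intro: assms(3) coeff_eq_0)
  then have "degree r = 0"
    using assms(1,2) by (cases "r = 0") (auto simp: degree_mult_eq)
  then show ?thesis using that by (auto elim: degree_eq_zeroE)
qed

text \<open>With P = U * Q^e and Q not dividing U, the Leibniz rule for \<open>euler P\<close> shows
  that Q divides e * U * euler Q, hence euler Q. As euler Q has no monomial outside the support of
  Q, the cofactor is a constant, and this constant is the total degree of every monomial of
  Q.\<close>

lemma prime_factor_hom:
  fixes Q :: "'k::{field_gcd, field_char_0} poly poly poly"
  assumes Q: "prime_elem Q" and "Q dvd P" "P \<noteq> 0" "hom n P"
  shows "\<exists>m. hom m Q"
proof -
  interpret E: derivation euler by (rule derivation_euler)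
  have "Q \<noteq> 0" "\<not> is_unit Q" using Q by (auto simp: prime_elem_def)
  define e where "e = multiplicity Q P"
  obtain U where U: "P = U * Q ^ e" "\<not> Q dvd U"
    using multiplicity_decompose'[OF assms(3) \<open>\<not> is_unit Q\<close>] unfolding e_def by (metis mult.commute)
  have e: "e \<noteq> 0" using U assms(2) by (cases e) auto
  have "Q * euler P = Q * (of_nat n * P)" using assms(4) by (simp add: hom_iff_euler)
  also have "euler P = euler U * Q ^ e + U * euler (Q ^ e)" by (simp add: U(1) E.mult)
  finally have "Q * euler U * Q ^ e + U * (Q * euler (Q ^ e)) = Q * of_nat n * U * Q ^ e"
    by (simp add: U(1) algebra_simps)
  then have "Q ^ e * (Q * euler U + of_nat e * U * euler Q) = Q ^ e * (Q * of_nat n * U)"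
    by (simp add: E.power algebra_simps)
  then have "Q * euler U + of_nat e * U * euler Q = Q * of_nat n * U"
    using \<open>Q \<noteq> 0\<close> by simp
  then have "of_nat e * U * euler Q = Q * (of_nat n * U - euler U)"
    by (simp add: algebra_simps)
  then have "Q dvd of_nat e * U * euler Q" by simp
  moreover have "\<not> Q dvd of_nat e"
    using e \<open>\<not> is_unit Q\<close> is_unit_const3[of "of_nat e :: 'k"] dvd_trans[of Q]
    by (auto simp: const3_of_nat)
  ultimately have "Q dvd euler Q" using U(2) Q by (auto simp: prime_elem_dvd_mult_iff)
  then obtain r where r: "euler Q = Q * r" ..
  have cf: "coeff (coeff (coeff (euler Q) i) j) k = of_nat (i + j + k) * coeff (coeff (coeff Q i) j) k" for i j k
    using cf_euler[of Q i j k] by (simp add: cf_def)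
  \<comment> \<open>\<open>cofactor_const\<close> is applied once per variable: to Q, to a nonzero
    coefficient of Q, and to a nonzero coefficient of that one.\<close>
  obtain r1 where r1: "r = [:r1:]"
    by (rule cofactor_const[OF r \<open>Q \<noteq> 0\<close>]) (simp add: poly_eq_iff cf)
  have e1: "coeff (euler Q) i = coeff Q i * r1" for i by (simp add: r r1)
  obtain i where i: "coeff Q i \<noteq> 0" using \<open>Q \<noteq> 0\<close> by (auto simp: poly_eq_iff)
  obtain r2 where r2: "r1 = [:r2:]"
    by (rule cofactor_const[OF e1 i]) (simp add: poly_eq_iff cf)
  have e2: "coeff (coeff (euler Q) i) j = coeff (coeff Q i) j * r2" for j by (simp add: e1 r2)
  obtain j where j: "coeff (coeff Q i) j \<noteq> 0" using i by (auto simp: poly_eq_iff)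
  obtain k where k: "r2 = [:k:]"
    by (rule cofactor_const[OF e2 j]) (simp add: poly_eq_iff cf)
  obtain l where l: "cf Q i j l \<noteq> 0" using j by (auto simp: poly_eq_iff cf_def)
  have eq: "euler Q = const3 k * Q" by (simp add: r r1 r2 k const3_def mult.commute)
  have "of_nat (i + j + l) * cf Q i j l = k * cf Q i j l"
    using cf_euler[of Q i j l] unfolding eq cf_const3_mult by (rule sym)
  then have "of_nat (i + j + l) = k" using l by (simp only: mult_cancel_right simp_thms)
  then have "hom (i + j + l) Q" unfolding hom_iff_euler eq by (metis const3_of_nat)
  then show ?thesis ..
qed

lemma prime_hom_pos: "prime_elem Q \<Longrightarrow> hom m Q \<Longrightarrow> m > 0"
  for Q :: "'k::field poly poly poly"
  by (cases m) (auto simp: prime_elem_def is_unit_const3 elim!: hom_0_imp_const3)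

text \<open>The partial derivatives have smaller degree than Q, so divisibility by Q makes them 0;
  Euler's relation then yields m * Q = 0 with m > 0.\<close>

lemma prime_not_dvd_pd:
  fixes Q :: "'k::field_char_0 poly poly poly"
  assumes Q: "prime_elem Q" "hom m Q"
  shows "\<exists>i<3. \<not> Q dvd pd i Q"
proof (rule ccontr)
  assume "\<not> ?thesis"
  then have *: "Q dvd pd i Q" if "i < 3" for i using that by blast
  have "m > 0" using prime_hom_pos[OF Q] .
  then have "pd i Q = 0" if "i < 3" for i
    using hom_dvd_lt_imp_0[OF Q(2) *[OF that] hom_pd[OF Q(2)]] by simp
  then have "euler Q = 0" by (simp add: euler_def)
  then have "of_nat m * Q = 0" using Q(2) by (simp add: hom_iff_euler)
  then show False using \<open>m > 0\<close> Q(1) by auto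
qed

text \<open>The term of lowest order is (j - m) A' R' times the derivative of P, of order j + m - 1,
  and it survives because j \<noteq> m. The extra factor P avoids writing that exponent.\<close>

lemma prime_power_not_dvd_wronskian:
  fixes P :: "'k::field_char_0 poly poly poly"
  assumes P: "prime_elem P" "\<not> P dvd pd i P" and ne: "j \<noteq> m"
    and A: "A = P ^ j * A'" "\<not> P dvd A'" and R: "R = P ^ m * R'" "\<not> P dvd R'"
  shows "\<not> P ^ (j + m + 1) dvd P * (R * pd i A - A * pd i R)"
proof
  interpret derivation "pd i" by (rule derivation_pd)
  assume "P ^ (j + m + 1) dvd P * (R * pd i A - A * pd i R)"
  then have dvd: "P ^ (j + m) * P dvd P * (R * pd i A - A * pd i R)"
    by (metis power_add power_one_right)
  have pw: "P * pd i (P ^ n) = of_nat n * P ^ n * pd i P" for n by (rule power)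
  have "P * (R * pd i A - A * pd i R) =
      P ^ m * R' * (P * pd i (P ^ j) * A' + P * P ^ j * pd i A')
       - P ^ j * A' * (P * pd i (P ^ m) * R' + P * P ^ m * pd i R')"
    unfolding A(1) R(1) mult by (simp add: algebra_simps)
  also have "\<dots> = P ^ (j + m) * ((of_nat j - of_nat m) * A' * R' * pd i P + P * (R' * pd i A' - A' * pd i R'))"
    unfolding pw by (simp add: algebra_simps power_add)
  finally have "P * (R * pd i A - A * pd i R) =
     P ^ (j + m) * ((of_nat j - of_nat m) * A' * R' * pd i P + P * (R' * pd i A' - A' * pd i R'))" .
  then have "P dvd (of_nat j - of_nat m) * A' * R' * pd i P + P * (R' * pd i A' - A' * pd i R')"
    using dvd P(1) by (simp add: prime_elem_def)
  then have "P dvd (of_nat j - of_nat m) * A' * R' * pd i P"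
    by (simp add: dvd_add_left_iff)
  moreover have "\<not> P dvd of_nat j - of_nat m"
  proof
    assume "P dvd of_nat j - of_nat m"
    also have "of_nat j - of_nat m = const3 (of_nat j - of_nat m :: 'k)"
      by (simp add: const3_diff const3_of_nat)
    also have "\<dots> dvd 1" using ne by (intro is_unit_const3) simp
    finally have "is_unit P" .
    then show False using P(1) by (auto simp: prime_elem_def)
  qed
  ultimately show False using P A(2) R(2) by (auto simp: prime_elem_dvd_mult_iff)
qed

section \<open>Numerators of closed forms with poles along the prime factors of a polynomial\<close>

definition mult_part :: "'k::field_gcd poly poly poly \<Rightarrow> 'k poly poly poly" where
  "mult_part F = (\<Prod>P\<in>prime_factors F. P ^ (multiplicity P F - 1))"

definition rad_part :: "'k::field_gcd poly poly poly \<Rightarrow> 'k poly poly poly" where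
  "rad_part F = F div mult_part F"

text \<open>\<open>rad_part F\<close> times dR/R for R = \<open>mult_part F\<close>. The division is
  exact because dR/R has only simple poles, see lemma \<open>logd\<close>.\<close>

definition logd :: "'k::field_gcd poly poly poly \<Rightarrow> nat \<Rightarrow> 'k poly poly poly" where
  "logd F i = rad_part F * pd i (mult_part F) div mult_part F"

definition omega_nat :: "'k::field_gcd poly poly poly \<Rightarrow> nat" where
  "omega_nat F = (\<Sum>P\<in>prime_factors F. (multiplicity P F - 1) * tdeg3 P)"

text \<open>The numerator of the closed 1-form \<open>\<Sum>\<^sub>P lam P \<cdot> dP/P + d(A/R)\<close> over the common
  denominator \<open>F\<close>, where \<open>R = mult_part F\<close>.\<close>
definition form :: "'k::field_gcd poly poly poly \<Rightarrow> ('k poly poly poly \<Rightarrow> 'k) \<Rightarrow> 'k poly poly poly \<Rightarrow> nat \<Rightarrow> 'k poly poly poly" where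
  "form F lam A i = (\<Sum>P\<in>prime_factors F. const3 (lam P) * ((F div P) * pd i P))
     + (rad_part F * pd i A - A * logd F i)"

lemma prime_factorsD:
  assumes "P \<in> prime_factors F"
  shows "prime_elem P" "P dvd F" "multiplicity P F > 0"
proof -
  show "multiplicity P F > 0" using assms by (auto simp: prime_factors_multiplicity)
  show "prime_elem P" "P dvd F" using assms by (auto simp: in_prime_factors_iff)
qed

lemma mult_part_nonzero: "mult_part F \<noteq> 0"
  by (auto simp: mult_part_def)

text \<open>Prime factors are normalized, so their powers multiply to F only up to a unit; as a
  quotient, \<open>rad_part\<close> absorbs that unit.\<close>

lemma rad_part_decomp:
  assumes F: "F \<noteq> 0"
  shows mult_rad_part: "F = mult_part F * rad_part F"
    and rad_part_eq: "\<exists>u. is_unit u \<and> rad_part F = \<Prod>(prime_factors F) * u"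
proof -
  have "mult_part F * \<Prod>(prime_factors F) = (\<Prod>P\<in>prime_factors F. P ^ (multiplicity P F - 1) * P)"
    unfolding mult_part_def by (simp add: prod.distrib)
  also have "\<dots> = (\<Prod>P\<in>prime_factors F. P ^ count (prime_factorization F) P)"
    by (rule prod.cong)
      (auto simp: power_Suc2[symmetric] count_prime_factorization_prime in_prime_factors_imp_prime
        dest: prime_factorsD(3) simp del: power_Suc)
  also have "\<dots> = prod_mset (prime_factorization F)"
    by (simp add: prod_mset_multiplicity)
  also have "normalize \<dots> = normalize F" using F by (rule prod_mset_prime_factorization_weak)
  finally obtain u where u: "is_unit u" "F = mult_part F * \<Prod>(prime_factors F) * u"
    by (metis associated_unit associatedE1 is_unit_mult_iff mult.commute)
  then have *: "F = mult_part F * (\<Prod>(prime_factors F) * u)" by (simp add: mult.assoc)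
  then have "rad_part F = \<Prod>(prime_factors F) * u"
    unfolding rad_part_def using mult_part_nonzero[of F] by (metis nonzero_mult_div_cancel_left)
  with u(1) * show "F = mult_part F * rad_part F"
     "\<exists>u. is_unit u \<and> rad_part F = \<Prod>(prime_factors F) * u" by auto
qed

text \<open>Each P * d(P^k) is a multiple of P^k, so one factor P for every prime clears the
  denominators of the logarithmic derivative.\<close>

lemma mult_part_dvd_aux:
  fixes k :: "'k::field_gcd poly poly poly \<Rightarrow> nat"
  assumes "finite S"
  shows "(\<Prod>P\<in>S. P ^ k P) dvd \<Prod>S * pd i (\<Prod>P\<in>S. P ^ k P)"
  using assms
proof (induction S rule: finite_induct)
  case (insert P S)
  interpret derivation "pd i" by (rule derivation_pd)
  let ?R = "\<Prod>P\<in>S. P ^ k P"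
  from insert.IH obtain Y where Y: "\<Prod>S * pd i ?R = ?R * Y" ..
  have pw: "P * pd i (P ^ n) = of_nat n * P ^ n * pd i P" for n by (rule power)
  have "P * \<Prod>S * pd i (P ^ k P * ?R) = \<Prod>S * ?R * (P * pd i (P ^ k P)) + P * P ^ k P * (\<Prod>S * pd i ?R)"
    unfolding mult by (simp add: algebra_simps)
  also have "\<dots> = (P ^ k P * ?R) * (\<Prod>S * of_nat (k P) * pd i P + P * Y)"
    unfolding pw Y by (simp add: algebra_simps)
  finally show ?case using insert.hyps by simp
qed simp

lemma logd:
  assumes "F \<noteq> 0"
  shows "mult_part F * logd F i = rad_part F * pd i (mult_part F)"
proof -
  obtain u where u: "rad_part F = \<Prod>(prime_factors F) * u" using rad_part_eq[OF assms] by blast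
  have "mult_part F dvd rad_part F * pd i (mult_part F)"
    using dvd_mult[OF mult_part_dvd_aux[of "prime_factors F" "\<lambda>P. multiplicity P F - 1" i], of u]
    by (simp add: mult_part_def u mult_ac)
  then show ?thesis unfolding logd_def by simp
qed

lemma mult_part_form:
  assumes "F \<noteq> 0"
  shows "mult_part F * (rad_part F * pd i A - A * logd F i) =
    rad_part F * (mult_part F * pd i A - A * pd i (mult_part F))"
  using logd[OF assms, of i] by algebra

text \<open>The ring identity behind the closedness of d(A/R), isolated from
  \<open>closed_form\<close>: q and p are derivatives of R = \<open>mult_part\<close>, wj and wi
  those of W = \<open>rad_part\<close>, X and Y the mixed derivatives of the components vi and vj,
  and zi and zj the wronskians of A and R. In m1 - m2 the second derivatives cancel, which leaves 2
  * w.\<close>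

lemma wedge_identity:
  fixes W :: "'a::comm_ring_1"
  assumes "q * vi + R * X = wj * zi + W * m1" and "p * vj + R * Y = wi * zj + W * m2"
    and "q * vi - p * vj = W * w" and "m1 - m2 = 2 * w"
  shows "W * (R * X) - W * (R * Y) = wj * (W * zi) - wi * (W * zj) + W * (q * vi - p * vj)"
proof -
  have eq: "R * X = wj * zi + W * m1 - q * vi" "R * Y = wi * zj + W * m2 - p * vj"
    using assms(1,2) by (simp_all add: eq_diff_eq add.commute)
  have "W * (R * X) - W * (R * Y) = wj * (W * zi) - wi * (W * zj) + W * (W * (m1 - m2))
      - W * (q * vi - p * vj)"
    unfolding eq by (simp add: algebra_simps)
  also have "W * (W * (m1 - m2)) = W * (q * vi - p * vj) + W * (q * vi - p * vj)"
    unfolding assms(3,4) by (simp add: algebra_simps)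
  finally show ?thesis by simp
qed

context
  fixes F :: "'k::{field_gcd, field_char_0} poly poly poly" and d :: nat
  assumes F: "F \<noteq> 0" "hom d F"
begin

lemma prime_factor_hom': "P \<in> prime_factors F \<Longrightarrow> hom (tdeg3 P) P"
  using prime_factor_hom[OF _ _ F] prime_factorsD(1,2)
  by (metis hom_tdeg3 prime_elem_not_zeroI prime_elem_def)

lemma prime_factor_tdeg3_pos: "P \<in> prime_factors F \<Longrightarrow> tdeg3 P > 0"
  using prime_factor_hom' prime_factorsD(1) prime_hom_pos by blast

lemma hom_mult_part: "hom (omega_nat F) (mult_part F)"
  unfolding mult_part_def omega_nat_def
  by (intro hom_prod hom_power prime_factor_hom')

lemma hom_rad_part: "hom (d - omega_nat F) (rad_part F)"
  by (rule hom_div[of d "mult_part F"])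
    (use F mult_rad_part[of F] hom_mult_part mult_part_nonzero in auto)

lemma omega_nat_le: "omega_nat F \<le> d"
proof -
  have "rad_part F \<noteq> 0" using mult_rad_part F(1) by force
  then obtain i j k where "cf (rad_part F) i j k \<noteq> 0" by (rule cf_nonzeroE)
  then show ?thesis
    using hom_cofactor[of d "mult_part F" "rad_part F" "omega_nat F" i j k] mult_rad_part[OF F(1)]
      F(2) hom_mult_part mult_part_nonzero[of F] by simp
qed

lemma hom_mult_logd:
  assumes "hom (omega_nat F) A"
  shows "hom (d - 1) (A * logd F i)"
proof -
  have "hom (d - omega_nat F + omega_nat F - 1) (rad_part F * pd i (mult_part F))"
    by (rule hom_mult_pd[OF hom_rad_part hom_mult_part])
  then have "hom (d - 1) (mult_part F * logd F i)"
    by (simp add: logd F(1) omega_nat_le)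
  then have "hom (omega_nat F + (d - 1)) (mult_part F * (A * logd F i))"
    using hom_mult[OF assms] by (metis mult.left_commute)
  from hom_div[OF this hom_mult_part mult_part_nonzero] show ?thesis by simp
qed

lemma hom_form:
  assumes A: "hom (omega_nat F) A"
  shows "hom (d - 1) (form F lam A i)"
proof -
  have "hom (d - 1) ((F div P) * pd i P)" if P: "P \<in> prime_factors F" for P
  proof -
    have PF: "P * (F div P) = F" using prime_factorsD(2)[OF P] by simp
    have "P \<noteq> 0" using PF F(1) by auto
    have h: "hom (tdeg3 P) P" using prime_factor_hom' P by blast
    have "hom (d - tdeg3 P) (F div P)"
      by (rule hom_div[of d P]) (use PF F(2) h \<open>P \<noteq> 0\<close> in auto)
    from hom_mult_pd[OF this h] have "hom (d - tdeg3 P + tdeg3 P - 1) (F div P * pd i P)" .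
    moreover have "tdeg3 P \<le> d"
    proof -
      have "F div P \<noteq> 0" using PF F(1) by force
      then obtain a b c where "cf (F div P) a b c \<noteq> 0" by (rule cf_nonzeroE)
      then show ?thesis using hom_cofactor[of d P "F div P" "tdeg3 P" a b c] PF F(2) h \<open>P \<noteq> 0\<close> by simp
    qed
    ultimately show ?thesis by simp
  qed
  moreover have "hom (d - 1) (rad_part F * pd i A)"
    using hom_mult_pd[OF hom_rad_part A, of i] omega_nat_le by simp
  ultimately show ?thesis unfolding form_def
    by (intro hom_add hom_diff hom_sum hom_const3_mult hom_mult_logd A)
qed

text \<open>Contraction with the Euler field takes dP/P to deg P, and d(A/R) to 0 because A/R has
  degree 0. What remains is the sum of the residues weighted by the degrees.\<close>

lemma euler_form:
  assumes A: "hom (omega_nat F) A"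
    and lam: "(\<Sum>P\<in>prime_factors F. lam P * of_nat (tdeg3 P)) = 0"
  shows "(\<Sum>i<3. xv i * form F lam A i) = 0"
proof -
  let ?R = "mult_part F" and ?W = "rad_part F"
  have 1: "(\<Sum>i<3. xv i * (const3 (lam P) * ((F div P) * pd i P))) = const3 (lam P * of_nat (tdeg3 P)) * F"
    if P: "P \<in> prime_factors F" for P
  proof -
    have "(\<Sum>i<3. xv i * (const3 (lam P) * ((F div P) * pd i P))) = const3 (lam P) * (F div P) * euler P"
      by (simp add: euler_def sum_distrib_left mult_ac)
    also have "euler P = of_nat (tdeg3 P) * P"
      using prime_factor_hom'[OF P] by (simp add: hom_iff_euler)
    also have "const3 (lam P) * (F div P) * \<dots> = const3 (lam P) * of_nat (tdeg3 P) * (F div P * P)"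
      by (simp add: mult_ac)
    also have "F div P * P = F" using prime_factorsD(2)[OF P] by simp
    finally show ?thesis by (simp add: const3_mult const3_of_nat)
  qed
  have "?R * (\<Sum>i<3. xv i * (?W * pd i A - A * logd F i)) =
      (\<Sum>i<3. xv i * (?W * (?R * pd i A - A * pd i ?R)))"
    by (simp add: sum_distrib_left mult.left_commute[of ?R] mult_part_form F(1))
  also have "\<dots> = ?W * (?R * euler A - A * euler ?R)"
    by (simp add: euler_def sum_distrib_left right_diff_distrib sum_subtractf mult_ac)
  also have "\<dots> = 0"
    using A hom_mult_part by (simp add: hom_iff_euler mult_ac)
  finally have 2: "(\<Sum>i<3. xv i * (?W * pd i A - A * logd F i)) = 0"
    using mult_part_nonzero[of F] by simp
  have "(\<Sum>i<3. xv i * form F lam A i) =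
     (\<Sum>i<3. \<Sum>P\<in>prime_factors F. xv i * (const3 (lam P) * ((F div P) * pd i P)))
      + (\<Sum>i<3. xv i * (?W * pd i A - A * logd F i))"
    unfolding form_def by (simp only: distrib_left sum.distrib sum_distrib_left)
  also have "\<dots> = (\<Sum>P\<in>prime_factors F. const3 (lam P * of_nat (tdeg3 P)) * F)"
    unfolding 2 by (subst sum.swap) (simp add: 1 cong: sum.cong)
  also have "\<dots> = const3 (\<Sum>P\<in>prime_factors F. lam P * of_nat (tdeg3 P)) * F"
    by (simp add: const3_sum sum_distrib_right)
  finally show ?thesis by (simp add: lam)
qed

text \<open>This is d(v/F) = 0 for v = \<open>form F lam A\<close>, multiplied by F^2. The property
  is linear in v, so dP/P and d(A/R) can be checked separately.\<close>

lemma closed_form: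
  "F * (pd j (form F lam A i) - pd i (form F lam A j)) = pd j F * form F lam A i - pd i F * form F lam A j"
proof -
  let ?R = "mult_part F" and ?W = "rad_part F"
  note D = derivation.add[OF derivation_pd] derivation.mult[OF derivation_pd] derivation.diff[OF derivation_pd]
  define cl where "cl v \<longleftrightarrow> F * (pd j (v i) - pd i (v j)) = pd j F * v i - pd i F * v j" for v
  have add: "cl (\<lambda>i. v i + w i)" if "cl v" "cl w" for v w
    using that unfolding cl_def D by algebra
  have scale: "cl (\<lambda>i. const3 c * v i)" if "cl v" for c v
    using that unfolding cl_def pd_const3_mult by algebra
  have sum: "cl (\<lambda>i. \<Sum>P\<in>S. v P i)" if "\<And>P. P \<in> S \<Longrightarrow> cl (v P)" for S v
    using that
  proof (induction S rule: infinite_finite_induct)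
    case (insert P S)
    then show ?case using add[of "v P" "\<lambda>i. \<Sum>P\<in>S. v P i"] by simp
  qed (simp_all add: cl_def derivation.zero[OF derivation_pd])
  have "cl (\<lambda>i. (F div P) * pd i P)" if P: "P \<in> prime_factors F" for P
  proof -
    define U where "U = F div P"
    have FU: "F = P * U" using prime_factorsD(2)[OF P] by (simp add: U_def)
    show ?thesis unfolding cl_def U_def[symmetric] D pd_commute[of j i P] unfolding FU D by (simp add: algebra_simps)
  qed
  moreover have "cl (\<lambda>i. ?W * pd i A - A * logd F i)"
  proof -
    define v where "v i = ?W * pd i A - A * logd F i" for i
    have v: "?R * v i = ?W * (?R * pd i A - A * pd i ?R)" for i
      unfolding v_def using mult_part_form F(1) by blast
    \<comment> \<open>The numerator v of d(A/R) is a wronskian only after multiplication by R, so it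
      is this product that is differentiated.\<close>
    have dv: "pd j ?R * v i + ?R * pd j (v i) = pd j ?W * (?R * pd i A - A * pd i ?R)
        + ?W * (pd j ?R * pd i A + ?R * pd j (pd i A) - (pd j A * pd i ?R + A * pd j (pd i ?R)))" for i j
      using arg_cong[OF v, of "pd j" i] unfolding D .
    obtain R W where RW: "R = ?R" "W = ?W" by blast
    have FRW: "F = R * W" unfolding RW using mult_rad_part[OF F(1)] .
    have "?R * (pd j ?R * v i - pd i ?R * v j) = ?R * (?W * (pd j ?R * pd i A - pd i ?R * pd j A))"
      using v[of i] v[of j] by algebra
    then have *: "pd j ?R * v i - pd i ?R * v j = ?W * (pd j ?R * pd i A - pd i ?R * pd j A)"
      using mult_part_nonzero[of F] by simp
    have "F * (pd j (v i) - pd i (v j)) = ?W * (?R * pd j (v i)) - ?W * (?R * pd i (v j))"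
      unfolding RW[symmetric] by (simp only: FRW algebra_simps)
    also have "\<dots> = pd j ?W * (?R * v i) - pd i ?W * (?R * v j) + ?W * (pd j ?R * v i - pd i ?R * v j)"
      unfolding v
    proof (rule wedge_identity[OF dv[of j i] dv[of i j] *])
      show "pd j ?R * pd i A + ?R * pd j (pd i A) - (pd j A * pd i ?R + A * pd j (pd i ?R))
          - (pd i ?R * pd j A + ?R * pd i (pd j A) - (pd i A * pd j ?R + A * pd i (pd j ?R)))
          = 2 * (pd j ?R * pd i A - pd i ?R * pd j A)"
        unfolding pd_commute[of j i] by (simp add: algebra_simps)
    qed
    also have "\<dots> = pd j F * v i - pd i F * v j"
      unfolding RW[symmetric] by (simp only: FRW D algebra_simps)
    finally show ?thesis unfolding cl_def v_def .
  qed
  ultimately have "cl (form F lam A)"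
    unfolding form_def[abs_def] by (intro add sum scale; simp)
  then show ?thesis unfolding cl_def .
qed

lemma power_dvd_div_prime_factor:
  assumes P: "P \<in> prime_factors F" and Q: "Q \<in> prime_factors F"
  shows "P ^ n dvd F div Q \<longleftrightarrow> n + (if P = Q then 1 else 0) \<le> multiplicity P F"
proof -
  define U where "U = F div Q"
  have pr: "prime P" "prime Q" using P Q by auto
  have FQ: "F = Q * U" using prime_factorsD(2)[OF Q] by (simp add: U_def)
  have nz: "Q \<noteq> 0" "U \<noteq> 0" using FQ F(1) by auto
  have "multiplicity P F = multiplicity P Q + multiplicity P U"
    unfolding FQ using pr nz by (intro prime_elem_multiplicity_mult_distrib) auto
  moreover have "multiplicity P Q = (if P = Q then 1 else 0)"
    using pr prime_multiplicity_other[of P Q] by simp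
  moreover have "P ^ n dvd U \<longleftrightarrow> n \<le> multiplicity P U"
    by (rule power_dvd_iff_le_multiplicity) (use nz pr not_prime_unit in auto)
  ultimately show ?thesis unfolding U_def[symmetric] by simp
qed

text \<open>At a prime \<open>P\<close> where \<open>A\<close> has smaller order than \<open>R\<close>, the exact part \<open>d(A/R)\<close> has
  a pole of order at least 2, which no logarithmic form can cancel.\<close>
lemma form_eq_0D:
  assumes A: "hom (omega_nat F) A" and 0: "\<And>i. i < 3 \<Longrightarrow> form F lam A i = 0"
  shows "\<exists>c. A = const3 c * mult_part F" and "\<And>P. P \<in> prime_factors F \<Longrightarrow> lam P = 0"
proof -
  let ?R = "mult_part F" and ?W = "rad_part F"
  define Lg where "Lg i = (\<Sum>P\<in>prime_factors F. const3 (lam P) * ((F div P) * pd i P))" for i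
  have eq: "?W * (?R * pd i A - A * pd i ?R) = - (?R * Lg i)" if "i < 3" for i
  proof -
    have "Lg i + (?W * pd i A - A * logd F i) = 0"
      using 0[OF that] unfolding form_def Lg_def .
    then have "?R * Lg i + ?R * (?W * pd i A - A * logd F i) = 0"
      by (metis distrib_left mult_zero_right)
    then show ?thesis unfolding mult_part_form[OF F(1)] by (metis eq_neg_iff_add_eq_0 add.commute)
  qed
  have mult_le: "multiplicity P F - 1 \<le> multiplicity P A" if P: "P \<in> prime_factors F" and "A \<noteq> 0" for P
  proof (rule ccontr)
    define j where "j = multiplicity P A"
    define m where "m = multiplicity P F - 1"
    assume "\<not> ?thesis"
    then have jm: "j < m" by (simp add: j_def m_def)
    have pr: "prime P" "prime_elem P" "\<not> is_unit P"
      using in_prime_factors_imp_prime[OF P] by (auto simp: not_prime_unit)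
    obtain A' where A': "A = P ^ j * A'" "\<not> P dvd A'"
      using multiplicity_decompose'[OF \<open>A \<noteq> 0\<close> pr(3)] unfolding j_def .
    have "multiplicity P ?R = m"
      unfolding mult_part_def m_def
      by (subst multiplicity_prod_prime_powers) (use P in auto)
    then obtain R' where R': "?R = P ^ m * R'" "\<not> P dvd R'"
      using multiplicity_decompose'[OF mult_part_nonzero[of F] pr(3)] by auto
    obtain i where i: "i < 3" "\<not> P dvd pd i P"
      using prime_not_dvd_pd[OF pr(2) prime_factor_hom'[OF P]] by auto
    have nd: "\<not> P ^ (j + m + 1) dvd P * (?R * pd i A - A * pd i ?R)"
      by (rule prime_power_not_dvd_wronskian[OF pr(2) i(2) _ A' R']) (use jm in simp)
    obtain u where u: "is_unit u" "?W = \<Prod>(prime_factors F) * u"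
      using rad_part_eq[OF F(1)] by blast
    moreover have "P dvd \<Prod>(prime_factors F)" using P by (intro dvd_prod_eqI[of _ P]) auto
    ultimately have "P dvd ?W" by simp
    then obtain W' where W': "?W = P * W'" ..
    have "\<not> P dvd W'"
    proof
      assume "P dvd W'"
      then obtain W'' where "W' = P * W''" ..
      then have "F = P ^ (m + 2) * (R' * W'')"
        using trans[OF mult_rad_part[OF F(1)] arg_cong2[OF R'(1) W', of "(*)"]]
        by (metis (no_types, opaque_lifting) ab_semigroup_mult_class.mult_ac(1) mult.left_commute power_add power2_eq_square)
      then have "P ^ (m + 2) dvd F" by simp
      then have "m + 2 \<le> multiplicity P F"
        using power_dvd_iff_le_multiplicity[of F P "m + 2"] F(1) pr by simp
      then show False unfolding m_def by simp
    qed
    \<comment> \<open>P divides \<open>rad_part F\<close> exactly once, so the cofactor W' can be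
      cancelled from the divisibility by P^(2m) derived next.\<close>
    then have "coprime (P ^ (m + m)) W'" using prime_elem_imp_coprime[OF pr(2)] by simp
    moreover have "P ^ m dvd Lg i" unfolding Lg_def
      by (intro dvd_sum dvd_mult dvd_mult2) (auto simp: power_dvd_div_prime_factor[OF P] m_def dest: prime_factorsD(3))
    then have "P ^ (m + m) dvd ?R * Lg i" unfolding R'(1) power_add
      by (intro mult_dvd_mono) auto
    then have "P ^ (m + m) dvd - (?R * Lg i)" by simp
    then have "P ^ (m + m) dvd W' * (P * (?R * pd i A - A * pd i ?R))"
      unfolding eq[OF i(1), symmetric] W' by (simp only: mult_ac)
    ultimately have "P ^ (m + m) dvd P * (?R * pd i A - A * pd i ?R)"
      by (simp add: coprime_dvd_mult_right_iff)
    moreover have "P ^ (j + m + 1) dvd P ^ (m + m)" using jm by (intro le_imp_power_dvd) simp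
    ultimately show False using nd dvd_trans by blast
  qed
  have "?R dvd A" if "A \<noteq> 0"
  proof (rule multiplicity_le_imp_dvd[OF mult_part_nonzero])
    fix p :: "'k poly poly poly" assume "prime p"
    then have "multiplicity p ?R = (if p \<in> prime_factors F then multiplicity p F - 1 else 0)"
      unfolding mult_part_def by (intro multiplicity_prod_prime_powers) auto
    then show "multiplicity p ?R \<le> multiplicity p A"
      using mult_le[OF _ that] by simp
  qed
  then have "?R dvd A" by (cases "A = 0") auto
  then obtain B where B: "A = ?R * B" ..
  have "hom (omega_nat F - omega_nat F) B"
    by (rule hom_div[of _ ?R]) (use A hom_mult_part mult_part_nonzero[of F] in \<open>auto simp flip: B\<close>)
  then obtain c where "B = const3 c" by (auto elim: hom_0_imp_const3)
  with B have Ac: "A = const3 c * ?R" by (simp add: mult.commute)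
  then show "\<exists>c. A = const3 c * ?R" by blast
  have Lg0: "Lg i = 0" if "i < 3" for i
  proof -
    have "?R * Lg i = 0" using eq[OF that] by (simp add: Ac pd_const3_mult)
    then show ?thesis using mult_part_nonzero[of F] by simp
  qed
  fix P assume P: "P \<in> prime_factors F"
  have pr: "prime_elem P" using prime_factorsD(1)[OF P] .
  define e where "e = multiplicity P F"
  have e: "e > 0" using prime_factorsD(3)[OF P] by (simp add: e_def)
  obtain i where i: "i < 3" "\<not> P dvd pd i P"
    using prime_not_dvd_pd[OF pr prime_factor_hom'[OF P]] by auto
  \<comment> \<open>Only the summand of P lacks the power P^e, since F div P contains just e - 1
    factors P. The relation would force the power on it unless its coefficient vanishes.\<close>
  let ?g = "\<lambda>P. const3 (lam P) * ((F div P) * pd i P)"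
  have "P ^ e dvd sum ?g (prime_factors F - {P})"
    by (intro dvd_sum dvd_mult dvd_mult2) (auto simp: power_dvd_div_prime_factor[OF P] e_def)
  moreover have "?g P + sum ?g (prime_factors F - {P}) = 0"
    using Lg0[OF i(1)] P unfolding Lg_def by (simp add: sum.remove)
  ultimately have dv: "P ^ e dvd ?g P" by (simp add: add_eq_0_iff2)
  show "lam P = 0"
  proof (rule ccontr)
    assume "lam P \<noteq> 0"
    then have "is_unit (const3 (lam P))" by (rule is_unit_const3)
    then have "P ^ e dvd (F div P) * pd i P" using dv by (simp add: dvd_mult_unit_iff')
    moreover have "coprime (P ^ e) (pd i P)" using prime_elem_imp_coprime[OF pr i(2)] by simp
    ultimately have "P ^ e dvd F div P" by (simp add: coprime_dvd_mult_left_iff)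
    then show False using power_dvd_div_prime_factor[OF P P] by (simp add: e_def)
  qed
qed

end

section \<open>The dimension bound\<close>

text \<open>Gaussian elimination by induction on the equations: an unknown u0 with nonzero
  coefficient in the equation e is eliminated from the others, and N is the reduced system.\<close>

lemma nontrivial_solution:
  fixes M :: "'u \<Rightarrow> 'e \<Rightarrow> 'k::field"
  assumes "finite E" "finite U" "card E < card U"
  shows "\<exists>x. (\<exists>u\<in>U. x u \<noteq> 0) \<and> (\<forall>e\<in>E. (\<Sum>u\<in>U. x u * M u e) = 0)"
  using assms
proof (induction E arbitrary: U M rule: finite_induct)
  case empty
  then have "U \<noteq> {}" by auto
  then show ?case by (intro exI[of _ "\<lambda>_. 1"]) auto
next
  case (insert e E)
  show ?case
  proof (cases "\<forall>u\<in>U. M u e = 0")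
    case True
    have "card E < card U" using insert.prems insert.hyps by simp
    from insert.IH[OF insert.prems(1) this, of M] True show ?thesis by auto
  next
    case False
    then obtain u0 where u0: "u0 \<in> U" "M u0 e \<noteq> 0" by auto
    define N where "N u e' = M u e' - M u e / M u0 e * M u0 e'" for u e'
    have "card E < card (U - {u0})" using insert.prems insert.hyps u0 by simp
    from insert.IH[OF _ this, of N] insert.prems obtain x u1 where
      x: "u1 \<in> U - {u0}" "x u1 \<noteq> 0" "\<And>e'. e' \<in> E \<Longrightarrow> (\<Sum>u\<in>U - {u0}. x u * N u e') = 0"
      by auto
    define s where "s = (\<Sum>u\<in>U - {u0}. x u * M u e)"
    define y where "y = x(u0 := - s / M u0 e)"
    have y: "(\<Sum>u\<in>U. y u * M u e') = - s / M u0 e * M u0 e' + (\<Sum>u\<in>U - {u0}. x u * M u e')" for e'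
    proof -
      have "(\<Sum>u\<in>U - {u0}. y u * M u e') = (\<Sum>u\<in>U - {u0}. x u * M u e')"
        by (rule sum.cong) (auto simp: y_def)
      then show ?thesis using sum.remove[OF insert.prems(1) u0(1), of "\<lambda>u. y u * M u e'"]
        by (simp add: y_def)
    qed
    have "(\<Sum>u\<in>U. y u * M u e') = 0" if "e' \<in> insert e E" for e'
    proof (cases "e' = e")
      case True
      then show ?thesis using u0(2) by (simp add: y s_def)
    next
      case False
      then have "0 = (\<Sum>u\<in>U - {u0}. x u * N u e')" using x(3) that by auto
      also have "\<dots> = (\<Sum>u\<in>U - {u0}. x u * M u e') - s / M u0 e * M u0 e'"
        by (simp add: N_def right_diff_distrib sum_subtractf s_def sum_divide_distrib sum_distrib_left mult_ac)
      finally show ?thesis by (simp add: y)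
    qed
    moreover have "y u1 \<noteq> 0" "u1 \<in> U" using x by (auto simp: y_def)
    ultimately show ?thesis by blast
  qed
qed

text \<open>Exponent pairs (b, c) of Y and X. With the exponent of Z filled up,
  \<open>Tri (Suc n)\<close> indexes the monomials of degree n.\<close>

definition Tri :: "nat \<Rightarrow> (nat \<times> nat) set" where
  "Tri m = (SIGMA b:{..<m}. {..<m - b})"

lemma Tri_iff: "(b, c) \<in> Tri m \<longleftrightarrow> b + c < m"
  by (auto simp: Tri_def)

lemma finite_Tri [simp]: "finite (Tri m)"
  by (simp add: Tri_def)

lemma card_Tri: "card (Tri m) = Suc m choose 2"
proof -
  have "card (Tri m) = (\<Sum>b<m. m - b)" by (simp add: Tri_def)
  also have "\<dots> = (\<Sum>b<m. Suc b)"
    by (subst sum.nat_diff_reindex[symmetric]) (auto intro: sum.cong)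
  also have "\<dots> = Suc m choose 2"
    by (induction m) (simp_all add: numeral_2_eq_2)
  finally show ?thesis .
qed

definition mono3 :: "nat \<Rightarrow> nat \<times> nat \<Rightarrow> 'a::comm_semiring_1 poly poly poly" where
  "mono3 n p = monom (monom (monom 1 (snd p)) (fst p)) (n - fst p - snd p)"

lemma cf_mono3: "cf (mono3 n p) a b c = (if a = n - fst p - snd p \<and> b = fst p \<and> c = snd p then 1 else 0)"
  by (auto simp: cf_def mono3_def coeff_monom)

lemma hom_mono3: "p \<in> Tri (Suc n) \<Longrightarrow> hom n (mono3 n p)"
  by (cases p) (auto simp: hom_def cf_mono3 Tri_iff split: if_splits)

text \<open>Coordinates on the triples of forms of degree \<open>d - 1\<close> annihilated by \<open>(X, Y, Z)\<close>.\<close>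
definition coords :: "nat \<Rightarrow> (nat \<times> nat \<times> nat) set" where
  "coords d = {0, 1} \<times> Tri (d - 1) \<union> {2} \<times> {1..d - 1} \<times> {0}"

definition coord :: "nat \<Rightarrow> nat \<times> nat \<times> nat \<Rightarrow> (nat \<Rightarrow> 'a::zero poly poly poly) \<Rightarrow> 'a" where
  "coord d = (\<lambda>(n, b, c) w. if n = 2 then cf (w 0) 0 b (d - 1 - b) else cf (w n) (d - 1 - b - c) b c)"

lemma finite_coords [simp]: "finite (coords d)"
  by (simp add: coords_def)

lemma two_choose_2: "2 * (Suc m choose 2) = m * Suc m"
  by (induction m) (simp_all add: numeral_2_eq_2)

lemma card_coords: "d \<ge> 1 \<Longrightarrow> card (coords d) = d\<^sup>2 - 1"
proof -
  assume d: "d \<ge> 1"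
  then obtain e where e: "d = Suc e" by (cases d) auto
  have "card (coords d) = card ({0, 1::nat} \<times> Tri (d - 1)) + card ({2::nat} \<times> {1..d - 1} \<times> {0::nat})"
    unfolding coords_def by (rule card_Un_disjoint) auto
  also have "\<dots> = 2 * (Suc e choose 2) + e"
    by (simp add: card_cartesian_product card_Tri e)
  also have "\<dots> = d\<^sup>2 - 1" unfolding two_choose_2 e by (simp add: power2_eq_square)
  finally show ?thesis .
qed

lemma coord_sum: "coord d q (\<lambda>i. \<Sum>u\<in>U. const3 (x u) * g u i) = (\<Sum>u\<in>U. x u * coord d q (g u))"
  by (cases q) (simp add: coord_def cf_sum cf_const3_mult)

text \<open>The coordinates tagged 0 and 1 are the coefficients of w 0 and w 1 at monomials
  containing Z. Modulo Z the relation reads X * w 0 + Y * w 1 = 0, so w 0 has no pure power of X;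
  its other coefficients without Z are the coordinates tagged 2. Once w 0 is 0, the relation gives w
  1 and then w 2.\<close>

lemma euler_triple_eq_0:
  fixes w :: "nat \<Rightarrow> 'a::{idom, ring_char_0} poly poly poly"
  assumes hom: "\<And>i. i < 3 \<Longrightarrow> hom (d - 1) (w i)"
    and eul: "(\<Sum>i<3. xv i * w i) = 0"
    and co: "\<And>q. q \<in> coords d \<Longrightarrow> coord d q w = 0"
    and "i < 3"
  shows "w i = 0"
proof -
  have "{..<3} = {0, Suc 0, 2::nat}" by auto
  then have e: "xv 0 * w 0 + (xv (Suc 0) * w (Suc 0) + xv 2 * w 2) = 0" using eul by simp
  have e': "cf (xv 0 * w 0) a b c + (cf (xv (Suc 0) * w (Suc 0)) a b c + cf (xv 2 * w 2) a b c) = 0" for a b c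
    using arg_cong[OF e, of "\<lambda>p. cf p a b c"] by (simp add: cf_add)
  have pos: "cf (w n) a b c = 0" if "a > 0" "n = 0 \<or> n = Suc 0" for n a b c
  proof (rule ccontr)
    assume nz: "cf (w n) a b c \<noteq> 0"
    then have "a + b + c = d - 1" using hom[of n] that unfolding hom_def by auto
    then have "a = d - 1 - b - c" "(n, b, c) \<in> coords d" using that by (auto simp: coords_def Tri_iff)
    then show False using co[of "(n, b, c)"] nz that by (auto simp: coord_def)
  qed
  have w0: "w 0 = 0"
  proof (rule cf_eqI)
    fix a b c
    show "cf (w 0) a b c = cf 0 a b c"
    proof (rule ccontr)
      assume "cf (w 0) a b c \<noteq> cf 0 a b c"
      then have nz: "cf (w 0) a b c \<noteq> 0" by simp
      then have s: "a + b + c = d - 1" using hom[of 0] unfolding hom_def by auto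
      have a: "a = 0" using pos[of a 0 b c] nz by auto
      show False
      proof (cases "b = 0")
        case True
        then show ?thesis using e'[of 0 0 "Suc c"] nz a by (simp add: cf_xv_mult)
      next
        case False
        then have "c = d - 1 - b" "(2, b, 0) \<in> coords d" using s a by (auto simp: coords_def)
        then show ?thesis using co[of "(2, b, 0)"] nz a by (auto simp: coord_def)
      qed
    qed
  qed
  have w1: "w (Suc 0) = 0"
  proof (rule cf_eqI)
    fix a b c
    show "cf (w (Suc 0)) a b c = cf 0 a b c"
      using pos[of a "Suc 0" b c] e'[of 0 "Suc b" c] by (cases a) (auto simp: cf_xv_mult w0)
  qed
  have "xv 2 * w 2 = 0" using e by (simp add: w0 w1)
  then have "w 2 = 0" by (auto simp: xv_def)
  moreover have "i = 0 \<or> i = Suc 0 \<or> i = 2" using assms(4) by auto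
  ultimately show ?thesis using w0 w1 by auto
qed

text \<open>\<open>form F lam A\<close> is linear in lam and A; these are its values on a basis,
  \<open>Inl P\<close> standing for the residue at P and \<open>Inr p\<close> for a monomial of
  A.\<close>

definition form_gen :: "'k::field_gcd poly poly poly \<Rightarrow> 'k poly poly poly + nat \<times> nat \<Rightarrow> nat \<Rightarrow> 'k poly poly poly" where
  "form_gen F u i = (case u of
      Inl P \<Rightarrow> (F div P) * pd i P
    | Inr p \<Rightarrow> rad_part F * pd i (mono3 (omega_nat F) p) - mono3 (omega_nat F) p * logd F i)"

definition form_idx :: "'k::field_gcd poly poly poly \<Rightarrow> ('k poly poly poly + nat \<times> nat) set" where
  "form_idx F = prime_factors F <+> Tri (Suc (omega_nat F))"

lemma finite_form_idx [simp]: "finite (form_idx F)"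
  by (simp add: form_idx_def)

lemma card_form_idx: "card (form_idx F) = card (prime_factors F) + (omega_nat F + 2 choose 2)"
  by (simp add: form_idx_def card_Plus card_Tri)

lemma form_conv_gen:
  "form F (\<lambda>P. x (Inl P)) (\<Sum>p\<in>Tri (Suc (omega_nat F)). const3 (x (Inr p)) * mono3 (omega_nat F) p) i
    = (\<Sum>u\<in>form_idx F. const3 (x u) * form_gen F u i)"
  by (simp add: form_idx_def sum.Plus form_gen_def form_def derivation.sum[OF derivation_pd]
      pd_const3_mult sum_distrib_left sum_distrib_right sum_subtractf right_diff_distrib mult_ac)

text \<open>A count of unknowns and equations. The unknowns are the coefficients of all the forms;
  the equations are the d^2 - 1 coordinates of their sum and two more for each member: the residue
  condition of \<open>euler_form\<close>, and the vanishing of one coefficient of A, which fixes A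
  modulo multiples of R. These two account for the -2. If the bound failed, a nontrivial solution
  would contradict \<open>indep\<close> together with \<open>form_eq_0D\<close>.\<close>

lemma dim_bound:
  fixes Fm :: "'i \<Rightarrow> 'k::{field_gcd, field_char_0} poly poly poly"
  assumes S: "finite S" and d: "d \<ge> 1"
    and F: "\<And>t. t \<in> S \<Longrightarrow> Fm t \<noteq> 0" "\<And>t. t \<in> S \<Longrightarrow> hom d (Fm t)"
    and indep: "\<And>lam A t i. (\<And>t. t \<in> S \<Longrightarrow> hom (omega_nat (Fm t)) (A t)) \<Longrightarrow>
       (\<And>t. t \<in> S \<Longrightarrow> (\<Sum>P\<in>prime_factors (Fm t). lam t P * of_nat (tdeg3 P)) = 0) \<Longrightarrow>
       (\<And>i. i < 3 \<Longrightarrow> (\<Sum>t\<in>S. form (Fm t) (lam t) (A t) i) = 0) \<Longrightarrow>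
       t \<in> S \<Longrightarrow> i < 3 \<Longrightarrow> form (Fm t) (lam t) (A t) i = 0"
  shows "(\<Sum>t\<in>S. int (card (form_idx (Fm t))) - 2) \<le> int d ^ 2 - 1"
proof (rule ccontr)
  assume "\<not> ?thesis"
  then have gt: "(\<Sum>t\<in>S. int (card (form_idx (Fm t)))) > int d ^ 2 - 1 + 2 * int (card S)"
    by (simp add: sum_subtractf)
  \<comment> \<open>A monomial p0 that occurs in R = \<open>mult_part\<close>: requiring its
    coefficient in A to vanish excludes the nonzero multiples of R.\<close>
  have "\<exists>p\<in>Tri (Suc (omega_nat (Fm t))). cf (mult_part (Fm t)) (omega_nat (Fm t) - fst p - snd p) (fst p) (snd p) \<noteq> 0"
    if t: "t \<in> S" for t
  proof -
    obtain a b c where nz: "cf (mult_part (Fm t)) a b c \<noteq> 0"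
      using mult_part_nonzero by (rule cf_nonzeroE)
    then have "a + b + c = omega_nat (Fm t)" using hom_mult_part[OF F[OF t]] unfolding hom_def by blast
    then have "a = omega_nat (Fm t) - b - c" "(b, c) \<in> Tri (Suc (omega_nat (Fm t)))"
      by (auto simp: Tri_iff)
    then show ?thesis using nz by (intro bexI[of _ "(b, c)"]) simp_all
  qed
  then obtain p0 where p0: "\<And>t. t \<in> S \<Longrightarrow> p0 t \<in> Tri (Suc (omega_nat (Fm t)))"
    "\<And>t. t \<in> S \<Longrightarrow> cf (mult_part (Fm t)) (omega_nat (Fm t) - fst (p0 t) - snd (p0 t)) (fst (p0 t)) (snd (p0 t)) \<noteq> 0"
    by metis
  define U where "U = Sigma S (\<lambda>t. form_idx (Fm t))"
  define E where "E = coords d <+> (S <+> S)"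
  \<comment> \<open>The rows of the system: coordinates of the sum, residue condition at s,
    coefficient of the monomial p0 s in A s.\<close>
  define M :: "'i \<times> ('k poly poly poly + nat \<times> nat) \<Rightarrow> nat \<times> nat \<times> nat + ('i + 'i) \<Rightarrow> 'k" where
    "M u e = (case e of
        Inl q \<Rightarrow> coord d q (form_gen (Fm (fst u)) (snd u))
      | Inr (Inl s) \<Rightarrow> if s = fst u then (case snd u of Inl P \<Rightarrow> of_nat (tdeg3 P) | _ \<Rightarrow> 0) else 0
      | Inr (Inr s) \<Rightarrow> if s = fst u then (case snd u of Inl P \<Rightarrow> 0 | Inr p \<Rightarrow> if p = p0 s then 1 else 0) else 0)"
    for u e
  have "int (card E) = int d ^ 2 - 1 + 2 * int (card S)"
  proof -
    have "card E = (d\<^sup>2 - 1) + (card S + card S)" using S d by (simp add: E_def card_Plus card_coords)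
    moreover have "int (d\<^sup>2 - 1) = int d ^ 2 - 1" using d by (subst of_nat_diff) auto
    ultimately show ?thesis by simp
  qed
  moreover have "int (card U) = (\<Sum>t\<in>S. int (card (form_idx (Fm t))))"
    using S by (simp add: U_def)
  ultimately have "card E < card U" using gt by simp
  moreover have "finite E" "finite U" using S by (auto simp: E_def U_def)
  ultimately obtain x u where u: "u \<in> U" "x u \<noteq> 0" and x: "\<And>e. e \<in> E \<Longrightarrow> (\<Sum>u\<in>U. x u * M u e) = 0"
    using nontrivial_solution[of E U M] by blast
  have inE: "q \<in> coords d \<Longrightarrow> Inl q \<in> E" "t \<in> S \<Longrightarrow> Inr (Inl t) \<in> E" "t \<in> S \<Longrightarrow> Inr (Inr t) \<in> E" for q t
    by (auto simp: E_def)
  have sumU: "(\<Sum>u\<in>U. h u) = (\<Sum>t\<in>S. \<Sum>v\<in>form_idx (Fm t). h (t, v))" for h :: "_ \<Rightarrow> 'b::comm_monoid_add"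
    unfolding U_def using S by (simp add: sum.Sigma)
  define lam where "lam t P = x (t, Inl P)" for t P
  define A where "A t = (\<Sum>p\<in>Tri (Suc (omega_nat (Fm t))). const3 (x (t, Inr p)) * mono3 (omega_nat (Fm t)) p)" for t
  have A: "hom (omega_nat (Fm t)) (A t)" for t
    unfolding A_def by (intro hom_sum hom_const3_mult hom_mono3)
  have fg: "form (Fm t) (lam t) (A t) i = (\<Sum>v\<in>form_idx (Fm t). const3 (x (t, v)) * form_gen (Fm t) v i)" for t i
    unfolding A_def lam_def[abs_def] by (rule form_conv_gen[of _ "\<lambda>v. x (t, v)"])
  have lam: "(\<Sum>P\<in>prime_factors (Fm t). lam t P * of_nat (tdeg3 P)) = 0" if t: "t \<in> S" for t
  proof -
    have "0 = (\<Sum>u\<in>U. x u * M u (Inr (Inl t)))" using x[OF inE(2)[OF t]] by simp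
    also have "\<dots> = (\<Sum>s\<in>S. if s = t then (\<Sum>P\<in>prime_factors (Fm t). lam t P * of_nat (tdeg3 P)) else 0)"
      unfolding sumU by (intro sum.cong) (auto simp: M_def form_idx_def sum.Plus lam_def)
    finally show ?thesis using t S by simp
  qed
  have x0: "x (t, Inr (p0 t)) = 0" if t: "t \<in> S" for t
  proof -
    have "0 = (\<Sum>u\<in>U. x u * M u (Inr (Inr t)))" using x[OF inE(3)[OF t]] by simp
    also have "\<dots> = (\<Sum>s\<in>S. if s = t then (\<Sum>p\<in>Tri (Suc (omega_nat (Fm t))). if p = p0 t then x (t, Inr p) else 0) else 0)"
      unfolding sumU by (intro sum.cong) (auto simp: M_def form_idx_def sum.Plus if_distrib[of "(*) _"] cong: if_cong)
    finally show ?thesis using t S p0 by simp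
  qed
  define w where "w i = (\<Sum>t\<in>S. form (Fm t) (lam t) (A t) i)" for i
  have w0: "w i = 0" if "i < 3" for i
  proof (rule euler_triple_eq_0[of d w])
    show "hom (d - 1) (w i)" for i
      unfolding w_def by (intro hom_sum hom_form F A)
    have "(\<Sum>i<3. xv i * w i) = (\<Sum>t\<in>S. \<Sum>i<3. xv i * form (Fm t) (lam t) (A t) i)"
      unfolding w_def sum_distrib_left by (rule sum.swap)
    also have "\<dots> = 0" by (rule sum.neutral, rule ballI, rule euler_form) (use F A lam in auto)
    finally show "(\<Sum>i<3. xv i * w i) = 0" .
    fix q assume q: "q \<in> coords d"
    have "w = (\<lambda>i. \<Sum>u\<in>U. const3 (x u) * form_gen (Fm (fst u)) (snd u) i)"
      unfolding w_def fg sumU by simp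
    then have "coord d q w = (\<Sum>u\<in>U. x u * coord d q (form_gen (Fm (fst u)) (snd u)))"
      by (simp add: coord_sum)
    also have "\<dots> = 0" using x[OF inE(1)[OF q]] by (simp add: M_def)
    finally show "coord d q w = 0" .
  qed (use that in simp)
  obtain t v where tv: "u = (t, v)" "t \<in> S" "v \<in> form_idx (Fm t)" using u(1) by (auto simp: U_def)
  have z: "form (Fm t) (lam t) (A t) i = 0" if "i < 3" for i
    by (rule indep[OF A lam _ tv(2) that]) (use w0 in \<open>simp_all add: w_def\<close>)
  obtain c where c: "A t = const3 c * mult_part (Fm t)"
    using form_eq_0D(1)[OF F[OF tv(2)] A z] by blast
  have cfA: "cf (A t) (omega_nat (Fm t) - fst p - snd p) (fst p) (snd p) = x (t, Inr p)"
    if p: "p \<in> Tri (Suc (omega_nat (Fm t)))" for p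
  proof -
    have "cf (A t) (omega_nat (Fm t) - fst p - snd p) (fst p) (snd p) =
       (\<Sum>p'\<in>Tri (Suc (omega_nat (Fm t))). if p' = p then x (t, Inr p') else 0)"
      unfolding A_def cf_sum cf_const3_mult
      by (intro sum.cong) (auto simp: cf_mono3 prod_eq_iff split: prod.splits)
    then show ?thesis using p by simp
  qed
  have "c = 0"
    using cfA[OF p0(1)[OF tv(2)]] x0[OF tv(2)] p0(2)[OF tv(2)] by (simp add: c cf_const3_mult)
  then have "x (t, Inr p) = 0" if "p \<in> Tri (Suc (omega_nat (Fm t)))" for p
    using cfA[OF that] by (simp add: c)
  moreover have "x (t, Inl P) = 0" if "P \<in> prime_factors (Fm t)" for P
    using form_eq_0D(2)[OF F[OF tv(2)] A z that] by (simp add: lam_def)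
  ultimately show False using u(2) tv by (auto simp: form_idx_def)
qed

section \<open>Lueroth's theorem\<close>

text \<open>Used twice, for the embeddings of K into the rational functions in one and in two
  variables.\<close>

locale field_embedding =
  fixes c :: "'k::field \<Rightarrow> 'q::field"
  assumes add [simp]: "c (x + y) = c x + c y"
    and mult [simp]: "c (x * y) = c x * c y"
    and one [simp]: "c 1 = 1"
begin

lemma zero [simp]: "c 0 = 0"
proof -
  have "c 0 = c 0 + c 0" using add[of 0 0] by (simp only: add_0_left)
  then show ?thesis by (metis add_cancel_right_right)
qed

lemma uminus [simp]: "c (- x) = - c x"
  using add[of x "- x"] by (simp add: eq_neg_iff_add_eq_0 add.commute)

lemma diff [simp]: "c (x - y) = c x - c y"
  using add[of x "- y"] by simp

lemma eq_0_iff [simp]: "c x = 0 \<longleftrightarrow> x = 0"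
proof
  assume "c x = 0"
  show "x = 0"
  proof (rule ccontr)
    assume "x \<noteq> 0"
    then have "c (x * inverse x) = 1" by simp
    then show False using \<open>c x = 0\<close> by (simp only: mult) simp
  qed
qed simp

definition ev :: "'k poly \<Rightarrow> 'q \<Rightarrow> 'q" where
  "ev a x = poly (map_poly c a) x"

lemma ev_0 [simp]: "ev 0 x = 0"
  by (simp add: ev_def)

lemma ev_pCons [simp]: "ev (pCons a p) x = c a + x * ev p x"
  by (simp add: ev_def map_poly_pCons)

lemma ev_add [simp]: "ev (p + q) x = ev p x + ev q x"
  by (induction p q rule: poly_induct2) (simp_all add: algebra_simps)

lemma ev_smult [simp]: "ev (smult a p) x = c a * ev p x"
  by (induction p) (simp_all add: algebra_simps)

lemma ev_mult [simp]: "ev (p * q) x = ev p x * ev q x"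
  by (induction p) (simp_all add: algebra_simps)

lemma ev_1 [simp]: "ev 1 x = 1"
  by (simp add: one_pCons)

definition subfield :: "'q set \<Rightarrow> bool" where
  "subfield M \<longleftrightarrow> range c \<subseteq> M \<and> (\<forall>x\<in>M. \<forall>y\<in>M. x + y \<in> M) \<and> (\<forall>x\<in>M. \<forall>y\<in>M. x * y \<in> M)
     \<and> (\<forall>x\<in>M. inverse x \<in> M)"

lemma subfieldD:
  assumes "subfield M"
  shows "c a \<in> M" "x \<in> M \<Longrightarrow> y \<in> M \<Longrightarrow> x + y \<in> M" "x \<in> M \<Longrightarrow> y \<in> M \<Longrightarrow> x * y \<in> M"
    "x \<in> M \<Longrightarrow> y \<in> M \<Longrightarrow> x - y \<in> M" "x \<in> M \<Longrightarrow> y \<in> M \<Longrightarrow> x / y \<in> M" "0 \<in> M" "1 \<in> M"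
proof -
  show 1: "c a \<in> M" for a using assms unfolding subfield_def by blast
  show 2: "x \<in> M \<Longrightarrow> y \<in> M \<Longrightarrow> x + y \<in> M" "x \<in> M \<Longrightarrow> y \<in> M \<Longrightarrow> x * y \<in> M" for x y
    using assms unfolding subfield_def by blast+
  show "x - y \<in> M" if "x \<in> M" "y \<in> M"
    using 2(1)[OF that(1) 2(2)[OF 1[of "- 1"] that(2)]] by simp
  show "x / y \<in> M" if "x \<in> M" "y \<in> M"
    using that assms 2 unfolding subfield_def divide_inverse by blast
  show "0 \<in> M" "1 \<in> M" using 1[of 0] 1[of 1] by simp_all
qed

lemma subfield_ev: "subfield M \<Longrightarrow> x \<in> M \<Longrightarrow> ev p x \<in> M"
  by (induction p) (auto intro!: subfieldD)

text \<open>The field K(h).\<close>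

definition gen :: "'q \<Rightarrow> 'q set" where
  "gen h = {ev a h / ev b h | a b. ev b h \<noteq> 0}"

lemma gen_subset: "subfield M \<Longrightarrow> h \<in> M \<Longrightarrow> gen h \<subseteq> M"
  by (auto simp: gen_def intro!: subfieldD(5) subfield_ev)

lemma genI: "ev b h \<noteq> 0 \<Longrightarrow> ev a h / ev b h \<in> gen h"
  by (auto simp: gen_def)

lemma gen_self: "h \<in> gen h"
  using genI[of 1 h "[:0, 1:]"] by simp

lemma subfield_gen: "subfield (gen h)"
  unfolding subfield_def
proof (intro conjI ballI)
  show "range c \<subseteq> gen h"
    using genI[of 1 h "[:a:]" for a] by auto
  fix x assume "x \<in> gen h"
  then obtain a b where x: "x = ev a h / ev b h" "ev b h \<noteq> 0" by (auto simp: gen_def)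
  show "inverse x \<in> gen h"
    using genI[of a h b] genI[of 1 h 0] x by (cases "ev a h = 0") auto
  fix y assume "y \<in> gen h"
  then obtain a' b' where y: "y = ev a' h / ev b' h" "ev b' h \<noteq> 0" by (auto simp: gen_def)
  show "x + y \<in> gen h"
    using genI[of "b * b'" h "a * b' + a' * b"] x y by (simp add: add_frac_eq)
  show "x * y \<in> gen h"
    using genI[of "b * b'" h "a * a'"] x y by simp
qed

lemma gen_mono: "y \<in> gen x \<Longrightarrow> gen y \<subseteq> gen x"
  by (rule gen_subset[OF subfield_gen])

end

section \<open>Polynomials in two variables S, T and rational functions in one variable\<close>

abbreviation fconst :: "'k::field \<Rightarrow> 'k poly fract" where
  "fconst x \<equiv> to_fract [:x:]"

interpretation K1: field_embedding fconst
  by unfold_locales (simp_all add: mult_to_poly to_fract_mult[symmetric] to_fract_add[symmetric] one_pCons[symmetric]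
    del: to_fract_mult to_fract_add)

lemma to_fract_smult: "to_fract (smult a p) = fconst a * to_fract p"
  by (simp flip: to_fract_mult)

abbreviation lift1 :: "'k::field poly \<Rightarrow> 'k poly poly" where
  "lift1 \<equiv> map_poly (\<lambda>x. [:x:])"

lemma poly_lift1_X: "poly (lift1 u) [:0, 1:] = u"
  by (induction u) (simp_all add: map_poly_pCons)

lemma lift1_1: "lift1 1 = 1"
  by (simp add: one_pCons map_poly_pCons)

lemma lift1_mult: "lift1 (p * q) = lift1 p * lift1 q"
proof (induction p)
  case (pCons a p)
  have "lift1 (smult a q) = smult [:a:] (lift1 q)" by (induction q) (simp_all add: map_poly_pCons)
  moreover have "lift1 (q + r) = lift1 q + lift1 r" for q r :: "'a poly"
    by (induction q r rule: poly_induct2) (simp_all add: map_poly_pCons)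
  ultimately show ?case using pCons by (simp add: map_poly_pCons)
qed simp

text \<open>The numerator of \<open>a(T)/b(T) - a(S)/b(S)\<close>; the outer variable is T and the inner one is S.\<close>
definition sep :: "'k::field poly \<Rightarrow> 'k poly \<Rightarrow> 'k poly poly" where
  "sep a b = smult b (lift1 a) - smult a (lift1 b)"

lemma coeff_sep: "coeff (sep a b) i = smult (coeff a i) b - smult (coeff b i) a"
  by (simp add: sep_def coeff_map_poly)

text \<open>Specializes the inner variable. For polynomials in X and Y the inner variable is X, so
  that this becomes restriction to the line X = t.\<close>

definition at_S :: "'k::field \<Rightarrow> 'k poly poly \<Rightarrow> 'k poly" where
  "at_S t P = map_poly (\<lambda>p. poly p t) P"

lemma at_S_mult: "at_S t (P * Q) = at_S t P * at_S t Q"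
  by (simp add: poly_eq_iff at_S_def coeff_map_poly coeff_mult poly_sum)

lemma at_S_sep: "at_S t (sep a b) = smult (poly b t) a - smult (poly a t) b"
  by (simp add: poly_eq_iff at_S_def coeff_map_poly coeff_sep mult.commute)

definition coeff_S :: "nat \<Rightarrow> 'k::field poly poly \<Rightarrow> 'k poly" where
  "coeff_S n P = map_poly (\<lambda>p. coeff p n) P"

lemma coeff_poly_const: "coeff (poly P [:t:]) n = poly (coeff_S n P) t"
  by (induction P) (simp_all add: coeff_S_def map_poly_pCons mult.commute)

lemma coeff_S_sep: "coeff_S n (sep a b) = smult (coeff b n) a - smult (coeff a n) b"
  by (simp add: poly_eq_iff coeff_S_def coeff_map_poly coeff_sep mult.commute)

lemma coeff_mult_const: "coeff (p * [:a:]) n = coeff p n * a"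
  for p :: "'k::field poly"
  by (simp add: mult.commute[of p])

lemma coeff_S_mult_lift1: "coeff_S n (P * lift1 q) = coeff_S n P * q"
proof (rule poly_eqI)
  fix i
  have "coeff (coeff (P * lift1 q) i) n = (\<Sum>j\<le>i. coeff (coeff P j * [:coeff q (i - j):]) n)"
    unfolding coeff_mult[of P] coeff_sum by (simp add: coeff_map_poly)
  also have "\<dots> = coeff (coeff_S n P * q) i"
    by (simp only: coeff_mult_const coeff_mult[of _ q]) (simp add: coeff_S_def coeff_map_poly)
  finally show "coeff (coeff_S n (P * lift1 q)) i = coeff (coeff_S n P * q) i"
    by (simp add: coeff_S_def coeff_map_poly)
qed

text \<open>\<open>poly P [:t:]\<close> is P at T = t, a polynomial in S. A nonzero coefficient in S
  is a nonzero polynomial in T and vanishes at finitely many t only.\<close>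

lemma generic_degree:
  fixes P :: "'k::field poly poly"
  assumes "n \<le> degree (coeff P i)" "coeff P i \<noteq> 0"
  shows "finite {t. degree (poly P [:t:]) < n}"
proof (rule finite_subset)
  let ?m = "degree (coeff P i)"
  show "{t. degree (poly P [:t:]) < n} \<subseteq> {t. poly (coeff_S ?m P) t = 0}"
    using assms(1) by (auto simp flip: coeff_poly_const intro: coeff_eq_0)
  have "coeff (coeff_S ?m P) i \<noteq> 0" using assms(2) by (simp add: coeff_S_def coeff_map_poly)
  then show "finite {t. poly (coeff_S ?m P) t = 0}" by (intro poly_roots_finite) auto
qed

lemma poly_sep: "poly (sep a b) [:t:] = smult (poly a t) b - smult (poly b t) a"
  by (simp add: poly_eq_iff coeff_poly_const coeff_S_sep mult.commute)

definition num :: "'k::field_gcd poly fract \<Rightarrow> 'k poly" where "num x = fst (quot_of_fract x)"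
definition den :: "'k::field_gcd poly fract \<Rightarrow> 'k poly" where "den x = snd (quot_of_fract x)"
definition fdeg :: "'k::field_gcd poly fract \<Rightarrow> nat" where "fdeg x = max (degree (num x)) (degree (den x))"

lemma den_nonzero [simp]: "den x \<noteq> 0"
  by (simp add: den_def)

lemma num_den: "x = to_fract (num x) / to_fract (den x)"
  by (simp add: num_def den_def flip: Fract_conv_to_fract)

lemma coprime_num_den: "coprime (num x) (den x)"
  by (simp add: num_def den_def coprime_quot_of_fract)

text \<open>By coprimality the reduced numerator and denominator divide those of any other
  representation.\<close>

lemma fdeg_le:
  assumes "x = to_fract p / to_fract q" "q \<noteq> 0"
  shows "fdeg x \<le> max (degree p) (degree q)"
proof -
  have "x * to_fract q = to_fract p" "x * to_fract (den x) = to_fract (num x)"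
    using assms num_den[of x] by (auto simp: nonzero_eq_divide_eq)
  then have "to_fract (p * den x) = to_fract (num x * q)"
    unfolding to_fract_mult by (metis mult.assoc mult.commute)
  then have eq: "p * den x = num x * q" by (simp only: to_fract_eq_iff)
  have "den x dvd q" using eq coprime_num_den[of x]
    by (metis coprime_commute coprime_dvd_mult_right_iff dvd_triv_right)
  then have 1: "degree (den x) \<le> degree q" using assms(2) by (rule dvd_imp_degree_le)
  have "num x dvd p" using eq coprime_num_den[of x]
    by (metis coprime_dvd_mult_left_iff dvd_triv_left)
  then have "degree (num x) \<le> degree p" if "p \<noteq> 0" using that by (rule dvd_imp_degree_le)
  moreover have "num x = 0" if "p = 0" using that eq assms(2) by simp
  ultimately show ?thesis using 1 by (cases "p = 0") (auto simp: fdeg_def)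
qed

lemma fdeg_0D: "fdeg x = 0 \<Longrightarrow> \<exists>a. x = fconst a"
proof -
  assume "fdeg x = 0"
  then obtain a b where "num x = [:a:]" "den x = [:b:]"
    unfolding fdeg_def by (metis degree_eq_zeroE max_nat.eq_neutr_iff)
  then have "x * fconst b = fconst a" "b \<noteq> 0"
    using num_den[of x] den_nonzero[of x] by (auto simp: field_simps)
  moreover have "fconst a = fconst (a / b) * fconst b" using \<open>b \<noteq> 0\<close> by (simp flip: K1.mult)
  ultimately have "x * fconst b = fconst (a / b) * fconst b" "fconst b \<noteq> 0" by auto
  then show ?thesis by (intro exI[of _ "a / b"]) simp
qed

lemma not_proportional:
  assumes "fdeg x > 0" "smult a (num x) = smult b (den x)"
  shows "a = 0 \<and> b = 0"
proof (rule ccontr)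
  assume "\<not> ?thesis"
  then have "a \<noteq> 0" using assms(2) by auto
  then have "num x = [:b / a:] * den x"
    using arg_cong[OF assms(2), of "smult (inverse a)"] by (simp add: divide_inverse mult.commute)
  then have "is_unit (den x)" using coprime_num_den[of x] by (metis coprime_common_divisor dvd_refl dvd_triv_right)
  then have "degree (den x) = 0" using den_nonzero is_unit_iff_degree by blast
  moreover have "degree (num x) \<le> degree (den x)"
    using \<open>num x = [:b / a:] * den x\<close> by simp
  ultimately show False using assms(1) by (simp add: fdeg_def)
qed

text \<open>Long division stays in M, since each step only uses a quotient of leading coefficients.
  This provides minimal polynomials over a field M that is a set and not a type.\<close>

lemma division_in_subfield:
  assumes M: "K1.subfield M" and m: "m \<noteq> 0" "\<And>i. coeff m i \<in> M" and p: "\<And>i. coeff p i \<in> M"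
  shows "\<exists>q r. p = m * q + r \<and> (\<forall>i. coeff r i \<in> M) \<and> (r = 0 \<or> degree r < degree m)"
  using p
proof (induction "degree p" arbitrary: p rule: less_induct)
  case less
  show ?case
  proof (cases "p = 0 \<or> degree p < degree m")
    case True
    then show ?thesis using less.prems by (intro exI[of _ 0] exI[of _ p]) auto
  next
    case False
    define a where "a = lead_coeff p / lead_coeff m"
    define t where "t = monom a (degree p - degree m)"
    define p' where "p' = p - t * m"
    have a: "a \<in> M" unfolding a_def by (intro K1.subfieldD[OF M] less.prems m)
    have "coeff (t * m) i \<in> M" for i
      using K1.subfieldD(3)[OF M a m(2)] K1.subfieldD(6)[OF M]
      by (simp add: t_def coeff_monom_mult)
    then have p': "coeff p' i \<in> M" for i
      unfolding p'_def coeff_diff by (intro K1.subfieldD(4)[OF M less.prems])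
    have "degree p' < degree p \<or> p' = 0"
    proof -
      have "degree (t * m) \<le> degree p"
        unfolding t_def using degree_mult_le[of "monom a (degree p - degree m)" m]
          degree_monom_le[of a "degree p - degree m"] False by linarith
      then have "degree p' \<le> degree p" unfolding p'_def by (intro degree_diff_le) auto
      moreover have "coeff p' (degree p) = 0"
        using False m(1) by (simp add: p'_def t_def coeff_monom_mult a_def)
      ultimately show ?thesis
        by (metis leading_coeff_0_iff le_neq_implies_less)
    qed
    then show ?thesis
    proof
      assume "degree p' < degree p"
      from less.hyps[OF this p'] obtain q r where
        "p' = m * q + r" "\<forall>i. coeff r i \<in> M" "r = 0 \<or> degree r < degree m" by blast
      then show ?thesis
        by (intro exI[of _ "q + t"] exI[of _ r]) (auto simp: p'_def algebra_simps)
    next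
      assume "p' = 0"
      then show ?thesis using K1.subfieldD(6)[OF M]
        by (intro exI[of _ t] exI[of _ 0]) (auto simp: p'_def)
    qed
  qed
qed

text \<open>A factor q(T) divides every coefficient in S, that is, combinations of num h and den h.
  Two of these are linearly independent because h is not constant, so q divides both num h and den
  h.\<close>

lemma lift1_dvd_sep:
  assumes "fdeg h > 0" "sep (num h) (den h) = m * lift1 q"
  shows "is_unit q"
proof -
  let ?u = "num h" and ?v = "den h"
  have dv: "q dvd smult (coeff ?v n) ?u - smult (coeff ?u n) ?v" for n
    using arg_cong[OF assms(2), of "coeff_S n"] unfolding coeff_S_sep coeff_S_mult_lift1 by simp
  obtain n where n: "coeff ?v n \<noteq> 0" using den_nonzero[of h] by (auto simp: poly_eq_iff simp del: den_nonzero)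
  have "smult (coeff ?v n) ?u \<noteq> smult (coeff ?u n) ?v"
    using not_proportional[OF assms(1), of "coeff ?v n" "coeff ?u n"] n by auto
  then obtain k where k: "coeff ?v n * coeff ?u k - coeff ?u n * coeff ?v k \<noteq> 0"
    by (auto simp: poly_eq_iff)
  let ?e = "coeff ?v n * coeff ?u k - coeff ?u n * coeff ?v k"
  define wn where "wn = smult (coeff ?v n) ?u - smult (coeff ?u n) ?v"
  define wk where "wk = smult (coeff ?v k) ?u - smult (coeff ?u k) ?v"
  have w: "q dvd wn" "q dvd wk" unfolding wn_def wk_def by (rule dv)+
  then have "q dvd smult (coeff ?u k) wn - smult (coeff ?u n) wk"
    "q dvd smult (coeff ?v k) wn - smult (coeff ?v n) wk"
    by (auto intro: dvd_diff dvd_smult)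
  moreover have "smult (coeff ?u k) wn - smult (coeff ?u n) wk = smult ?e ?u"
    "smult (coeff ?v k) wn - smult (coeff ?v n) wk = smult ?e ?v"
    by (simp_all add: poly_eq_iff wn_def wk_def algebra_simps)
  ultimately have "q dvd ?u" "q dvd ?v" using k by (auto simp: dvd_smult_iff)
  then show ?thesis using coprime_num_den[of h] coprime_common_divisor by blast
qed

text \<open>The core of Lueroth's theorem. Let m be the minimal polynomial over M of the variable s.
  For y in M the polynomial num y (T) - y * den y (T) over M vanishes at s, so m divides it, and the
  primitive version m' of m divides every \<open>sep\<close>. Some coefficient of m' has S-degree at
  least fdeg h, which is all the S-degree that \<open>sep (num h) (den h)\<close> has; the cofactor
  is thus a polynomial in T, hence a unit by \<open>lift1_dvd_sep\<close>.\<close>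

lemma sep_min_degree_dvd:
  fixes M :: "'k::{field_gcd, field_char_0} poly fract set"
  assumes M: "K1.subfield M" and h: "h \<in> M" "fdeg h > 0"
    and min: "\<And>x. x \<in> M \<Longrightarrow> fdeg x > 0 \<Longrightarrow> fdeg h \<le> fdeg x"
    and x: "x \<in> M"
  shows "sep (num h) (den h) dvd sep (num x) (den x)"
proof -
  note SD = K1.subfieldD[OF M]
  let ?f = "map_poly to_fract :: 'k poly poly \<Rightarrow> 'k poly fract poly"
  define s :: "'k poly fract" where "s = to_fract [:0, 1:]"
  have f_s: "poly (?f P) s = to_fract (poly P [:0, 1:])" for P
    unfolding s_def by (induction P) (simp_all add: map_poly_pCons, simp flip: to_fract_mult)
  define I where "I = {p. p \<noteq> 0 \<and> (\<forall>i. coeff p i \<in> M) \<and> poly p s = 0}"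
  define S where "S y = smult (inverse (to_fract (den y))) (?f (sep (num y) (den y)))" for y
  have S_M: "coeff (S y) i \<in> M" if "y \<in> M" for y i
  proof -
    have "coeff (S y) i = fconst (coeff (num y) i) - y * fconst (coeff (den y) i)"
      using num_den[of y] den_nonzero[of y]
      by (simp add: S_def coeff_map_poly coeff_sep to_fract_smult field_simps)
    then show ?thesis using that by (auto intro!: SD)
  qed
  have S_s: "poly (S y) s = 0" for y
    by (simp add: S_def f_s sep_def poly_lift1_X mult.commute)
  have sep_h: "sep (num h) (den h) \<noteq> 0"
  proof
    assume "sep (num h) (den h) = 0"
    \<comment> \<open>This factorization would make 0 a unit.\<close>
    then have "sep (num h) (den h) = 0 * lift1 0" by simp
    from lift1_dvd_sep[OF h(2) this] show False by simp
  qed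
  then have "S h \<in> I" using S_M[OF h(1)] S_s by (auto simp: I_def S_def)
  then obtain m where m: "m \<in> I" "\<And>p. p \<in> I \<Longrightarrow> degree m \<le> degree p"
    using ex_has_least_nat[of "\<lambda>p. p \<in> I" "S h" degree] by blast
  have m_dvd: "m dvd p" if p: "\<And>i. coeff p i \<in> M" "poly p s = 0" for p
  proof -
    from division_in_subfield[OF M _ _ p(1), of m] m(1) obtain q r where
      qr: "p = m * q + r" "\<forall>i. coeff r i \<in> M" "r = 0 \<or> degree r < degree m"
      unfolding I_def by blast
    have "poly r s = 0" using p(2) qr(1) m(1) by (simp add: I_def)
    then have "r = 0" using qr m(2)[of r] by (force simp: I_def)
    then show ?thesis using qr by simp
  qed
  obtain c0 m' where m': "m = smult c0 (?f m')" "content m' = 1" by (rule content_decompose_fract)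
  have "m \<noteq> 0" using m(1) by (simp add: I_def)
  then have c0: "c0 \<noteq> 0" "m' \<noteq> 0" using m' by auto
  have dvd_sep: "m' dvd sep (num y) (den y)" if "y \<in> M" for y
  proof -
    have "m dvd S y" by (rule m_dvd[OF S_M[OF that] S_s])
    then have "?f m' dvd ?f (sep (num y) (den y))"
      using c0 by (simp add: m'(1) S_def smult_dvd_iff dvd_smult_iff)
    \<comment> \<open>Gauss's lemma: m' is primitive.\<close>
    then show ?thesis using m'(2) by (rule fract_poly_dvdD)
  qed
  have m's: "poly m' [:0, 1:] = 0"
    using m(1) c0(1) by (simp add: I_def m'(1) f_s)
  \<comment> \<open>Ratios of coefficients of m' are ratios of coefficients of m and lie in M. If
    all S-degrees were below fdeg h, minimality of h would make these ratios constant, so that m' =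
    l(S) k(T), which does not vanish at T = S.\<close>
  obtain i where i: "fdeg h \<le> degree (coeff m' i)" "coeff m' i \<noteq> 0"
  proof (rule ccontr)
    assume "\<not> thesis"
    with that have small: "degree (coeff m' i) < fdeg h" for i
      using h(2) by (cases "coeff m' i = 0") force+
    define l where "l = lead_coeff m'"
    have l: "l \<noteq> 0" using c0 by (simp add: l_def)
    have "\<exists>a. to_fract (coeff m' i) / to_fract l = fconst a" for i
    proof -
      let ?y = "to_fract (coeff m' i) / to_fract l"
      have "?y = coeff m i / coeff m (degree m')" using c0 by (simp add: m'(1) l_def coeff_map_poly)
      then have "?y \<in> M" using m(1) by (auto simp: I_def intro!: SD)
      moreover have "fdeg ?y < fdeg h"
        using fdeg_le[OF refl l, of "coeff m' i"] small[of i] small[of "degree m'"] by (simp add: l_def)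
      ultimately show ?thesis using min[of ?y] fdeg_0D[of ?y] by force
    qed
    then obtain a where a: "\<And>i. to_fract (coeff m' i) / to_fract l = fconst (a i)" by metis
    have a': "coeff m' i = l * [:a i:]" for i
    proof -
      have "to_fract (coeff m' i) = to_fract (l * [:a i:])"
        using a[of i] l by (simp only: to_fract_mult) (simp add: field_simps)
      then show ?thesis by (simp only: to_fract_eq_iff)
    qed
    define k where "k = Poly (map a [0..<Suc (degree m')])"
    have "m' = smult l (lift1 k)"
    proof (rule poly_eqI)
      fix i
      show "coeff m' i = coeff (smult l (lift1 k)) i"
        using a'[of i] by (cases "i \<le> degree m'")
          (auto simp: k_def coeff_map_poly nth_default_def coeff_eq_0 simp del: upt_Suc)
    qed
    then have "l * k = 0" using m's by (simp add: poly_lift1_X)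
    then show False using l \<open>m' = smult l (lift1 k)\<close> c0(2) by simp
  qed
  obtain Q where Q: "sep (num h) (den h) = m' * Q" using dvd_sep[OF h(1)] ..
  have "degree (coeff Q j) = 0" for j
  proof (rule ccontr)
    assume j: "degree (coeff Q j) \<noteq> 0"
    then have "coeff Q j \<noteq> 0" by auto
    \<comment> \<open>At a general value of T the S-degrees of m' and Q add up to at most fdeg h,
      and m' alone takes all of it.\<close>
    have "finite ({t. degree (poly m' [:t:]) < fdeg h} \<union> {t. degree (poly Q [:t:]) < 1})"
      using generic_degree[OF i] generic_degree[of 1 Q j] j \<open>coeff Q j \<noteq> 0\<close> by auto
    then obtain t where t: "degree (poly m' [:t:]) \<ge> fdeg h" "degree (poly Q [:t:]) \<ge> 1"
      using ex_new_if_finite[OF infinite_UNIV_char_0, of "{t. degree (poly m' [:t:]) < fdeg h} \<union> {t. degree (poly Q [:t:]) < 1}"]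
      by (auto simp: not_less)
    have nz: "poly m' [:t:] \<noteq> 0" "poly Q [:t:] \<noteq> 0" using t h(2) by auto
    have "fdeg h + 1 \<le> degree (poly m' [:t:]) + degree (poly Q [:t:])" using t by simp
    also have "\<dots> = degree (poly (sep (num h) (den h)) [:t:])"
      unfolding Q poly_mult using nz by (simp add: degree_mult_eq)
    also have "\<dots> \<le> fdeg h" unfolding poly_sep fdeg_def
      by (intro degree_diff_le order.trans[OF degree_smult_le]) auto
    finally show False by simp
  qed
  then have "\<exists>a. coeff Q j = [:a:]" for j by (metis degree_eq_zeroE)
  then obtain a where a: "\<And>j. coeff Q j = [:a j:]" by metis
  define q where "q = Poly (map a [0..<Suc (degree Q)])"
  have Qq: "Q = lift1 q"
  proof (rule poly_eqI)
    fix i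
    show "coeff Q i = coeff (lift1 q) i"
      using a[of i] by (cases "i \<le> degree Q")
        (auto simp: q_def coeff_map_poly nth_default_def coeff_eq_0 simp del: upt_Suc)
  qed
  have "is_unit q" using lift1_dvd_sep[OF h(2) Q[unfolded Qq]] .
  then obtain q' where "q * q' = 1" by (metis dvdE)
  then have "m' = sep (num h) (den h) * lift1 q'"
    unfolding Q Qq by (simp add: mult.assoc lift1_1 flip: lift1_mult)
  then show ?thesis using dvd_sep[OF x] dvd_trans dvd_triv_left by metis
qed

text \<open>Descent on fdeg x. The divisibility of \<open>sep_min_degree_dvd\<close>, specialized at
  two values of S, writes a Moebius transform z of x as y * r, where r is fractional linear in h and
  y = C1/C2 lies in M and has smaller degree than x. By induction y is in K(h), hence so are z and
  x.\<close>

theorem lueroth: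
  fixes M :: "'k::{field_gcd, field_char_0} poly fract set"
  assumes M: "K1.subfield M" and ne: "\<exists>x\<in>M. fdeg x > 0"
  shows "\<exists>h\<in>M. M \<subseteq> K1.gen h"
proof -
  obtain h where h: "h \<in> M" "fdeg h > 0" "\<And>x. x \<in> M \<Longrightarrow> fdeg x > 0 \<Longrightarrow> fdeg h \<le> fdeg x"
    using ex_has_least_nat[of "\<lambda>x. x \<in> M \<and> fdeg x > 0" _ fdeg] ne by blast
  note SD = K1.subfieldD[OF M] and GD = K1.subfieldD[OF K1.subfield_gen]
  let ?n = "fdeg h" and ?u = "num h" and ?v = "den h"
  define U where "U t = smult (poly ?v t) ?u - smult (poly ?u t) ?v" for t
  have U_ne: "coeff (U t) ?n \<noteq> 0" if "poly (smult (coeff ?u ?n) ?v - smult (coeff ?v ?n) ?u) t \<noteq> 0" for t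
    using that by (simp add: U_def algebra_simps)
  have "smult (coeff ?u ?n) ?v - smult (coeff ?v ?n) ?u \<noteq> 0"
  proof
    assume "smult (coeff ?u ?n) ?v - smult (coeff ?v ?n) ?u = 0"
    then have "smult (coeff ?v ?n) ?u = smult (coeff ?u ?n) ?v" by simp
    from not_proportional[OF h(2) this] have "coeff ?v ?n = 0" "coeff ?u ?n = 0" by auto
    moreover have "?n = degree ?u \<or> ?n = degree ?v" by (auto simp: fdeg_def)
    ultimately have "?u = 0 \<and> ?n = degree ?u" using den_nonzero[of h] by (metis leading_coeff_0_iff)
    then show False using h(2) by simp
  qed
  then have finU: "finite {t. coeff (U t) ?n = 0}"
    using U_ne by (intro finite_subset[OF _ poly_roots_finite]) blast+
  have "x \<in> M \<Longrightarrow> x \<in> K1.gen h" for x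
  proof (induction "fdeg x" arbitrary: x rule: less_induct)
    case less
    show ?case
    proof (cases "fdeg x = 0")
      case True
      then show ?thesis using fdeg_0D[of x] GD(1) by auto
    next
      case False
      let ?a = "num x" and ?b = "den x"
      define A where "A t = smult (poly ?b t) ?a - smult (poly ?a t) ?b" for t
      have A_ne: "A t \<noteq> 0" for t
      proof
        assume "A t = 0"
        then have "poly ?b t = 0" "poly ?a t = 0"
          using not_proportional[of x "poly ?b t" "poly ?a t"] False by (auto simp: A_def)
        then have "[:-t, 1:] dvd ?a" "[:-t, 1:] dvd ?b" by (auto simp: poly_eq_0_iff_dvd)
        then have "is_unit [:-t, 1:]" using coprime_num_den[of x] coprime_common_divisor by blast
        then show False by (simp add: is_unit_iff_degree)
      qed
      have UA: "U t dvd A t" for t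
      proof -
        have "sep ?u ?v dvd sep ?a ?b"
          by (rule sep_min_degree_dvd[OF M h(1,2) _ less.prems]) (rule h(3))
        then obtain R where "sep ?a ?b = sep ?u ?v * R" ..
        from arg_cong[OF this, of "at_S t"] show ?thesis
          unfolding at_S_mult at_S_sep U_def A_def by simp
      qed
      obtain t1 where t1: "coeff (U t1) ?n \<noteq> 0"
        using ex_new_if_finite[OF infinite_UNIV_char_0 finU] by auto
      \<comment> \<open>At t1 and t2 the polynomial U has full degree fdeg h, which makes the
        degrees of C1 and C2 smaller than fdeg x. The value of A t1 at t2 is, up to sign, the
        determinant of the transformation from x to z; it must not vanish if x is to be
        recovered.\<close>
      have "finite ({t. coeff (U t) ?n = 0} \<union> {t. poly (A t1) t = 0} \<union> {t. poly (U t1) t = 0})"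
        using finU poly_roots_finite[OF A_ne[of t1]] poly_roots_finite[of "U t1"] t1 by fastforce
      from ex_new_if_finite[OF infinite_UNIV_char_0 this]
      obtain t2 where t2: "coeff (U t2) ?n \<noteq> 0" "poly (A t1) t2 \<noteq> 0" by auto
      obtain C1 C2 where C: "A t1 = U t1 * C1" "A t2 = U t2 * C2" using UA by (metis dvdE)
      have nz: "U t1 \<noteq> 0" "U t2 \<noteq> 0" "C1 \<noteq> 0" "C2 \<noteq> 0" using t1 t2 C A_ne[of t1] A_ne[of t2] by auto
      have degA: "degree (A t) \<le> fdeg x" for t unfolding A_def fdeg_def
        by (intro degree_diff_le order.trans[OF degree_smult_le]) auto
      have "degree C1 + ?n \<le> fdeg x"
        using degA[of t1] le_degree[OF t1] nz by (simp add: C degree_mult_eq)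
      moreover have "degree C2 + ?n \<le> fdeg x"
        using degA[of t2] le_degree[OF t2(1)] nz by (simp add: C degree_mult_eq)
      ultimately have dC: "max (degree C1) (degree C2) < fdeg x" using h(2) by auto
      define y where "y = to_fract C1 / to_fract C2"
      have fA: "to_fract (A t) = to_fract ?b * (fconst (poly ?b t) * x - fconst (poly ?a t))" for t
      proof -
        have "A t = [:poly ?b t:] * ?a - ?b * [:poly ?a t:]" by (simp add: A_def mult.commute[of ?b])
        then show ?thesis using num_den[of x] by (simp add: right_diff_distrib del: mult_pCons_left mult_pCons_right) (simp add: field_simps del: mult_pCons_left mult_pCons_right)
      qed
      have fU: "to_fract (U t) = to_fract ?v * (fconst (poly ?v t) * h - fconst (poly ?u t))" for t
      proof -
        have "U t = [:poly ?v t:] * ?u - ?v * [:poly ?u t:]" by (simp add: U_def mult.commute[of ?v])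
        then show ?thesis using num_den[of h] by (simp add: right_diff_distrib del: mult_pCons_left mult_pCons_right) (simp add: field_simps del: mult_pCons_left mult_pCons_right)
      qed
      define z where "z = to_fract (A t1) / to_fract (A t2)"
      define r where "r = to_fract (U t1) / to_fract (U t2)"
      have z: "z = y * r" by (simp add: z_def y_def r_def C mult_ac)
      have r0: "r \<noteq> 0" using nz by (simp add: r_def)
      have rg: "r \<in> K1.gen h" unfolding r_def fU by (auto intro!: GD K1.gen_self)
      have "z \<in> M" unfolding z_def fA using less.prems by (auto intro!: SD)
      moreover have "r \<in> M" unfolding r_def fU using h(1) by (auto intro!: SD)
      moreover have "y = z / r" using z r0 by simp
      ultimately have "y \<in> M" by (auto intro: SD)
      moreover have "fdeg y < fdeg x" using fdeg_le[OF y_def] nz(4) dC by (meson le_less_trans to_fract_eq_0_iff)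
      ultimately have "y \<in> K1.gen h" using less.hyps by blast
      then have zg: "z \<in> K1.gen h" unfolding z using rg by (rule GD)
      have "z * (fconst (poly ?b t2) * x - fconst (poly ?a t2)) = fconst (poly ?b t1) * x - fconst (poly ?a t1)"
      proof -
        have "to_fract (A t2) \<noteq> 0" using A_ne by (simp only: to_fract_eq_0_iff not_False_eq_True)
        then show ?thesis unfolding z_def fA by simp
      qed
      then have eq: "x * (fconst (poly ?b t1) - z * fconst (poly ?b t2)) = fconst (poly ?a t1) - z * fconst (poly ?a t2)"
        by (simp add: algebra_simps)
      have "fconst (poly ?b t1) - z * fconst (poly ?b t2) \<noteq> 0"
      proof
        assume *: "fconst (poly ?b t1) - z * fconst (poly ?b t2) = 0"
        then have "fconst (poly ?a t1) - z * fconst (poly ?a t2) = 0" using eq by simp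
        then have "fconst (poly ?b t1) * fconst (poly ?a t2) - fconst (poly ?a t1) * fconst (poly ?b t2) = 0"
          using * by (simp add: algebra_simps)
        then have "poly ?b t1 * poly ?a t2 - poly ?a t1 * poly ?b t2 = 0"
          by (simp only: K1.eq_0_iff flip: K1.mult K1.diff)
        then show False using t2(2) by (simp add: A_def)
      qed
      then have "x = (fconst (poly ?a t1) - z * fconst (poly ?a t2)) / (fconst (poly ?b t1) - z * fconst (poly ?b t2))"
        using eq by (simp add: field_simps)
      also have "\<dots> \<in> K1.gen h" by (intro GD zg)
      finally show ?thesis .
    qed
  qed
  then show ?thesis using h(1) by blast
qed

section \<open>Rational first integrals\<close>

interpretation K2: field_embedding "const_fract :: 'k::field \<Rightarrow> 'k poly poly fract"
  unfolding const_fract_def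
  by unfold_locales (simp_all add: mult_to_poly to_fract_mult[symmetric] to_fract_add[symmetric] one_pCons[symmetric]
    del: to_fract_mult to_fract_add)

lemma eval_fract_eq_ev: "eval_fract a h = K2.ev a h"
  by (simp add: eval_fract_def K2.ev_def)

lemma Fract_eq_to_fract: "Fract p q = to_fract p / to_fract q"
  by (rule Fract_conv_to_fract)

text \<open>Once the common factor of a and b is removed, non-compositeness bounds the degrees by 1.
  So r is fractional linear in h, and this can be solved for h because r is not constant.\<close>

lemma non_composite_gen:
  fixes f g :: "'k::field_gcd poly poly"
  assumes nc: "non_composite f g" and nonconst: "Fract f g \<notin> range const_fract"
    and rh: "Fract f g \<in> K2.gen h"
  shows "h \<in> K2.gen (Fract f g)"
proof -
  let ?r = "Fract f g"
  obtain a b where ab: "?r = K2.ev a h / K2.ev b h" "K2.ev b h \<noteq> 0" using rh by (auto simp: K2.gen_def)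
  have "b \<noteq> 0" using ab(2) by auto
  then obtain a' b' where ab': "a = a' * gcd a b" "b = b' * gcd a b" "coprime a' b'"
    by (metis gcd_coprime_exists gcd_eq_0_iff)
  define e where "e = gcd a b"
  have e: "K2.ev a h = K2.ev a' h * K2.ev e h" "K2.ev b h = K2.ev b' h * K2.ev e h"
    using ab' unfolding e_def by (metis K2.ev_mult)+
  then have b'0: "K2.ev b' h \<noteq> 0" and e0: "K2.ev e h \<noteq> 0" using ab(2) by auto
  have r: "?r = K2.ev a' h / K2.ev b' h" using ab(1) e e0 by simp
  then have "\<not> max (degree a') (degree b') \<ge> 2"
    using nc ab'(3) b'0 unfolding non_composite_def eval_fract_eq_ev by blast
  then have deg: "degree a' \<le> 1" "degree b' \<le> 1" by auto
  have lin: "\<exists>x y. p = [:x, y:]" if "degree p \<le> 1" for p :: "'k poly"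
  proof -
    have "p = [:coeff p 0, coeff p 1:]"
      by (rule poly_eqI) (use that in \<open>auto simp: coeff_pCons coeff_eq_0 split: nat.split\<close>)
    then show ?thesis by blast
  qed
  obtain a0 a1 b0 b1 where l: "a' = [:a0, a1:]" "b' = [:b0, b1:]" using lin deg by metis
  let ?c = "const_fract :: 'k \<Rightarrow> 'k poly poly fract"
  have "?r * (?c b0 + h * ?c b1) = ?c a0 + h * ?c a1"
    using r b'0 by (simp add: l field_simps)
  then have eq: "h * (?r * ?c b1 - ?c a1) = ?c a0 - ?r * ?c b0" by (simp add: algebra_simps)
  have "?r * ?c b1 - ?c a1 \<noteq> 0"
  proof
    assume z: "?r * ?c b1 - ?c a1 = 0"
    show False
    proof (cases "b1 = 0")
      case True
      then have "a1 = 0" using z by simp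
      then have "?r = ?c a0 / ?c b0" "b0 \<noteq> 0" using r b'0 True by (simp_all add: l)
      then have "?r = ?c (a0 / b0)" by (simp add: divide_eq_eq flip: K2.mult)
      then show False using nonconst by blast
    next
      case False
      then have "?r = ?c (a1 / b1)" using z by (simp add: eq_divide_eq flip: K2.mult)
          (metis K2.eq_0_iff K2.mult nonzero_divide_eq_eq nonzero_eq_divide_eq)
      then show False using nonconst by blast
    qed
  qed
  then have "h = (?c a0 - ?r * ?c b0) / (?r * ?c b1 - ?c a1)" using eq by (simp add: eq_divide_eq)
  also have "\<dots> \<in> K2.gen ?r" using K2.gen_self by (intro K2.subfieldD[OF K2.subfield_gen]) auto
  finally show ?thesis .
qed

section \<open>Restricting the constants of a derivation to a line\<close>

lemma at_S_add: "at_S t (P + Q) = at_S t P + at_S t Q"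
  by (simp add: poly_eq_iff at_S_def coeff_map_poly)

lemma at_S_0 [simp]: "at_S t 0 = 0"
  by (simp add: at_S_def)

lemma at_S_const [simp]: "at_S t [:[:c:]:] = [:c:]"
  by (simp add: at_S_def map_poly_pCons)

lemma at_S_1 [simp]: "at_S t 1 = 1"
  using at_S_const[of t 1] by (simp flip: one_pCons)

lemma at_S_eq_0_iff: "at_S t P = 0 \<longleftrightarrow> [:[:- t, 1:]:] dvd P"
  by (simp add: const_poly_dvd_iff poly_eq_iff at_S_def coeff_map_poly poly_eq_0_iff_dvd)

lemma at_S_generic_nonzero:
  fixes P :: "'k::{field_gcd, field_char_0} poly poly"
  assumes "P \<noteq> 0"
  shows "\<exists>t. at_S t P \<noteq> 0"
proof -
  obtain i where i: "coeff P i \<noteq> 0" using assms by (auto simp: poly_eq_iff)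
  obtain t where "poly (coeff P i) t \<noteq> 0"
    using ex_new_if_finite[OF infinite_UNIV_char_0 poly_roots_finite[OF i]] by auto
  then have "coeff (at_S t P) i \<noteq> 0" by (simp add: at_S_def coeff_map_poly)
  then show ?thesis by (intro exI[of _ t]) auto
qed

text \<open>D will be the map taking z to the coefficient of dz wedge dr, up to a factor; its
  rational constants are the functions psi. \<open>transversal\<close> says that D does not preserve
  the line X = t, which makes the restriction of constants to this line injective.\<close>

locale plane_derivation = derivation D
  for D :: "'k::{field_gcd, field_char_0} poly poly \<Rightarrow> 'k poly poly" +
  fixes t :: 'k
  assumes const [simp]: "D [:[:c:]:] = 0"
    and transversal: "at_S t (D [:[:0, 1:]:]) \<noteq> 0"
begin

text \<open>D(p/q) = 0, without a derivation on fractions.\<close>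

definition csts :: "'k poly poly \<Rightarrow> 'k poly poly \<Rightarrow> bool" where
  "csts p q \<longleftrightarrow> q * D p = p * D q"

abbreviation lt :: "'k poly poly" where
  "lt \<equiv> [:[:- t, 1:]:]"

lemma D_lt: "D lt = D [:[:0, 1:]:]"
  using add[of "[:[:0, 1:]:]" "[:[:-t:]:]"] by simp

lemma lt_power_decomp:
  assumes "p \<noteq> 0"
  obtains i p1 where "p = lt ^ i * p1" "at_S t p1 \<noteq> 0"
proof -
  have "\<not> is_unit lt" by (simp add: is_unit_iff_degree is_unit_const_poly_iff)
  then show ?thesis using multiplicity_decompose'[OF assms, of lt] that at_S_eq_0_iff by metis
qed

text \<open>If p = lt^k * p1 with k > 0 and p1 not vanishing on the line, then D p has the term k *
  lt^(k-1) * p1 * D lt, whereas p * D q is divisible by lt^k. On the line this contradicts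
  \<open>transversal\<close>.\<close>

lemma csts_restrict_inj:
  assumes "csts p q" "at_S t p = 0" "at_S t q \<noteq> 0"
  shows "p = 0"
proof (rule ccontr)
  assume "p \<noteq> 0"
  then obtain k p1 where p: "p = lt ^ k * p1" "at_S t p1 \<noteq> 0" by (rule lt_power_decomp)
  have "k \<noteq> 0" using p assms(2) by (cases k) auto
  obtain l where l: "l = lt" by blast
  have "l ^ k * (of_nat k * q * D l * p1 + l * q * D p1) = q * p1 * (of_nat k * l ^ k * D l) + q * l * l ^ k * D p1"
    by (simp add: algebra_simps)
  also have "\<dots> = l * (q * D (l ^ k * p1))"
    unfolding power[symmetric] mult by (simp add: algebra_simps)
  also have "q * D (l ^ k * p1) = l ^ k * p1 * D q"
    using assms(1) by (simp only: csts_def p(1) l)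
  finally have "l ^ k * (of_nat k * q * D l * p1 + l * q * D p1) = l ^ k * (l * p1 * D q)"
    by (simp only: mult_ac)
  moreover have "l \<noteq> 0" using l by simp
  ultimately have "of_nat k * q * D l * p1 + l * q * D p1 = l * p1 * D q"
    by simp
  then have "at_S t (of_nat k * q * D lt * p1 + lt * q * D p1) = at_S t (lt * p1 * D q)"
    by (simp only: l)
  moreover have "at_S t lt = 0" by (simp add: at_S_eq_0_iff)
  moreover have "of_nat k = [:[:of_nat k :: 'k:]:]" by (simp add: of_nat_poly)
  ultimately have "[:of_nat k:] * at_S t q * at_S t (D lt) * at_S t p1 = 0"
    by (simp only: at_S_add at_S_mult at_S_const mult_zero_left mult_zero_right add_0_right)
  then show False using \<open>k \<noteq> 0\<close> assms(3) p(2) transversal by (simp add: D_lt)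
qed

lemma csts_scale: "n \<noteq> 0 \<Longrightarrow> csts (n * p) (n * q) \<longleftrightarrow> csts p q"
proof -
  assume n: "n \<noteq> 0"
  have "n * q * D (n * p) - n * p * D (n * q) = n * n * (q * D p - p * D q)"
    unfolding mult by (simp add: algebra_simps)
  then show ?thesis using n unfolding csts_def
    by (metis eq_iff_diff_eq_0 mult_eq_0_iff)
qed

lemma csts_sym: "csts p q \<longleftrightarrow> csts q p"
  by (auto simp: csts_def)

text \<open>A constant has no pole along the line: after common powers of lt are cancelled, its
  reciprocal would be a constant that vanishes there, hence 0.\<close>

lemma csts_regular_rep:
  assumes "csts p q" "q \<noteq> 0"
  obtains p' q' where "at_S t q' \<noteq> 0" "csts p' q'" "p * q' = p' * q"
proof (cases "p = 0")
  case True
  then show ?thesis using that[of 1 0] by (simp add: csts_def)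
next
  case False
  obtain i p1 where p: "p = lt ^ i * p1" "at_S t p1 \<noteq> 0" using False by (rule lt_power_decomp)
  obtain j q1 where q: "q = lt ^ j * q1" "at_S t q1 \<noteq> 0" using assms(2) by (rule lt_power_decomp)
  show ?thesis
  proof (cases "j \<le> i")
    case True
    then obtain l where l: "i = j + l" by (metis le_iff_add)
    have "csts (lt ^ j * (lt ^ l * p1)) (lt ^ j * q1)" using assms(1) by (simp add: p q l power_add mult.assoc)
    then have "csts (lt ^ l * p1) q1" by (subst (asm) csts_scale) auto
    then show ?thesis using that[of q1 "lt ^ l * p1"] q(2) by (simp add: p q l power_add mult_ac)
  next
    case False
    then obtain l where l: "j = i + Suc l" by (metis less_imp_Suc_add not_le add_Suc_right)
    have "csts (lt ^ i * p1) (lt ^ i * (lt ^ Suc l * q1))" using assms(1) by (simp add: p q l power_add mult_ac)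
    then have "csts p1 (lt ^ Suc l * q1)" by (subst (asm) csts_scale) auto
    then have "csts (lt ^ Suc l * q1) p1" by (simp only: csts_sym[of p1])
    moreover have "lt dvd lt ^ Suc l * q1" by (simp only: power_Suc mult.assoc dvd_triv_left)
    ultimately have "lt ^ Suc l * q1 = 0"
      using csts_restrict_inj p(2) at_S_eq_0_iff by blast
    then show ?thesis using q(2) by simp
  qed
qed

text \<open>The graph of restriction to the line on the field of constants. As a relation it needs
  no choice of representatives; that it is well defined and injective enters through
  \<open>restr_eq_0_iff\<close>.\<close>

definition restr :: "'k poly poly fract \<Rightarrow> 'k poly fract \<Rightarrow> bool" where
  "restr x y \<longleftrightarrow> (\<exists>p q. at_S t q \<noteq> 0 \<and> csts p q \<and> x = to_fract p / to_fract q
     \<and> y = to_fract (at_S t p) / to_fract (at_S t q))"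

lemma restrE:
  assumes "restr x y"
  obtains p q where "at_S t q \<noteq> 0" "q \<noteq> 0" "csts p q" "x = to_fract p / to_fract q"
     "y = to_fract (at_S t p) / to_fract (at_S t q)"
  using assms unfolding restr_def by force

lemma restr_const: "restr (const_fract c) (fconst c)"
  unfolding restr_def const_fract_def
  by (intro exI[of _ "[:[:c:]:]"] exI[of _ 1]) (simp add: csts_def)

lemma restr_add: "restr x y \<Longrightarrow> restr x' y' \<Longrightarrow> restr (x + x') (y + y')"
proof (elim restrE)
  fix p q p' q' assume *: "at_S t q \<noteq> 0" "q \<noteq> 0" "at_S t q' \<noteq> 0" "q' \<noteq> 0" "csts p q" "csts p' q'"
     "x = to_fract p / to_fract q" "x' = to_fract p' / to_fract q'"
     "y = to_fract (at_S t p) / to_fract (at_S t q)" "y' = to_fract (at_S t p') / to_fract (at_S t q')"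
  have "csts (p * q' + p' * q) (q * q')"
  proof -
    have "q * q' * D (p * q' + p' * q) - (p * q' + p' * q) * D (q * q') =
      q' * q' * (q * D p - p * D q) + q * q * (q' * D p' - p' * D q')"
      unfolding mult add by (simp add: algebra_simps)
    then show ?thesis using *(5,6) by (simp add: csts_def)
  qed
  then show "restr (x + x') (y + y')" unfolding restr_def using *
    by (intro exI[of _ "p * q' + p' * q"] exI[of _ "q * q'"])
      (simp add: at_S_mult at_S_add add_frac_eq)
qed

lemma restr_mult: "restr x y \<Longrightarrow> restr x' y' \<Longrightarrow> restr (x * x') (y * y')"
proof (elim restrE)
  fix p q p' q' assume *: "at_S t q \<noteq> 0" "q \<noteq> 0" "at_S t q' \<noteq> 0" "q' \<noteq> 0" "csts p q" "csts p' q'"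
     "x = to_fract p / to_fract q" "x' = to_fract p' / to_fract q'"
     "y = to_fract (at_S t p) / to_fract (at_S t q)" "y' = to_fract (at_S t p') / to_fract (at_S t q')"
  have "csts (p * p') (q * q')"
  proof -
    have "q * q' * D (p * p') - (p * p') * D (q * q') =
      q' * p' * (q * D p - p * D q) + q * p * (q' * D p' - p' * D q')"
      unfolding mult add by (simp add: algebra_simps)
    then show ?thesis using *(5,6) by (simp add: csts_def)
  qed
  then show "restr (x * x') (y * y')" unfolding restr_def using *
    by (intro exI[of _ "p * p'"] exI[of _ "q * q'"]) (simp add: at_S_mult)
qed

lemma restr_inverse: "restr x y \<Longrightarrow> restr (inverse x) (inverse y)"
proof (elim restrE)
  fix p q assume *: "at_S t q \<noteq> 0" "q \<noteq> 0" "csts p q" "x = to_fract p / to_fract q"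
     "y = to_fract (at_S t p) / to_fract (at_S t q)"
  show ?thesis
  proof (cases "at_S t p = 0")
    case True
    then have "p = 0" using csts_restrict_inj * by blast
    then show ?thesis using restr_const[of 0] * by simp
  next
    case False
    then show ?thesis unfolding restr_def using *
      by (intro exI[of _ q] exI[of _ p]) (auto simp: csts_sym)
  qed
qed

lemma restr_eq_0_iff: "restr x y \<Longrightarrow> x = 0 \<longleftrightarrow> y = 0"
  using csts_restrict_inj by (auto elim!: restrE)

lemma restr_ev: "restr x y \<Longrightarrow> restr (K2.ev a x) (K1.ev a y)"
proof (induction a)
  case 0
  then show ?case using restr_const[of 0] by simp
next
  case (pCons a p)
  then show ?case using restr_add[OF restr_const restr_mult] by simp
qed

lemma subfield_restr: "K1.subfield {y. \<exists>x. restr x y}"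
  unfolding K1.subfield_def using restr_const restr_add restr_mult restr_inverse by blast

text \<open>Lueroth's theorem transported from the line \<open>X = t\<close> to the field of constants of \<open>D\<close>.\<close>
lemma constants_gen:
  assumes nc: "non_composite f g" and fg: "csts f g" "g \<noteq> 0" and nonconst: "Fract f g \<notin> range const_fract"
    and pq: "csts p q" "q \<noteq> 0"
  shows "to_fract p / to_fract q \<in> K2.gen (Fract f g)"
proof -
  let ?M = "{y. \<exists>x. restr x y}"
  have ex: "\<exists>y. restr (to_fract p / to_fract q) y" if pq: "csts p q" "q \<noteq> 0" for p q
  proof -
    obtain p' q' where *: "at_S t q' \<noteq> 0" "csts p' q'" "p * q' = p' * q"
      using pq by (rule csts_regular_rep)
    have "q' \<noteq> 0" using *(1) by auto
    have "to_fract p / to_fract q = to_fract p' / to_fract q'"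
      using pq(2) \<open>q' \<noteq> 0\<close> arg_cong[OF *(3), of to_fract] by (simp add: frac_eq_eq)
    then show ?thesis using * unfolding restr_def by blast
  qed
  obtain y where y: "restr (Fract f g) y" using ex[OF fg] by (auto simp: Fract_eq_to_fract)
  have "fdeg y > 0"
  proof (rule ccontr)
    assume "\<not> fdeg y > 0"
    then obtain a where a: "y = fconst a" using fdeg_0D[of y] by auto
    have "restr (Fract f g + const_fract (- a)) (y + fconst (- a))"
      by (intro restr_add y restr_const)
    moreover have "y + fconst (- a) = 0" unfolding a using K1.add[of a "- a"] by simp
    ultimately have "Fract f g + const_fract (- a) = 0" using restr_eq_0_iff by blast
    then have "Fract f g = const_fract a" by simp
    then show False using nonconst by blast
  qed
  then obtain h where h: "h \<in> ?M" "?M \<subseteq> K1.gen h"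
    using lueroth[OF subfield_restr] y by blast
  then obtain H where H: "restr H h" by blast
  have gen: "x \<in> K2.gen H" if x: "restr x z" for x z
  proof -
    obtain a b where ab: "z = K1.ev a h / K1.ev b h" "K1.ev b h \<noteq> 0"
      using h(2) x by (auto simp: K1.gen_def)
    have b: "K2.ev b H \<noteq> 0" using restr_eq_0_iff[OF restr_ev[OF H, of b]] ab(2) by simp
    \<comment> \<open>The equation z = a(h)/b(h) on the line is lifted to the plane by writing it as
      the vanishing of a constant of D.\<close>
    have "restr (x * K2.ev b H + const_fract (- 1) * K2.ev a H) (z * K1.ev b h + fconst (- 1) * K1.ev a h)"
      by (intro restr_add restr_mult x restr_ev H restr_const)
    moreover have "z * K1.ev b h + fconst (- 1) * K1.ev a h = 0"
      using ab K1.uminus[of 1] K1.one by simp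
    ultimately have "x * K2.ev b H + const_fract (- 1) * K2.ev a H = 0" using restr_eq_0_iff by blast
    then have "x = K2.ev a H / K2.ev b H" using b by (simp add: eq_divide_eq)
    then show ?thesis using K2.genI[OF b] by simp
  qed
  have "H \<in> K2.gen (Fract f g)" using non_composite_gen[OF nc nonconst gen[OF y]] .
  then show ?thesis using K2.gen_mono gen ex[OF pq] by blast
qed

end

section \<open>Wedge products and dehomogenization\<close>

text \<open>Write m_t = f + k t * g, so that m_t/g = r + k t, and let eta_t = (a t, b t)/m_t, which
  is closed by \<open>cl\<close>. Then d((a t, b t)/g) = d((r + k t) eta_t) = dr wedge eta_t. Summed
  over t, the left side vanishes by \<open>inf\<close>, so the sum of the eta_t has zero wedge
  product with dr.\<close>

lemma wedge_eq_0_of_closed: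
  fixes X Y :: "'a::idom \<Rightarrow> 'a"
  assumes X: "derivation X" and Y: "derivation Y" and T: "finite T"
    and k: "\<And>t. X (k t) = 0" "\<And>t. Y (k t) = 0"
    and cl: "\<And>t. t \<in> T \<Longrightarrow> (f + k t * g) * (Y (a t) - X (b t)) = Y (f + k t * g) * a t - X (f + k t * g) * b t"
    and inf: "g * (Y (sum a T) - X (sum b T)) = Y g * sum a T - X g * sum b T"
  shows "(\<Sum>t\<in>T. a t * (\<Prod>s\<in>T - {t}. f + k s * g)) * (g * Y f - f * Y g)
       = (\<Sum>t\<in>T. b t * (\<Prod>s\<in>T - {t}. f + k s * g)) * (g * X f - f * X g)"
proof -
  define m where "m t = f + k t * g" for t
  define WX where "WX = g * X f - f * X g"
  define WY where "WY = g * Y f - f * Y g"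
  define P where "P = (\<Prod>s\<in>T. m s)"
  have W: "g * X (m t) - m t * X g = WX" "g * Y (m t) - m t * Y g = WY" for t
    unfolding m_def WX_def WY_def derivation.add[OF X] derivation.mult[OF X] derivation.add[OF Y] derivation.mult[OF Y] k
    by (simp_all add: algebra_simps)
  have 1: "(WY * a t - WX * b t) * (\<Prod>s\<in>T - {t}. m s) = P * (g * (Y (a t) - X (b t)) - (Y g * a t - X g * b t))"
    if t: "t \<in> T" for t
  proof -
    have "WY * a t - WX * b t = g * (Y (m t) * a t - X (m t) * b t) - m t * (Y g * a t - X g * b t)"
      unfolding W(1)[of t, symmetric] W(2)[of t, symmetric] by (simp add: algebra_simps)
    also have "\<dots> = m t * (g * (Y (a t) - X (b t)) - (Y g * a t - X g * b t))"
      unfolding cl[OF t, folded m_def, symmetric] by (simp add: algebra_simps)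
    finally show ?thesis
      unfolding P_def using prod.remove[OF T t, of m] by (simp add: mult_ac)
  qed
  have "WY * (\<Sum>t\<in>T. a t * (\<Prod>s\<in>T - {t}. m s)) - WX * (\<Sum>t\<in>T. b t * (\<Prod>s\<in>T - {t}. m s))
      = (\<Sum>t\<in>T. (WY * a t - WX * b t) * (\<Prod>s\<in>T - {t}. m s))"
    by (simp add: sum_distrib_left left_diff_distrib sum_subtractf mult.assoc)
  also have "\<dots> = (\<Sum>t\<in>T. P * (g * (Y (a t) - X (b t)) - (Y g * a t - X g * b t)))"
    by (rule sum.cong[OF refl 1])
  also have "\<dots> = P * (g * (Y (sum a T) - X (sum b T)) - (Y g * sum a T - X g * sum b T))"
    unfolding derivation.sum[OF X] derivation.sum[OF Y]
    by (simp add: sum_distrib_left sum_subtractf right_diff_distrib mult_ac)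
  also have "\<dots> = 0" using inf by simp
  finally show ?thesis unfolding WX_def WY_def m_def by (simp add: mult.commute)
qed

text \<open>(Va, Vb)/P is the sum of the closed forms (a t, b t)/m t over a common
  denominator.\<close>

lemma closed_sum:
  fixes X Y :: "'a::idom \<Rightarrow> 'a"
  assumes X: "derivation X" and Y: "derivation Y" and T: "finite T"
    and cl: "\<And>t. t \<in> T \<Longrightarrow> m t * (Y (a t) - X (b t)) = Y (m t) * a t - X (m t) * b t"
  defines "P \<equiv> \<Prod>s\<in>T. m s" and "Va \<equiv> \<Sum>t\<in>T. a t * (\<Prod>s\<in>T - {t}. m s)"
    and "Vb \<equiv> \<Sum>t\<in>T. b t * (\<Prod>s\<in>T - {t}. m s)"
  shows "P * (Y Va - X Vb) = Y P * Va - X P * Vb"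
proof -
  have 1: "P * (Y (a t * n) - X (b t * n)) = Y P * (a t * n) - X P * (b t * n)"
    if t: "t \<in> T" and n: "n = (\<Prod>s\<in>T - {t}. m s)" for t n
  proof -
    have P: "P = m t * n" unfolding P_def n by (rule prod.remove[OF T t])
    have "P * (Y (a t * n) - X (b t * n)) = n * n * (m t * (Y (a t) - X (b t))) + m t * n * (a t * Y n - b t * X n)"
      unfolding P derivation.mult[OF X] derivation.mult[OF Y] by (simp add: algebra_simps)
    also have "\<dots> = Y P * (a t * n) - X P * (b t * n)"
      unfolding cl[OF t] unfolding P derivation.mult[OF X] derivation.mult[OF Y] by (simp add: algebra_simps)
    finally show ?thesis .
  qed
  have "P * (Y Va - X Vb) = (\<Sum>t\<in>T. P * (Y (a t * (\<Prod>s\<in>T - {t}. m s)) - X (b t * (\<Prod>s\<in>T - {t}. m s))))"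
    unfolding Va_def Vb_def derivation.sum[OF X] derivation.sum[OF Y]
    by (simp add: sum_distrib_left sum_subtractf right_diff_distrib)
  also have "\<dots> = (\<Sum>t\<in>T. Y P * (a t * (\<Prod>s\<in>T - {t}. m s)) - X P * (b t * (\<Prod>s\<in>T - {t}. m s)))"
    by (intro sum.cong refl 1)
  also have "\<dots> = Y P * Va - X P * Vb"
    unfolding Va_def Vb_def by (simp add: sum_distrib_left sum_subtractf)
  finally show ?thesis .
qed

text \<open>If the closed form \<open>(a, b)/P\<close> equals \<open>\<psi> dr\<close> with \<open>r = f/g\<close>, then \<open>d\<psi> \<and> dr = 0\<close>; here
  \<open>(A, B) = g\<^sup>2 dr\<close> and \<open>\<psi> = b g\<^sup>2/(P B)\<close>.\<close>
lemma first_integral_of_closed: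
  fixes X Y :: "'a::idom \<Rightarrow> 'a" and f g a b P :: 'a
  assumes X: "derivation X" and Y: "derivation Y" and comm: "\<And>z. X (Y z) = Y (X z)"
  defines "A \<equiv> g * X f - f * X g" and "B \<equiv> g * Y f - f * Y g"
  assumes wedge: "a * B = b * A" and cl: "P * (Y a - X b) = Y P * a - X P * b"
  defines "D \<equiv> \<lambda>z. X z * B - Y z * A"
  shows "(P * B) * D (b * g\<^sup>2) = (b * g\<^sup>2) * D (P * B)"
proof -
  note dX = derivation.mult[OF X] derivation.diff[OF X] derivation.add[OF X]
  note dY = derivation.mult[OF Y] derivation.diff[OF Y] derivation.add[OF Y]
  \<comment> \<open>The closedness of dr = (A, B)/g^2, with denominators cleared.\<close>
  have dW: "g * (Y A - X B) = 2 * (Y g * A - X g * B)"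
    unfolding A_def B_def dX dY comm by (simp add: algebra_simps)
  have Y1: "Y a * B + a * Y B = Y b * A + b * Y A"
    using arg_cong[OF wedge, of Y] unfolding dY .
  have "P * B * D b = P * B * (X b * B) - P * B * (Y b * A)" by (simp add: D_def algebra_simps)
  also have "Y b * A = Y a * B + a * Y B - b * Y A" using Y1 by (simp add: algebra_simps)
  also have "P * B * (X b * B) - P * B * (Y a * B + a * Y B - b * Y A)
     = - B * B * (P * (Y a - X b)) - P * (a * B) * Y B + P * b * B * Y A"
    by (simp add: algebra_simps)
  also have "\<dots> = - B * (Y P * (a * B) - X P * b * B) - P * (a * B) * Y B + P * b * B * Y A"
    unfolding cl by (simp add: algebra_simps)
  also have "\<dots> = b * (B * D P + P * D B) + b * P * B * (Y A - X B)"
    unfolding wedge by (simp add: D_def algebra_simps)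
  finally have Db: "P * B * D b = b * (B * D P + P * D B) + b * P * B * (Y A - X B)" .
  have Dm: "D (y * z) = D y * z + y * D z" for y z
    unfolding D_def dX dY by (simp add: algebra_simps)
  have "(P * B) * D (b * g\<^sup>2) = g * (g * (P * B * D b) + 2 * b * P * B * D g)"
    unfolding Dm power2_eq_square by (simp add: algebra_simps)
  also have "g * (P * B * D b) + 2 * b * P * B * D g
      = b * g * (B * D P + P * D B) + b * P * B * (g * (Y A - X B)) + 2 * b * P * B * D g"
    unfolding Db by (simp add: algebra_simps)
  also have "\<dots> = b * g * (B * D P + P * D B)"
    unfolding dW D_def by (simp add: algebra_simps)
  also have "g * (b * g * (B * D P + P * D B)) = (b * g\<^sup>2) * D (P * B)"
    unfolding Dm power2_eq_square by (simp add: algebra_simps)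
  finally show ?thesis .
qed

section \<open>The chart Z = 1\<close>

definition dehom :: "'a::comm_semiring_1 poly poly poly \<Rightarrow> 'a poly poly" where
  "dehom P = poly P 1"

lemma dehom_simps [simp]: "dehom 0 = 0" "dehom 1 = 1" "dehom (P + Q) = dehom P + dehom Q"
    "dehom (P * Q) = dehom P * dehom Q" "dehom (const3 c) = [:[:c:]:]"
  by (simp_all add: dehom_def const3_def)

lemma dehom_diff [simp]: "dehom (P - Q) = dehom P - dehom Q"
  for P :: "'a::comm_ring_1 poly poly poly"
  by (simp add: dehom_def)

lemma dehom_sum: "dehom (sum h A) = (\<Sum>x\<in>A. dehom (h x))"
  by (induction A rule: infinite_finite_induct) simp_all

lemma dehom_prod: "dehom (prod h A) = (\<Prod>x\<in>A. dehom (h x))"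
  by (induction A rule: infinite_finite_induct) simp_all

lemma dehom_prod_mset: "dehom (prod_mset (image_mset h A)) = (\<Prod>x\<in>#A. dehom (h x))"
  by (induction A) simp_all

lemma dehom_pd:
  "dehom (pd 0 P) = map_poly pderiv (dehom P)" "dehom (pd (Suc 0) P) = pderiv (dehom P)"
proof -
  interpret X: derivation "map_poly pderiv :: 'a poly poly \<Rightarrow> 'a poly poly"
    by (intro derivation_map_poly derivation_pderiv)
  show "dehom (pd 0 P) = map_poly pderiv (dehom P)"
    by (induction P) (simp_all add: pd_def dehom_def map_poly_pCons X.add)
  show "dehom (pd (Suc 0) P) = pderiv (dehom P)"
    by (induction P) (simp_all add: pd_def dehom_def map_poly_pCons pderiv_add)
qed

lemma coeff_dehom: "coeff (coeff (dehom P) b) c = (\<Sum>a\<le>degree P. cf P a b c)"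
  by (simp add: dehom_def poly_altdef coeff_sum cf_def)

lemma coeff_dehom_hom:
  assumes "hom n P"
  shows "coeff (coeff (dehom P) b) c = (if b + c \<le> n then cf P (n - b - c) b c else 0)"
proof -
  have *: "cf P a b c = (if a + b + c = n then cf P a b c else 0)" for a
    using assms by (auto simp: hom_def)
  have "coeff (coeff (dehom P) b) c = (\<Sum>a\<le>degree P. if a + b + c = n then cf P a b c else 0)"
    unfolding coeff_dehom using * by (intro sum.cong) auto
  also have "\<dots> = (if b + c \<le> n then cf P (n - b - c) b c else 0)"
  proof (cases "b + c \<le> n")
    case True
    then have "(\<Sum>a\<le>degree P. if a + b + c = n then cf P a b c else 0)
        = (\<Sum>a\<le>degree P. if a = n - b - c then cf P a b c else 0)"
      by (intro sum.cong) auto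
    also have "\<dots> = (if n - b - c \<le> degree P then cf P (n - b - c) b c else 0)" by simp
    also have "\<dots> = cf P (n - b - c) b c" by (auto simp: cf_def coeff_eq_0)
    finally show ?thesis using True by simp
  qed (auto intro!: sum.neutral)
  finally show ?thesis .
qed

lemma dehom_inj: "hom n P \<Longrightarrow> dehom P = 0 \<Longrightarrow> P = 0"
proof (rule cf_eqI)
  fix a b c assume P: "hom n P" "dehom P = 0"
  show "cf P a b c = cf 0 a b c"
  proof (rule ccontr)
    assume "cf P a b c \<noteq> cf 0 a b c"
    then have "cf P a b c \<noteq> 0" by simp
    moreover from this have "a + b + c = n" using P(1) unfolding hom_def by blast
    ultimately show False using coeff_dehom_hom[OF P(1), of b c] P(2) by (auto simp flip: \<open>a + b + c = n\<close>)
  qed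
qed

lemma cf_homog:
  assumes "tdeg2 f \<le> d"
  shows "cf (homog d f) a b c = (if a + b + c = d then coeff (coeff f b) c else 0)"
proof -
  have monom3: "cf (monom (monom (monom x j) i) k) a b c = (if k = a \<and> i = b \<and> j = c then x else 0)"
    for x :: 'a and i j k
    by (simp add: cf_def coeff_monom)
  have "cf (homog d f) a b c = (\<Sum>i\<le>degree f. \<Sum>j\<le>degree (coeff f i).
      if i = b \<and> j = c \<and> a = d - b - c then coeff (coeff f b) c else 0)"
    unfolding homog_def cf_sum monom3 by (intro sum.cong refl) auto
  also have "\<dots> = (\<Sum>i\<le>degree f. if i = b then
     (\<Sum>j\<le>degree (coeff f b). if j = c then (if a = d - b - c then coeff (coeff f b) c else 0) else 0) else 0)"
    by (intro sum.cong refl) (auto intro!: sum.cong sum.neutral)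
  also have "\<dots> = (if a = d - b - c then coeff (coeff f b) c else 0)"
    by (auto simp: coeff_eq_0)
  also have "\<dots> = (if a + b + c = d then coeff (coeff f b) c else 0)"
    using tdeg2_ge[of f b c] assms by (cases "coeff (coeff f b) c = 0") auto
  finally show ?thesis .
qed

lemma hom_homog: "tdeg2 f \<le> d \<Longrightarrow> hom d (homog d f)"
  by (simp add: hom_def cf_homog)

lemma dehom_homog: "tdeg2 f \<le> d \<Longrightarrow> dehom (homog d f) = f"
proof -
  assume d: "tdeg2 f \<le> d"
  have "coeff (coeff (dehom (homog d f)) b) c = coeff (coeff f b) c" for b c
    using tdeg2_ge[of f b c] d unfolding coeff_dehom_hom[OF hom_homog[OF d]] cf_homog[OF d]
    by (cases "coeff (coeff f b) c = 0") auto
  then show ?thesis by (simp add: poly_eq_iff)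
qed

text \<open>A common prime factor P is homogeneous, and its dehomogenization divides f and g, hence
  is constant. So Z divides P; but d is the exact maximum of the degrees, so Z does not divide both
  homogenizations.\<close>

lemma coprime_homog:
  fixes f g :: "'k::{field_gcd, field_char_0} poly poly"
  assumes "coprime f g" and d: "d = max (tdeg2 f) (tdeg2 g)" "d \<ge> 1"
  shows "coprime (homog d f) (homog d g)"
proof (rule ccontr)
  let ?F = "homog d f" and ?G = "homog d g"
  assume "\<not> coprime ?F ?G"
  then have nu: "\<not> is_unit (gcd ?F ?G)" by (simp add: coprime_iff_gcd_eq_1)
  have df: "tdeg2 f \<le> d" "tdeg2 g \<le> d" by (auto simp: d)
  have top: "\<exists>b c. coeff (coeff h b) c \<noteq> 0 \<and> b + c = d" if "tdeg2 h = d" for h :: "'k poly poly"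
    using tdeg2_attained[of h] that d(2) by (metis less_eq_Suc_le One_nat_def)
  have "\<exists>b c. cf ?F 0 b c \<noteq> 0 \<or> cf ?G 0 b c \<noteq> 0"
    using top[of f] top[of g] d(1) unfolding cf_homog[OF df(1)] cf_homog[OF df(2)] by (metis add_0 max_def)
  then obtain b c where bc: "cf ?F 0 b c \<noteq> 0 \<or> cf ?G 0 b c \<noteq> 0" by blast
  then have "gcd ?F ?G \<noteq> 0" by (auto simp: gcd_eq_0_iff)
  then obtain P where P: "prime P" "P dvd gcd ?F ?G" using nu prime_divisor_exists by blast
  then have PFG: "P dvd ?F" "P dvd ?G" by auto
  have pe: "prime_elem P" using P(1) by simp
  have "?F \<noteq> 0 \<or> ?G \<noteq> 0" using bc by auto
  then obtain n where n: "hom n P"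
    using prime_factor_hom[OF pe PFG(1) _ hom_homog[OF df(1)]] prime_factor_hom[OF pe PFG(2) _ hom_homog[OF df(2)]] by blast
  have "n > 0" using prime_hom_pos[OF pe n] .
  have "dehom P dvd f" "dehom P dvd g"
    using PFG dehom_homog[OF df(1)] dehom_homog[OF df(2)] by (metis dehom_simps(4) dvd_def)+
  then have "is_unit (dehom P)" using assms(1) coprime_common_divisor by blast
  then obtain x where x: "dehom P = [:[:x:]:]" by (auto simp: is_unit_poly_iff)
  have "cf P 0 b' c' = 0" for b' c'
  proof (rule ccontr)
    assume nz: "cf P 0 b' c' \<noteq> 0"
    then have "b' + c' = n" using n unfolding hom_def by fastforce
    then show False using coeff_dehom_hom[OF n, of b' c'] nz \<open>n > 0\<close>
      by (auto simp: x coeff_pCons split: nat.splits)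
  qed
  then have P0: "coeff P 0 = 0" by (simp add: cf_def poly_eq_iff)
  have "coeff H 0 = 0" if "P dvd H" for H using that P0 by (auto simp: coeff_mult_0 elim!: dvdE)
  then show False using bc PFG by (auto simp: cf_def)
qed

section \<open>Pencils of plane curves\<close>

lemma dvd_diff_mult:
  fixes m :: "'a::comm_ring_1"
  assumes "m dvd a - a'" "m dvd b - b'"
  shows "m dvd a * b - a' * b'"
proof -
  have "a * b - a' * b' = (a - a') * b + a' * (b - b')" by (simp add: algebra_simps)
  then show ?thesis using assms by simp
qed

locale hom_pencil =
  fixes F G :: "'k::{field_gcd, field_char_0} poly poly poly" and d :: nat
  assumes hom_F: "hom d F" and hom_G: "hom d G" and d_pos: "d \<ge> 1" and coprime_FG: "coprime F G"
begin

text \<open>The member through the point \<open>(1 : t)\<close> resp. \<open>(0 : 1)\<close> of the pencil, and a member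
  complementary to it.\<close>
definition mem :: "'k option \<Rightarrow> 'k poly poly poly" where
  "mem s = (case s of None \<Rightarrow> G | Some t \<Rightarrow> F + const3 t * G)"

definition comp :: "'k option \<Rightarrow> 'k poly poly poly" where
  "comp s = (case s of None \<Rightarrow> F | Some t \<Rightarrow> G)"

text \<open>The components of G^2 dr for r = F/G; not to be confused with
  \<open>theta_inv\<close>.\<close>

definition theta :: "nat \<Rightarrow> 'k poly poly poly" where
  "theta i = G * pd i F - F * pd i G"

lemma mem_simps [simp]: "mem None = G" "mem (Some t) = F + const3 t * G"
  and comp_simps [simp]: "comp None = F" "comp (Some t) = G"
  by (simp_all add: mem_def comp_def)

lemma hom_mem: "hom d (mem s)"
  by (cases s) (simp_all add: hom_add hom_const3_mult hom_F hom_G)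

lemma coprime_mem_comp: "coprime (mem s) (comp s)"
proof (cases s)
  case (Some t)
  show ?thesis
  proof (rule coprimeI)
    fix c assume c: "c dvd mem s" "c dvd comp s"
    then have "c dvd (F + const3 t * G) - const3 t * G" using Some by (intro dvd_diff) auto
    then have "c dvd F" by simp
    then show "is_unit c" using c Some coprime_FG coprime_common_divisor by auto
  qed
qed (use coprime_FG in \<open>simp add: coprime_commute\<close>)

lemma not_unit_mem: "\<not> is_unit (mem s)"
proof
  assume "is_unit (mem s)"
  then obtain c where "c \<noteq> 0" "mem s = const3 c" by (rule is_unit_imp_const3)
  then show False using hom_unique[of d "mem s" 0] hom_mem[of s] hom_const3[of c] d_pos by auto
qed

lemma hom_comp: "hom d (comp s)"
  by (cases s) (simp_all add: hom_F hom_G)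

lemma not_unit_comp: "\<not> is_unit (comp s)"
proof
  assume "is_unit (comp s)"
  then obtain c where "c \<noteq> 0" "comp s = const3 c" by (rule is_unit_imp_const3)
  then show False using hom_unique[of d "comp s" 0] hom_comp[of s] hom_const3[of c] d_pos by auto
qed

lemma mem_nonzero: "mem s \<noteq> 0"
  using coprime_mem_comp[of s] not_unit_comp[of s] by auto

text \<open>Modulo \<open>mem t\<close> the pencil is spanned by \<open>comp t\<close>
  alone.\<close>

lemma mem_cong:
  "\<exists>c. mem t dvd mem s - const3 c * comp t \<and> (s \<noteq> t \<longrightarrow> c \<noteq> 0)"
proof (cases s; cases t)
  fix a b assume "s = Some a" "t = Some b"
  then show ?thesis by (intro exI[of _ "a - b"]) (simp add: const3_diff algebra_simps)
next
  fix b assume "s = None" "t = Some b"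
  then show ?thesis by (intro exI[of _ 1]) simp
next
  fix a assume "s = Some a" "t = None"
  then show ?thesis by (intro exI[of _ 1]) simp
next
  assume "s = None" "t = None"
  then show ?thesis by (intro exI[of _ 0]) simp
qed

lemma prod_mem_cong:
  "\<exists>c. mem t dvd (\<Prod>s\<in>#A. mem s) - const3 c * comp t ^ size A \<and> (t \<notin># A \<longrightarrow> c \<noteq> 0)"
proof (induction A)
  case empty
  show ?case by (intro exI[of _ 1]) simp
next
  case (add s A)
    then obtain c where c: "mem t dvd (\<Prod>s\<in>#A. mem s) - const3 c * comp t ^ size A" "t \<notin># A \<longrightarrow> c \<noteq> 0" by blast
  obtain c' where c': "mem t dvd mem s - const3 c' * comp t" "s \<noteq> t \<longrightarrow> c' \<noteq> 0"
    using mem_cong[of t s] by blast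
    have "mem t dvd mem s * (\<Prod>s\<in>#A. mem s) - (const3 c' * comp t) * (const3 c * comp t ^ size A)"
      by (rule dvd_diff_mult[OF c'(1) c(1)])
    then show ?case using c(2) c'(2)
      by (intro exI[of _ "c' * c"]) (auto simp: const3_mult mult_ac)
qed

lemma prime_dvd_mem_unique:
  assumes "prime_elem P" "P dvd mem t" "P dvd mem s"
  shows "s = t"
proof (rule ccontr)
  assume "s \<noteq> t"
  obtain c where c: "mem t dvd mem s - const3 c * comp t" "c \<noteq> 0"
    using mem_cong[of t s] \<open>s \<noteq> t\<close> by blast
  have "P dvd mem s - (mem s - const3 c * comp t)"
    using assms(3) dvd_trans[OF assms(2) c(1)] by (rule dvd_diff)
  then have "P dvd const3 c * comp t" by simp
  then have "P dvd comp t" using is_unit_const3[OF c(2)] by (simp add: dvd_mult_unit_iff')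
  then have "is_unit P" using assms(2) coprime_mem_comp coprime_common_divisor by blast
  then show False using assms(1) by (simp add: prime_elem_def)
qed

text \<open>\<open>theta\<close> is alternating in the basis of the pencil, and
  (\<open>mem s\<close>, \<open>comp s\<close>) differs from (F, G) by a transformation of
  determinant 1 or -1.\<close>

lemma theta_mem: "theta i = (case s of None \<Rightarrow> -1 | Some _ \<Rightarrow> 1) * (comp s * pd i (mem s) - mem s * pd i (comp s))"
  by (cases s) (simp_all add: theta_def derivation.add[OF derivation_pd] derivation.mult[OF derivation_pd] algebra_simps)

lemma hom_theta: "hom (2 * d - 1) (theta i)"
  using hom_mult_pd[OF hom_G hom_F, of i] hom_mult_pd[OF hom_F hom_G, of i]
  unfolding theta_def by (intro hom_diff) (simp_all add: mult_2)

lemma euler_theta: "(\<Sum>i<3. xv i * theta i) = 0"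
proof -
  have "(\<Sum>i<3. xv i * theta i) = G * euler F - F * euler G"
    by (simp add: theta_def euler_def right_diff_distrib sum_subtractf sum_distrib_left mult_ac)
  also have "\<dots> = 0" using hom_F hom_G by (simp add: hom_iff_euler)
  finally show ?thesis .
qed

text \<open>A prime of multiplicity \<open>e\<close> in a member has multiplicity only \<open>e - 1\<close> in \<open>theta\<close>.\<close>
lemma cancel_members:
  assumes "\<And>i. i < 3 \<Longrightarrow> V i * (\<Prod>s\<in>#J. mem s) = const3 c * (\<Prod>s\<in>#I. mem s) * theta i"
  shows "(\<forall>i<3. V i = 0) \<or> (\<exists>I' c'. size I' + size J = size I \<and>
     (\<forall>i<3. V i = const3 c' * (\<Prod>s\<in>#I'. mem s) * theta i))"
  using assms
proof (induction J arbitrary: I)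
  case empty
  then show ?case by auto
next
  case (add s J)
  show ?case
  proof (cases "s \<in># I")
    case True
    then obtain I0 where I0: "I = add_mset s I0" by (metis insert_DiffM)
    have "V i * (\<Prod>s\<in>#J. mem s) = const3 c * (\<Prod>s\<in>#I0. mem s) * theta i" if "i < 3" for i
    proof -
      have "mem s * (V i * (\<Prod>s\<in>#J. mem s)) = mem s * (const3 c * (\<Prod>s\<in>#I0. mem s) * theta i)"
        using add.prems[OF that] by (simp add: I0 mult_ac)
      then show ?thesis using mem_nonzero by simp
    qed
    from add.IH[OF this] I0 show ?thesis by simp
  next
    case False
    show ?thesis
    proof (cases "c = 0")
      case True
      then have "V i = 0" if "i < 3" for i
        using add.prems[OF that] mem_nonzero by (auto simp: prod_mset_zero_iff)
      then show ?thesis by blast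
    next
      case c: False
      obtain P where P: "prime P" "P dvd mem s" using prime_divisor_exists[OF mem_nonzero not_unit_mem] by blast
      have pe: "prime_elem P" "\<not> is_unit P" using P(1) by (auto simp: not_prime_unit)
      define e where "e = multiplicity P (mem s)"
      obtain A' where A': "mem s = P ^ e * A'" "\<not> P dvd A'"
        using multiplicity_decompose'[OF mem_nonzero pe(2)] unfolding e_def by blast
      have "e \<noteq> 0" using A' P(2) by (cases e) auto
      obtain n where n: "hom n P" using prime_factor_hom[OF pe(1) P(2) mem_nonzero hom_mem] by blast
      obtain i where i: "i < 3" "\<not> P dvd pd i P" using prime_not_dvd_pd[OF pe(1) n] by blast
      have nc: "\<not> P dvd comp s"
        using coprime_mem_comp[of s] P(2) pe(2) coprime_common_divisor by blast
      \<comment> \<open>The wronskian lemma with R = \<open>comp s\<close>, where P has order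
        0.\<close>
      have nd: "\<not> P ^ (e + 0 + 1) dvd P * (comp s * pd i (mem s) - mem s * pd i (comp s))"
        by (rule prime_power_not_dvd_wronskian[OF pe(1) i(2) \<open>e \<noteq> 0\<close> A' _ nc]) simp
      have "\<not> P ^ e dvd comp s * pd i (mem s) - mem s * pd i (comp s)"
        using nd pe(1) by (auto simp: prime_elem_def)
      moreover have "theta i = comp s * pd i (mem s) - mem s * pd i (comp s) \<or>
          theta i = - (comp s * pd i (mem s) - mem s * pd i (comp s))"
        unfolding theta_mem[of i s] by (cases s) auto
      ultimately have nt: "\<not> P ^ e dvd theta i" by (metis dvd_minus_iff)
      have "P ^ e dvd V i * (\<Prod>s\<in>#add_mset s J. mem s)" using A'(1) by simp
      then have "P ^ e dvd (const3 c * (\<Prod>s\<in>#I. mem s)) * theta i" using add.prems[OF i(1)] by simp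
      moreover have "\<not> P dvd const3 c * (\<Prod>s\<in>#I. mem s)"
      proof
        assume "P dvd const3 c * (\<Prod>s\<in>#I. mem s)"
        then have "P dvd (\<Prod>s\<in>#I. mem s)" using is_unit_const3[OF c] by (simp add: dvd_mult_unit_iff')
        then obtain s' where "s' \<in># I" "P dvd mem s'" using P(1) by (auto simp: prime_dvd_prod_mset_iff)
        then show False using prime_dvd_mem_unique[OF pe(1) P(2)] False by blast
      qed
      then have "coprime P (const3 c * (\<Prod>s\<in>#I. mem s))"
        by (rule prime_elem_imp_coprime[OF pe(1)])
      then have "coprime (P ^ e) (const3 c * (\<Prod>s\<in>#I. mem s))"
        by (simp only: coprime_power_left_iff simp_thms)
      ultimately have "P ^ e dvd theta i" by (simp only: coprime_dvd_mult_right_iff)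
      then show ?thesis using nt by blast
    qed
  qed
qed

text \<open>Reduction modulo \<open>mem (Some t)\<close>. In V only the summand of t survives, and
  the product of the other members becomes a nonzero constant times G^(card T - 1). In the second
  case of the hypothesis, \<open>theta i\<close> becomes G * pd i (mem (Some t)) and the product
  over I a constant times G^(size I). Since size I + 2 = card T, the powers of G agree and cancel,
  leaving v t proportional to d(mem (Some t)), exactly and not just as a congruence, because both
  have degree d - 1. Contraction with the Euler field shows that the factor is 0.\<close>

lemma independent_if_pullback:
  fixes v :: "'k \<Rightarrow> nat \<Rightarrow> 'k poly poly poly"
  assumes T: "finite T" "t \<in> T"
    and hom: "\<And>i. hom (d - 1) (v t i)" and euler: "(\<Sum>i<3. xv i * v t i) = 0"
    and V: "(\<forall>i<3. V i = 0) \<or> (\<exists>I c. size I + 2 = card T \<and> (\<forall>i<3. V i = const3 c * (\<Prod>s\<in>#I. mem s) * theta i))"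
    and V_def: "\<And>i. V i = (\<Sum>t\<in>T. v t i * (\<Prod>s\<in>T - {t}. mem (Some s)))"
    and "i < 3"
  shows "v t i = 0"
proof -
  let ?Ft = "mem (Some t)"
  let ?A = "image_mset Some (mset_set (T - {t}))"
  have sz: "size ?A = card T - 1" using T by simp
  have "Some t \<notin># ?A" using T by auto
  moreover obtain c1 where c1: "?Ft dvd (\<Prod>s\<in>#?A. mem s) - const3 c1 * comp (Some t) ^ size ?A"
      "Some t \<notin># ?A \<longrightarrow> c1 \<noteq> 0"
    using prod_mem_cong by blast
  ultimately have c1': "c1 \<noteq> 0" "?Ft dvd (\<Prod>s\<in>T - {t}. mem (Some s)) - const3 c1 * G ^ (card T - 1)"
    unfolding sz by (auto simp: prod_unfold_prod_mset image_mset.compositionality o_def)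
  have Vc: "?Ft dvd V i - const3 c1 * G ^ (card T - 1) * v t i" for i
  proof -
    have "V i = v t i * (\<Prod>s\<in>T - {t}. mem (Some s)) + (\<Sum>u\<in>T - {t}. v u i * (\<Prod>s\<in>T - {u}. mem (Some s)))"
      unfolding V_def using T by (simp add: sum.remove)
    moreover have "?Ft dvd (\<Sum>u\<in>T - {t}. v u i * (\<Prod>s\<in>T - {u}. mem (Some s)))"
    proof (intro dvd_sum dvd_mult)
      fix u assume "u \<in> T - {t}"
      then show "?Ft dvd (\<Prod>s\<in>T - {u}. mem (Some s))" using T by (intro dvd_prodI) auto
    qed
    moreover have "?Ft dvd v t i * ((\<Prod>s\<in>T - {t}. mem (Some s)) - const3 c1 * G ^ (card T - 1))"
      using c1'(2) by simp
    moreover have "V i - const3 c1 * G ^ (card T - 1) * v t i = v t i * ((\<Prod>s\<in>T - {t}. mem (Some s)) - const3 c1 * G ^ (card T - 1))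
       + (V i - v t i * (\<Prod>s\<in>T - {t}. mem (Some s)))"
      by (simp add: algebra_simps)
    ultimately show ?thesis by (simp only: add_diff_cancel_left' dvd_add)
  qed
  have cop: "coprime ?Ft (G ^ n)" for n using coprime_mem_comp[of "Some t"] by simp
  have "\<exists>c. \<forall>i<3. const3 c1 * v t i = const3 c * pd i ?Ft"
    using V
  proof
    assume V0: "\<forall>i<3. V i = 0"
    have "v t i = 0" if "i < 3" for i
    proof (rule hom_dvd_lt_imp_0[OF hom_mem _ hom])
      have "?Ft dvd const3 c1 * G ^ (card T - 1) * v t i" using Vc[of i] V0 that by simp
      then have "?Ft dvd G ^ (card T - 1) * v t i"
        using is_unit_const3[OF c1'(1)] by (simp add: dvd_mult_unit_iff' mult.assoc)
      then show "?Ft dvd v t i" using cop by (simp only: coprime_dvd_mult_right_iff)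
      show "d - 1 < d" using d_pos by simp
    qed
    then show ?thesis by (intro exI[of _ 0]) simp
  next
    assume "\<exists>I c. size I + 2 = card T \<and> (\<forall>i<3. V i = const3 c * (\<Prod>s\<in>#I. mem s) * theta i)"
    then obtain I c where I: "size I + 2 = card T" "\<And>i. i < 3 \<Longrightarrow> V i = const3 c * (\<Prod>s\<in>#I. mem s) * theta i" by blast
    obtain c2 where c2: "?Ft dvd (\<Prod>s\<in>#I. mem s) - const3 c2 * comp (Some t) ^ size I"
      using prod_mem_cong by blast
    have "const3 c1 * v t i = const3 (c * c2) * pd i ?Ft" if "i < 3" for i
    proof -
      have "theta i - G * pd i ?Ft = - (?Ft * pd i G)" unfolding theta_mem[of i "Some t"] by simp
      then have "?Ft dvd theta i - G * pd i ?Ft" by (metis dvd_minus_iff dvd_triv_left)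
      then have "?Ft dvd (const3 c * (\<Prod>s\<in>#I. mem s)) * theta i - (const3 c * (const3 c2 * G ^ size I)) * (G * pd i ?Ft)"
        using c2 by (intro dvd_diff_mult) (auto simp flip: right_diff_distrib)
      then have "?Ft dvd V i - const3 (c * c2) * G ^ (card T - 1) * pd i ?Ft"
        using I(2)[OF that] by (simp add: const3_mult mult_ac flip: I(1) del: mem_simps)
      from dvd_diff[OF this Vc[of i]]
      have "?Ft dvd G ^ (card T - 1) * (const3 c1 * v t i - const3 (c * c2) * pd i ?Ft)"
        by (simp add: algebra_simps)
      then have "?Ft dvd const3 c1 * v t i - const3 (c * c2) * pd i ?Ft"
        using cop by (simp only: coprime_dvd_mult_right_iff)
      moreover have "hom (d - 1) (const3 c1 * v t i - const3 (c * c2) * pd i ?Ft)"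
        by (intro hom_diff hom_const3_mult hom hom_pd hom_mem)
      ultimately have "const3 c1 * v t i - const3 (c * c2) * pd i ?Ft = 0"
        using hom_dvd_lt_imp_0[OF hom_mem] d_pos by (metis diff_less less_le_trans zero_less_one)
      then show ?thesis by simp
    qed
    then show ?thesis by blast
  qed
  then obtain c where c: "\<And>i. i < 3 \<Longrightarrow> const3 c1 * v t i = const3 c * pd i ?Ft" by blast
  have "0 = const3 c1 * (\<Sum>i<3. xv i * v t i)" using euler by simp
  also have "\<dots> = (\<Sum>i<3. xv i * (const3 c * pd i ?Ft))"
    unfolding sum_distrib_left by (intro sum.cong refl) (simp add: mult.left_commute[of "const3 c1"] c)
  also have "\<dots> = const3 c * euler ?Ft" by (simp add: euler_def sum_distrib_left mult_ac)
  also have "\<dots> = const3 c * of_nat d * ?Ft" using hom_mem[of "Some t"] by (simp add: hom_iff_euler)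
  finally have "c = 0" using mem_nonzero[of "Some t"] d_pos by auto
  then show ?thesis using c[OF \<open>i < 3\<close>] c1'(1) by simp
qed

end

text \<open>Over an algebraically closed field a splits into linear factors, so the numerator of
  a(f/g) is a product of members f + s * g, where s runs through the negated roots of a. c and A do
  not depend on f and g.\<close>

lemma split_ev:
  fixes a :: "'k::field poly"
  assumes ac: "alg_closed_field TYPE('k)"
  shows "\<exists>c A. (c = 0 \<longleftrightarrow> a = 0) \<and> (\<forall>f g. g \<noteq> 0 \<longrightarrow>
    K2.ev a (to_fract f / to_fract g) * to_fract g ^ size A = to_fract ([:[:c:]:] * (\<Prod>s\<in>#A. f + [:[:s:]:] * g)))"
proof (induction "degree a" arbitrary: a)
  case 0
  then obtain c where c: "a = [:c:]" by (metis degree_eq_zeroE)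
  show ?case by (intro exI[of _ c] exI[of _ "{#}"]) (simp add: c, simp add: const_fract_def)
next
  case (Suc n)
  then obtain x where "poly a x = 0" using ac unfolding alg_closed_field_def by (metis Suc_le_mono le0 One_nat_def)
  then obtain a' where a': "a = [:- x, 1:] * a'" by (auto simp: poly_eq_0_iff_dvd)
  have "a' \<noteq> 0" using Suc.hyps(2) a' by auto
  then have "degree a = Suc (degree a')" unfolding a' by (subst degree_mult_eq) auto
  then obtain c A where cA: "c = 0 \<longleftrightarrow> a' = 0" "\<And>f g. g \<noteq> 0 \<Longrightarrow>
    K2.ev a' (to_fract f / to_fract g) * to_fract g ^ size A = to_fract ([:[:c:]:] * (\<Prod>s\<in>#A. f + [:[:s:]:] * g))"
    using Suc.hyps(1)[of a'] Suc.hyps(2) by auto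
  have "K2.ev a (to_fract f / to_fract g) * to_fract g ^ size (add_mset (- x) A)
      = to_fract ([:[:c:]:] * (\<Prod>s\<in>#add_mset (- x) A. f + [:[:s:]:] * g))" if g: "g \<noteq> 0" for f g
  proof -
    have 1: "K2.ev [:- x, 1:] (to_fract f / to_fract g) * to_fract g = to_fract (f + [:[:- x:]:] * g)"
    proof -
      have "K2.ev [:- x, 1:] (to_fract f / to_fract g) = to_fract [:[:- x:]:] + to_fract f / to_fract g"
        by (simp del: K2.uminus) (simp only: const_fract_def)
      also have "\<dots> * to_fract g = to_fract ([:[:- x:]:] * g) + to_fract f"
        using g by (simp only: distrib_right to_fract_mult) simp
      finally show ?thesis by (simp only: to_fract_add add.commute)
    qed
    have "K2.ev a (to_fract f / to_fract g) * to_fract g ^ size (add_mset (- x) A)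
      = (K2.ev [:- x, 1:] (to_fract f / to_fract g) * to_fract g) * (K2.ev a' (to_fract f / to_fract g) * to_fract g ^ size A)"
      unfolding a' K2.ev_mult by (simp only: size_add_mset power_Suc mult_ac)
    also have "\<dots> = to_fract ([:[:c:]:] * (\<Prod>s\<in>#add_mset (- x) A. f + [:[:s:]:] * g))"
      unfolding 1 cA(2)[OF g] by (simp only: to_fract_mult[symmetric] image_mset_add_mset prod_mset.add_mset mult_ac)
    finally show ?thesis .
  qed
  moreover have "c = 0 \<longleftrightarrow> a = 0"
    using cA(1) \<open>a' \<noteq> 0\<close> Suc.hyps(2) by auto
  ultimately show ?case by blast
qed

context hom_pencil
begin

text \<open>Closedness of w/H in the X, Y directions only, which is what the chart Z = 1
  sees.\<close>

definition closed_at :: "'k poly poly poly \<Rightarrow> (nat \<Rightarrow> 'k poly poly poly) \<Rightarrow> bool" where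
  "closed_at H w \<longleftrightarrow> H * (pd (Suc 0) (w 0) - pd 0 (w (Suc 0))) = pd (Suc 0) H * w 0 - pd 0 H * w (Suc 0)"

text \<open>V divided by the product of the members is the closed form eta, and the conclusion says
  eta = psi(r) dr: psi is a quotient of two polynomials in r, and \<open>split_ev\<close> turns
  these into products of members.\<close>

lemma pullback:
  fixes v :: "'k \<Rightarrow> nat \<Rightarrow> 'k poly poly poly"
  defines "f \<equiv> dehom F" and "g \<equiv> dehom G"
  assumes ac: "alg_closed_field TYPE('k)" and nc: "non_composite f g"
    and WY: "g * pderiv f - f * pderiv g \<noteq> 0"
    and T: "finite T"
    and hom: "\<And>t i. t \<in> T \<Longrightarrow> hom (d - 1) (v t i)"
    and euler: "\<And>t. t \<in> T \<Longrightarrow> (\<Sum>i<3. xv i * v t i) = 0"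
    and cl: "\<And>t. t \<in> T \<Longrightarrow> closed_at (mem (Some t)) (v t)"
    and cl_inf: "closed_at G (\<lambda>i. \<Sum>t\<in>T. v t i)"
    and V_def: "\<And>i. V i = (\<Sum>t\<in>T. v t i * (\<Prod>s\<in>T - {t}. mem (Some s)))"
  shows "\<exists>I J c. size I + 2 = size J + card T \<and>
     (\<forall>i<3. V i * (\<Prod>s\<in>#J. mem s) = const3 c * (\<Prod>s\<in>#I. mem s) * theta i)"
proof -
  define X :: "'k poly poly \<Rightarrow> 'k poly poly" where "X = map_poly pderiv"
  define Y :: "'k poly poly \<Rightarrow> 'k poly poly" where "Y = pderiv"
  have dX: "derivation X" and dY: "derivation Y"
    unfolding X_def Y_def by (intro derivation_map_poly derivation_pderiv)+
  have comm: "X (Y z) = Y (X z)" for z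
    by (simp add: X_def Y_def poly_eq_iff coeff_map_poly coeff_pderiv coeff_of_nat_mult del: of_nat_Suc)
  define A where "A = g * X f - f * X g"
  define B where "B = g * Y f - f * Y g"
  have B0: "B \<noteq> 0" using WY by (simp add: B_def Y_def)
  have g0: "g \<noteq> 0" using B0 nc unfolding non_composite_def B_def
    by (auto simp: dY derivation.zero)
  define k where "k t = [:[:t:]:]" for t :: 'k
  have Xk: "X (k t) = 0" and Yk: "Y (k t) = 0" for t
    by (simp_all add: X_def Y_def k_def map_poly_pCons pderiv_pCons)
  have dmem: "dehom (mem (Some t)) = f + k t * g" for t by (simp add: f_def g_def k_def)
  define a where "a t = dehom (v t 0)" for t
  define b where "b t = dehom (v t (Suc 0))" for t
  define P where "P = (\<Prod>t\<in>T. f + k t * g)"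
  have dpd: "dehom (pd 0 Q) = X (dehom Q)" "dehom (pd (Suc 0) Q) = Y (dehom Q)" for Q
    unfolding X_def Y_def by (rule dehom_pd)+
  have cl': "(f + k t * g) * (Y (a t) - X (b t)) = Y (f + k t * g) * a t - X (f + k t * g) * b t" if "t \<in> T" for t
    using arg_cong[OF cl[OF that, unfolded closed_at_def], of dehom]
    unfolding dehom_simps dehom_diff dpd dmem a_def b_def .
  have inf': "g * (Y (sum a T) - X (sum b T)) = Y g * sum a T - X g * sum b T"
    using arg_cong[OF cl_inf[unfolded closed_at_def], of dehom]
    unfolding dehom_simps dehom_diff dpd dehom_sum by (simp add: a_def b_def g_def)
  have Va: "dehom (V 0) = (\<Sum>t\<in>T. a t * (\<Prod>s\<in>T - {t}. f + k s * g))"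
    and Vb: "dehom (V (Suc 0)) = (\<Sum>t\<in>T. b t * (\<Prod>s\<in>T - {t}. f + k s * g))"
    unfolding V_def dehom_sum dehom_simps(4) dehom_prod dmem a_def b_def by (rule refl)+
  have wedge: "dehom (V 0) * B = dehom (V (Suc 0)) * A"
    unfolding Va Vb A_def B_def by (rule wedge_eq_0_of_closed[OF dX dY T Xk Yk cl' inf'])
  have clV: "P * (Y (dehom (V 0)) - X (dehom (V (Suc 0)))) = Y P * dehom (V 0) - X P * dehom (V (Suc 0))"
    unfolding Va Vb P_def by (rule closed_sum[OF dX dY T cl'])
  \<comment> \<open>D z is the coefficient of dz wedge g^2 dr. D X = B, so B \<noteq> 0 provides a
    transversal line X = t0.\<close>
  define D where "D z = X z * B - Y z * A" for z
  interpret D: derivation D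
    by unfold_locales
      (simp_all add: D_def derivation.add[OF dX] derivation.add[OF dY] derivation.mult[OF dX] derivation.mult[OF dY] algebra_simps)
  have DX: "D [:[:0, 1:]:] = B"
    by (simp add: D_def X_def Y_def map_poly_pCons pderiv_pCons one_pCons[symmetric])
  obtain t0 where t0: "at_S t0 B \<noteq> 0" using at_S_generic_nonzero[OF B0] by blast
  interpret D: plane_derivation D t0
  proof
    show "D [:[:c:]:] = 0" for c using Xk[of c] Yk[of c] by (simp add: D_def k_def)
    show "at_S t0 (D [:[:0, 1:]:]) \<noteq> 0" using t0 by (simp add: DX)
  qed
  let ?r = "to_fract f / to_fract g"
  let ?p = "dehom (V (Suc 0)) * g\<^sup>2" and ?q = "P * B"
  have csts1: "D.csts f g"
    by (simp add: D.csts_def D_def A_def B_def algebra_simps)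
  have csts2: "D.csts ?p ?q"
    unfolding D.csts_def D_def A_def B_def
    by (rule first_integral_of_closed[OF dX dY comm wedge[unfolded A_def B_def] clV])
  have mem0: "f + k t * g \<noteq> 0" for t
    using dehom_inj[OF hom_mem, of "Some t"] mem_nonzero[of "Some t"] unfolding dmem by blast
  have P0: "P \<noteq> 0" using mem0 T by (simp add: P_def)
  have nonconst: "Fract f g \<notin> range const_fract"
  proof
    assume "Fract f g \<in> range const_fract"
    then obtain c where "to_fract f / to_fract g = to_fract (k c)"
      by (auto simp: Fract_eq_to_fract const_fract_def k_def)
    then have "to_fract f = to_fract (k c * g)" using g0 by (simp add: divide_eq_eq)
    then have "f = k c * g" by (simp only: to_fract_eq_iff)
    then have "B = 0" unfolding B_def by (simp add: derivation.mult[OF dY] Yk algebra_simps)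
    then show False using B0 by simp
  qed
  have "to_fract ?p / to_fract ?q \<in> K2.gen ?r"
    using D.constants_gen[OF nc csts1 g0 nonconst csts2] P0 B0 by (simp add: Fract_eq_to_fract)
  then obtain \<alpha> \<beta> where \<alpha>\<beta>: "to_fract ?p / to_fract ?q = K2.ev \<alpha> ?r / K2.ev \<beta> ?r" "K2.ev \<beta> ?r \<noteq> 0"
    by (auto simp: K2.gen_def)
  obtain ca M where M: "K2.ev \<alpha> ?r * to_fract g ^ size M = to_fract ([:[:ca:]:] * (\<Prod>s\<in>#M. f + k s * g))"
    using split_ev[OF ac, of \<alpha>] g0 unfolding k_def by blast
  obtain cb N where N: "cb \<noteq> 0" "K2.ev \<beta> ?r * to_fract g ^ size N = to_fract ([:[:cb:]:] * (\<Prod>s\<in>#N. f + k s * g))"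
    using split_ev[OF ac, of \<beta>] g0 \<alpha>\<beta>(2) unfolding k_def by (metis K2.ev_0)
  \<comment> \<open>Clearing denominators in psi = \<alpha>(r)/\<beta>(r): a root of \<alpha>
    contributes a member to I and a factor G to J, a root of \<beta> does the reverse; the factor P
    in the denominator of psi puts T into I, and g^2 in its numerator puts two copies of G into
    J.\<close>
  define I where "I = image_mset Some M + replicate_mset (size N) None + image_mset Some (mset_set T)"
  define J where "J = image_mset Some N + replicate_mset (size M + 2) None"
  let ?dm = "\<lambda>s. dehom (mem s)"
  have dm_Some: "(\<Prod>s\<in>#image_mset Some M. ?dm s) = (\<Prod>s\<in>#M. f + k s * g)" for M
    by (simp add: image_mset.compositionality o_def flip: dmem del: mem_simps)
  have I_dm: "(\<Prod>s\<in>#I. ?dm s) = (\<Prod>s\<in>#M. f + k s * g) * g ^ size N * P"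
    unfolding I_def image_mset_union prod_mset.union dm_Some
    by (simp add: P_def prod_unfold_prod_mset g_def del: mem_simps add: mem_simps(1))
  have J_dm: "(\<Prod>s\<in>#J. ?dm s) = (\<Prod>s\<in>#N. f + k s * g) * g ^ size M * g\<^sup>2"
    unfolding J_def image_mset_union prod_mset.union dm_Some
    by (simp add: g_def power_add power2_eq_square del: mem_simps add: mem_simps(1))
  have "to_fract ?p * K2.ev \<beta> ?r = K2.ev \<alpha> ?r * to_fract ?q"
    using \<alpha>\<beta> P0 B0 by (simp add: frac_eq_eq del: to_fract_mult)
  then have "to_fract ?p * (K2.ev \<beta> ?r * to_fract g ^ size N) * to_fract g ^ size M
      = (K2.ev \<alpha> ?r * to_fract g ^ size M) * to_fract g ^ size N * to_fract ?q"
    by (simp only: mult_ac)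
  moreover have fpow: "to_fract g ^ n = to_fract (g ^ n)" for n by (induction n) simp_all
  ultimately have "?p * ([:[:cb:]:] * (\<Prod>s\<in>#N. f + k s * g)) * g ^ size M
      = ([:[:ca:]:] * (\<Prod>s\<in>#M. f + k s * g)) * g ^ size N * ?q"
    unfolding M N(2) unfolding fpow by (simp only: to_fract_mult[symmetric] to_fract_eq_iff)
  then have eqb: "[:[:cb:]:] * (dehom (V (Suc 0)) * (\<Prod>s\<in>#J. ?dm s)) = [:[:ca:]:] * ((\<Prod>s\<in>#I. ?dm s) * B)"
    unfolding I_dm J_dm by (simp only: mult_ac)
  have cc: "[:[:cb:]:] * [:[:ca / cb:]:] = [:[:ca:]:]" using N(1) by simp
  have b: "dehom (V (Suc 0)) * (\<Prod>s\<in>#J. ?dm s) = [:[:ca / cb:]:] * (\<Prod>s\<in>#I. ?dm s) * B"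
  proof -
    have "[:[:cb:]:] * (dehom (V (Suc 0)) * (\<Prod>s\<in>#J. ?dm s)) = [:[:cb:]:] * ([:[:ca / cb:]:] * (\<Prod>s\<in>#I. ?dm s) * B)"
      unfolding eqb cc[symmetric] by (simp only: mult_ac)
    moreover have "[:[:cb:]:] \<noteq> 0" using N(1) by simp
    ultimately show ?thesis by (simp only: mult_cancel_left simp_thms)
  qed
  have a: "dehom (V 0) * (\<Prod>s\<in>#J. ?dm s) = [:[:ca / cb:]:] * (\<Prod>s\<in>#I. ?dm s) * A"
  proof -
    have "B * (dehom (V 0) * (\<Prod>s\<in>#J. ?dm s)) = (dehom (V 0) * B) * (\<Prod>s\<in>#J. ?dm s)" by (simp only: mult_ac)
    also have "\<dots> = A * (dehom (V (Suc 0)) * (\<Prod>s\<in>#J. ?dm s))" unfolding wedge by (simp only: mult_ac)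
    also have "\<dots> = B * ([:[:ca / cb:]:] * (\<Prod>s\<in>#I. ?dm s) * A)" unfolding b by (simp only: mult_ac)
    finally show ?thesis using B0 by (simp only: mult_cancel_left simp_thms)
  qed
  have size: "size I + 2 = size J + card T" using T by (simp add: I_def J_def)
  define E where "E i = V i * (\<Prod>s\<in>#J. mem s) - const3 (ca / cb) * (\<Prod>s\<in>#I. mem s) * theta i" for i
  have homE: "hom (d * (size I + 2) - 1) (E i)" for i
  \<comment> \<open>For empty T the expression card T - 1 is truncated, but V is 0.\<close>
  proof (cases "T = {}")
    case True
    then have "V i = 0" by (simp add: V_def)
    have "hom (size I * d + (2 * d - 1)) ((const3 (ca / cb) * (\<Prod>s\<in>#I. mem s)) * theta i)"
      by (intro hom_mult hom_const3_mult hom_prod_mset hom_mem hom_theta)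
    moreover have "size I * d + (2 * d - 1) = d * (size I + 2) - 1" using d_pos by (simp add: algebra_simps)
    ultimately show ?thesis using \<open>V i = 0\<close> unfolding E_def by (intro hom_diff) auto
  next
    case False
    then have cT: "card T \<ge> 1" using T by (simp add: Suc_le_eq card_gt_0_iff)
    have "hom ((d - 1) + (card T - 1) * d) (V i)" unfolding V_def
    proof (intro hom_sum hom_mult hom)
      fix t assume t: "t \<in> T"
      have "hom (\<Sum>s\<in>T - {t}. d) (\<Prod>s\<in>T - {t}. mem (Some s))" by (intro hom_prod hom_mem)
      then show "hom ((card T - 1) * d) (\<Prod>s\<in>T - {t}. mem (Some s))" using t T by simp
    qed
    then have "hom ((d - 1) + (card T - 1) * d + size J * d) (V i * (\<Prod>s\<in>#J. mem s))"
      by (intro hom_mult hom_prod_mset hom_mem)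
    moreover have "(d - 1) + (card T - 1) * d + size J * d = d * (size I + 2) - 1"
    proof -
      obtain m where "card T = Suc m" using cT by (cases "card T") auto
      then show ?thesis unfolding size using d_pos by (simp add: algebra_simps)
    qed
    moreover have "hom (size I * d + (2 * d - 1)) ((const3 (ca / cb) * (\<Prod>s\<in>#I. mem s)) * theta i)"
      by (intro hom_mult hom_const3_mult hom_prod_mset hom_mem hom_theta)
    moreover have "size I * d + (2 * d - 1) = d * (size I + 2) - 1" using d_pos by (simp add: algebra_simps)
    ultimately show ?thesis unfolding E_def by (intro hom_diff) auto
  qed
  have th: "dehom (theta 0) = A" "dehom (theta (Suc 0)) = B"
    unfolding theta_def by (simp_all only: dehom_diff dehom_simps dpd A_def B_def f_def g_def)
  have E01: "E 0 = 0" "E (Suc 0) = 0"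
    by (rule dehom_inj[OF homE], simp only: E_def dehom_diff dehom_simps dehom_prod_mset th a b diff_self)+
  have s3: "(\<Sum>i<3. h i) = h 0 + (h (Suc 0) + h 2)" for h :: "nat \<Rightarrow> 'k poly poly poly"
  proof -
    have "{..<3} = {0, Suc 0, 2::nat}" by auto
    then show ?thesis by simp
  qed
  have "(\<Sum>i<3. xv i * V i) = (\<Sum>t\<in>T. (\<Sum>i<3. xv i * v t i) * (\<Prod>s\<in>T - {t}. mem (Some s)))"
    unfolding V_def by (simp add: s3 sum_distrib_left sum.distrib algebra_simps)
  also have "\<dots> = 0" using euler by simp
  finally have eulV: "(\<Sum>i<3. xv i * V i) = 0" .
  have "(\<Sum>i<3. xv i * E i) = (\<Sum>i<3. xv i * V i) * (\<Prod>s\<in>#J. mem s)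
      - const3 (ca / cb) * (\<Prod>s\<in>#I. mem s) * (\<Sum>i<3. xv i * theta i)"
    unfolding E_def by (simp add: s3 algebra_simps)
  then have "(\<Sum>i<3. xv i * E i) = 0" by (simp add: eulV euler_theta)
  \<comment> \<open>The chart gave the first two components; the Euler relation gives the
    third.\<close>
  then have "xv 2 * E 2 = 0" unfolding s3 E01 by simp
  then have "E 2 = 0" by (auto simp: xv_def)
  moreover have "i = 0 \<or> i = Suc 0 \<or> i = 2" if "i < 3" for i :: nat using that by auto
  ultimately have "\<forall>i<3. E i = 0" using E01 by blast
  then show ?thesis using size unfolding E_def by (intro exI[of _ I] exI[of _ J] exI[of _ "ca / cb"]) simp
qed

end

section \<open>The total order of reducibility\<close>

context hom_pencil
begin

text \<open>The form of the member at infinity is minus the sum of the others, so its closedness is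
  the hypothesis \<open>cl_inf\<close> of \<open>pullback\<close>; if that member is absent, the sum
  is 0. After the forms of the finite members are shown to vanish, the relation itself disposes of
  the one at infinity.\<close>

lemma forms_independent:
  assumes ac: "alg_closed_field TYPE('k)" and nc: "non_composite (dehom F) (dehom G)"
    and WY: "dehom G * pderiv (dehom F) - dehom F * pderiv (dehom G) \<noteq> 0"
    and S: "finite S"
    and A: "\<And>s. s \<in> S \<Longrightarrow> hom (omega_nat (mem s)) (A s)"
    and lam: "\<And>s. s \<in> S \<Longrightarrow> (\<Sum>P\<in>prime_factors (mem s). lam s P * of_nat (tdeg3 P)) = 0"
    and sum0: "\<And>i. i < 3 \<Longrightarrow> (\<Sum>s\<in>S. form (mem s) (lam s) (A s) i) = 0"
    and "s \<in> S" "i < 3"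
  shows "form (mem s) (lam s) (A s) i = 0"
proof -
  define w where "w s = form (mem s) (lam s) (A s)" for s
  define T where "T = Some -` S"
  have T: "finite T" unfolding T_def by (rule finite_vimageI[OF S]) simp
  have S_split: "(\<Sum>s\<in>S. h s) = (if None \<in> S then h None else 0) + (\<Sum>t\<in>T. h (Some t))"
    for h :: "'k option \<Rightarrow> 'k poly poly poly"
  proof -
    have "S - {None} = Some ` T" unfolding T_def by (auto simp: image_iff)
    then have "(\<Sum>s\<in>S - {None}. h s) = (\<Sum>t\<in>T. h (Some t))" by (simp add: sum.reindex)
    then show ?thesis using S by (auto simp: sum.remove)
  qed
  have hw: "hom (d - 1) (w s i)" if "s \<in> S" for s i
    unfolding w_def by (rule hom_form[OF mem_nonzero hom_mem A[OF that]])
  have ew: "(\<Sum>i<3. xv i * w s i) = 0" if "s \<in> S" for s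
    unfolding w_def by (rule euler_form[OF mem_nonzero hom_mem A[OF that] lam[OF that]])
  have cw: "closed_at (mem s) (w s)" for s
    unfolding closed_at_def w_def by (rule closed_form[OF mem_nonzero hom_mem])
  define V where "V i = (\<Sum>t\<in>T. w (Some t) i * (\<Prod>s\<in>T - {t}. mem (Some s)))" for i
  have inf: "closed_at G (\<lambda>i. \<Sum>t\<in>T. w (Some t) i)"
  proof -
    have eq: "(\<Sum>t\<in>T. w (Some t) i) = - (if None \<in> S then w None i else 0)" if "i < 3" for i
      using sum0[OF that] unfolding w_def[symmetric] S_split by (simp add: eq_neg_iff_add_eq_0 add.commute)
    show ?thesis
    proof (cases "None \<in> S")
      case True
      then have "(\<Sum>t\<in>T. w (Some t) 0) = - w None 0" "(\<Sum>t\<in>T. w (Some t) (Suc 0)) = - w None (Suc 0)"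
        using eq[of 0] eq[of "Suc 0"] by simp_all
      then show ?thesis
        using arg_cong[OF cw[of None, unfolded closed_at_def], of uminus]
        unfolding closed_at_def by (simp add: derivation.uminus[OF derivation_pd] algebra_simps)
    next
      case False
      then have "(\<Sum>t\<in>T. w (Some t) 0) = 0" "(\<Sum>t\<in>T. w (Some t) (Suc 0)) = 0"
        using eq[of 0] eq[of "Suc 0"] by simp_all
      then show ?thesis by (simp add: closed_at_def derivation.zero[OF derivation_pd])
    qed
  qed
  have TS: "Some t \<in> S" if "t \<in> T" for t using that by (simp add: T_def)
  have "\<exists>I J c. size I + 2 = size J + card T \<and>
      (\<forall>i<3. V i * (\<Prod>s\<in>#J. mem s) = const3 c * (\<Prod>s\<in>#I. mem s) * theta i)"
    by (rule pullback[where v = "\<lambda>t. w (Some t)" and V = V, OF ac nc WY T])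
      (erule hw[OF TS] ew[OF TS] | rule cw inf V_def)+
  then obtain I J c where IJ: "size I + 2 = size J + card T"
    "\<And>i. i < 3 \<Longrightarrow> V i * (\<Prod>s\<in>#J. mem s) = const3 c * (\<Prod>s\<in>#I. mem s) * theta i"
    by blast
  have pb: "(\<forall>i<3. V i = 0) \<or> (\<exists>I c. size I + 2 = card T \<and> (\<forall>i<3. V i = const3 c * (\<Prod>s\<in>#I. mem s) * theta i))"
    using cancel_members[of V J c I, OF IJ(2)]
  proof
    assume "\<exists>I' c'. size I' + size J = size I \<and> (\<forall>i<3. V i = const3 c' * (\<Prod>s\<in>#I'. mem s) * theta i)"
    then obtain I' c' where I': "size I' + size J = size I" "\<forall>i<3. V i = const3 c' * (\<Prod>s\<in>#I'. mem s) * theta i"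
      by blast
    then have "size I' + 2 = card T" using IJ(1) by linarith
    then show ?thesis using I'(2) by blast
  qed (assumption, rule disjI1, assumption)
  have fin: "w (Some t) i = 0" if "t \<in> T" "i < 3" for t i
    by (rule independent_if_pullback[where v = "\<lambda>t. w (Some t)" and V = V, OF T that(1)])
      (rule hw[OF TS[OF that(1)]] ew[OF TS[OF that(1)]] pb V_def that(2))+
  have "w None i = 0" if "None \<in> S"
    using sum0[OF \<open>i < 3\<close>] that fin[OF _ \<open>i < 3\<close>] unfolding w_def[symmetric] S_split by simp
  then show ?thesis using fin[OF _ \<open>i < 3\<close>] \<open>s \<in> S\<close> unfolding w_def[symmetric] T_def by (cases s) auto
qed

section \<open>Local dimensions and the invariants of a member\<close>

lemma omega_add_degrees: "omega_nat (mem s) + (\<Sum>P\<in>prime_factors (mem s). tdeg3 P) = d"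
proof -
  obtain u where u: "is_unit u" "rad_part (mem s) = \<Prod>(prime_factors (mem s)) * u"
    using rad_part_eq[OF mem_nonzero] by blast
  obtain c where c: "u = const3 c" using u(1) by (rule is_unit_imp_const3)
  have eq: "mem s = const3 c * (mult_part (mem s) * \<Prod>(prime_factors (mem s)))"
    using mult_rad_part[OF mem_nonzero, of s] unfolding u(2) c by (rule trans) (simp only: mult_ac)
  have "hom (omega_nat (mem s) + (\<Sum>P\<in>prime_factors (mem s). tdeg3 P)) (const3 c * (mult_part (mem s) * \<Prod>(prime_factors (mem s))))"
    by (intro hom_const3_mult hom_mult hom_mult_part[OF mem_nonzero hom_mem] hom_prod prime_factor_hom'[OF mem_nonzero hom_mem])
  then have "hom (omega_nat (mem s) + (\<Sum>P\<in>prime_factors (mem s). tdeg3 P)) (mem s)"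
    unfolding eq[symmetric] .
  then show ?thesis using hom_unique hom_mem mem_nonzero by blast
qed

lemma n_inv_pos: "n_inv (mem s) \<ge> 1"
proof -
  obtain P where "prime P" "P dvd mem s" using prime_divisor_exists[OF mem_nonzero not_unit_mem] by blast
  then have "prime_factors (mem s) \<noteq> {}" using mem_nonzero prime_factorsI by blast
  then have "card (prime_factors (mem s)) > 0" by (simp only: card_gt_0_iff finite_set_mset simp_thms)
  then show ?thesis unfolding n_inv_def by linarith
qed

lemma omega_inv_eq: "omega_inv H = int (omega_nat H)"
  unfolding omega_inv_def omega_nat_def of_nat_sum
  by (intro sum.cong refl) (auto dest!: prime_factorsD(3) simp: of_nat_diff)

lemma m_inv_eq: "m_inv H = (\<Sum>P\<in>prime_factors H. int (multiplicity P H))"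
  unfolding m_inv_def size_multiset_overloaded_eq of_nat_sum
  by (intro sum.cong refl) (simp add: count_prime_factorization_prime in_prime_factors_imp_prime)

text \<open>m - n is the sum of the e - 1, which is subtracted again in theta, and (w+1 choose 2) +
  w + 1 = (w+2 choose 2). The -2 stands for the two conditions per member in
  \<open>dim_bound\<close>.\<close>

lemma local_dim: "m_inv H - 1 + omega_inv H + theta_inv H = int (card (form_idx H)) - 2"
proof -
  have "omega_nat H + 2 choose 2 = (omega_nat H + 1 choose 2) + (omega_nat H + 1)"
    by (simp add: numeral_2_eq_2)
  then show ?thesis
    unfolding card_form_idx theta_inv_def omega_inv_eq m_inv_eq
    by (simp add: sum_subtractf del: binomial_Suc_Suc)
qed

lemma n_inv_le_m_inv: "n_inv H \<le> m_inv H"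
proof -
  have "n_inv H = (\<Sum>P\<in>prime_factors H. 1)" by (simp add: n_inv_def)
  also have "\<dots> \<le> m_inv H" unfolding m_inv_eq
    by (intro sum_mono) (auto dest!: prime_factorsD(3))
  finally show ?thesis .
qed

text \<open>The factors have degree at least 1, so the sum of the e - 1 is at most w, and w \<le>
  (w+1 choose 2).\<close>

lemma theta_inv_nonneg: "theta_inv (mem s) \<ge> 0"
proof -
  let ?w = "omega_nat (mem s)"
  have "(\<Sum>P\<in>prime_factors (mem s). int (multiplicity P (mem s)) - 1)
      = int (\<Sum>P\<in>prime_factors (mem s). multiplicity P (mem s) - 1)"
    unfolding of_nat_sum by (intro sum.cong refl) (auto dest!: prime_factorsD(3) simp: of_nat_diff)
  also have "(\<Sum>P\<in>prime_factors (mem s). multiplicity P (mem s) - 1) \<le> ?w"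
    unfolding omega_nat_def using prime_factor_tdeg3_pos[OF mem_nonzero hom_mem]
    by (intro sum_mono) (simp add: Suc_le_eq)
  also have "?w \<le> (?w + 1 choose 2)" by (simp add: numeral_2_eq_2)
  finally show ?thesis by (simp add: theta_inv_def omega_inv_eq)
qed

lemma sum_local_dims_le:
  assumes ac: "alg_closed_field TYPE('k)" and nc: "non_composite (dehom F) (dehom G)"
    and WY: "dehom G * pderiv (dehom F) - dehom F * pderiv (dehom G) = 0 \<Longrightarrow> d = 1"
    and S: "finite S"
  shows "(\<Sum>s\<in>S. m_inv (mem s) - 1 + omega_inv (mem s) + theta_inv (mem s)) \<le> int d ^ 2 - 1"
proof (cases "dehom G * pderiv (dehom F) - dehom F * pderiv (dehom G) = 0")
  case True
  then have d: "d = 1" by (rule WY)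
  have "m_inv (mem s) - 1 + omega_inv (mem s) + theta_inv (mem s) = 0" for s
  proof -
    have "card (prime_factors (mem s)) \<le> (\<Sum>P\<in>prime_factors (mem s). tdeg3 P)"
      using sum_mono[of "prime_factors (mem s)" "\<lambda>_. 1" tdeg3] prime_factor_tdeg3_pos[OF mem_nonzero hom_mem]
      by (simp add: Suc_le_eq)
    moreover have "card (prime_factors (mem s)) \<ge> 1" using n_inv_pos[of s] by (simp add: n_inv_def)
    ultimately have "card (prime_factors (mem s)) = 1" "omega_nat (mem s) = 0"
      using omega_add_degrees[of s] d by linarith+
    then show ?thesis unfolding local_dim card_form_idx by (simp add: numeral_2_eq_2)
  qed
  then show ?thesis by (simp add: d)
next
  case False
  show ?thesis unfolding local_dim
    by (rule dim_bound[OF S d_pos mem_nonzero hom_mem]) (rule forms_independent[OF ac nc False S])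
qed

end

text \<open>A constant is composite: it is T^2 evaluated at a square root of it.\<close>

lemma non_composite_degree_pos:
  fixes f g :: "'k::field_gcd poly poly"
  assumes ac: "alg_closed_field TYPE('k)" and nc: "non_composite f g" and g: "g \<noteq> 0"
  shows "max (tdeg2 f) (tdeg2 g) \<ge> 1"
proof (rule ccontr)
  assume "\<not> ?thesis"
  then have 0: "tdeg2 f = 0" "tdeg2 g = 0" by auto
  have const: "\<exists>x. h = [:[:x:]:]" if "tdeg2 h = 0" for h :: "'k poly poly"
  proof (intro exI[of _ "coeff (coeff h 0) 0"] poly_eqI)
    fix i j
    show "coeff (coeff h i) j = coeff (coeff [:[:coeff (coeff h 0) 0:]:] i) j"
      using tdeg2_ge[of h i j] that by (cases "coeff (coeff h i) j = 0") (auto simp: coeff_pCons split: nat.splits)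
  qed
  obtain x y where xy: "f = [:[:x:]:]" "g = [:[:y:]:]" using const 0 by metis
  then have y: "y \<noteq> 0" using g by auto
  have "degree [:- (x / y), 0, 1:] \<ge> 1" by simp
  then obtain z where "poly [:- (x / y), 0, 1:] z = 0" using ac unfolding alg_closed_field_def by blast
  then have z: "z * z * y = x" using y by (simp add: field_simps)
  have "Fract f g = eval_fract [:0, 0, 1:] (const_fract z) / eval_fract 1 (const_fract z)"
    using y unfolding eval_fract_eq_ev xy Fract_eq_to_fract
    by (simp add: const_fract_def divide_eq_eq flip: z to_fract_mult)
  moreover have "coprime [:0, 0, 1 :: 'k:] 1" "max (degree [:0, 0, 1 :: 'k:]) (degree (1 :: 'k poly)) \<ge> 2"
    "eval_fract 1 (const_fract z) \<noteq> 0"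
    by (simp_all add: eval_fract_eq_ev)
  ultimately show False using nc unfolding non_composite_def by blast
qed

lemma ev_X: "K2.ev a (to_fract [:[:0, 1:]:]) = to_fract [:a:]"
  by (induction a) (simp, simp, simp add: const_fract_def flip: to_fract_mult to_fract_add)

text \<open>By coprimality f and g divide their own Y-derivatives, so they do not involve Y. Then r
  = a(X)/b(X) is a composition with X, and non-compositeness bounds its degree.\<close>

lemma wronskian_Y_eq_0_imp_degree_le_1:
  fixes f g :: "'k::{field_gcd, field_char_0} poly poly"
  assumes g: "g \<noteq> 0" and cop: "coprime f g" and nc: "non_composite f g"
    and W: "g * pderiv f - f * pderiv g = 0"
  shows "max (tdeg2 f) (tdeg2 g) \<le> 1"
proof -
  have eq: "g * pderiv f = f * pderiv g" using W by simp
  have deg0: "degree h = 0" if "h dvd pderiv h" for h :: "'k poly poly"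
  proof (rule ccontr)
    assume h: "degree h \<noteq> 0"
    then have "pderiv h \<noteq> 0" by (simp add: pderiv_eq_0_iff)
    then have "degree h \<le> degree (pderiv h)" using that by (intro dvd_imp_degree_le)
    then show False using h by (simp add: degree_pderiv)
  qed
  have "g dvd f * pderiv g" using eq by (metis dvd_triv_left)
  then have "degree g = 0"
    using cop by (intro deg0) (simp add: coprime_dvd_mult_right_iff coprime_commute)
  moreover have "f dvd g * pderiv f" using eq by simp
  then have "degree f = 0"
    using cop by (intro deg0) (simp add: coprime_dvd_mult_right_iff)
  ultimately obtain a b where ab: "f = [:a:]" "g = [:b:]" by (metis degree_eq_zeroE)
  have "coprime a b"
  proof (rule coprimeI)
    fix c assume "c dvd a" "c dvd b"
    then have "[:c:] dvd f" "[:c:] dvd g" by (simp_all add: ab)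
    then have "is_unit [:c:]" using cop coprime_common_divisor by blast
    then show "is_unit c" by (simp add: is_unit_const_poly_iff)
  qed
  moreover have "Fract f g = eval_fract a (to_fract [:[:0, 1:]:]) / eval_fract b (to_fract [:[:0, 1:]:])"
    "eval_fract b (to_fract [:[:0, 1:]:]) \<noteq> 0"
    using g by (simp_all add: eval_fract_eq_ev ev_X ab Fract_eq_to_fract)
  ultimately have "\<not> max (degree a) (degree b) \<ge> 2" using nc unfolding non_composite_def by blast
  then have deg: "degree a \<le> 1" "degree b \<le> 1" by auto
  have "tdeg2 [:h:] \<le> 1" if h: "degree h \<le> 1" for h :: "'k poly"
  proof (rule tdeg2_le)
    fix i j assume "coeff (coeff [:h:] i) j \<noteq> 0"
    then show "i + j \<le> 1" using h le_degree[of h j] by (auto simp: coeff_pCons split: nat.splits)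
  qed
  then show ?thesis using deg by (simp add: ab)
qed

theorem theorem2p2:
  fixes f g :: "'k::{field_gcd, field_char_0} poly poly"
  assumes "alg_closed_field TYPE('k)"
    and "g \<noteq> 0"
    and "coprime f g"
    and "non_composite f g"
  defines "d \<equiv> max (tdeg2 f) (tdeg2 g)"
  shows "0 \<le> rho_fg f g
       \<and> rho_fg f g \<le> m_fg f g + omega_fg f g + theta_fg f g
       \<and> m_fg f g + omega_fg f g + theta_fg f g \<le> int d ^ 2 - 1"
proof -
  have d: "d \<ge> 1" using non_composite_degree_pos[OF assms(1,4,2)] by (simp add: d_def)
  have df: "tdeg2 f \<le> d" "tdeg2 g \<le> d" by (auto simp: d_def)
  interpret hom_pencil "homog d f" "homog d g" d
    by unfold_locales (use d df hom_homog coprime_homog[OF assms(3) d_def[THEN meta_eq_to_obj_eq]] in auto)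
  note dehom = dehom_homog[OF df(1)] dehom_homog[OF df(2)]
  have pencil: "pencil f g 0 1 = mem None" "pencil f g 1 t = mem (Some t)" for t
    by (simp_all add: pencil_def d_def[symmetric] Let_def)
  define L where "L s = m_inv (mem s) - 1 + omega_inv (mem s) + theta_inv (mem s)" for s
  have bound: "(\<Sum>s\<in>S. L s) \<le> int d ^ 2 - 1" if "finite S" for S
    unfolding L_def
  proof (rule sum_local_dims_le[OF assms(1) _ _ that])
    show "non_composite (dehom (homog d f)) (dehom (homog d g))" by (simp add: dehom assms(4))
    show "d = 1" if "dehom (homog d g) * pderiv (dehom (homog d f)) - dehom (homog d f) * pderiv (dehom (homog d g)) = 0"
      using wronskian_Y_eq_0_imp_degree_le_1[OF assms(2-4)] that d unfolding dehom d_def[symmetric] by simp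
  qed
  have n1: "n_inv (mem s) - 1 \<ge> 0" and nm: "n_inv (mem s) - 1 \<le> m_inv (mem s) - 1"
    and om: "omega_inv (mem s) \<ge> 0" and th: "theta_inv (mem s) \<ge> 0" for s
    using n_inv_pos[of s] n_inv_le_m_inv[of "mem s"] theta_inv_nonneg[of s] by (simp_all add: omega_inv_eq)
  have L0: "L s \<ge> 0" and nL: "n_inv (mem s) - 1 \<le> L s" for s
    using n1[of s] nm[of s] om[of s] th[of s] unfolding L_def by linarith+
  define Z where "Z = {t. L (Some t) \<noteq> 0}"
  \<comment> \<open>\<open>bound\<close> holds for every finite set of members, and each member in Z
    contributes at least 1, so there cannot be d^2 of them.\<close>
  have "finite Z"
  proof (rule ccontr)
    assume "infinite Z"
    then obtain B where B: "finite B" "card B = d\<^sup>2" "B \<subseteq> Z" using infinite_arbitrarily_large by blast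
    have "int (d\<^sup>2) = (\<Sum>s\<in>Some ` B. 1)" using B by (simp add: card_image)
    also have "\<dots> \<le> (\<Sum>s\<in>Some ` B. L s)"
    proof (rule sum_mono)
      fix s assume "s \<in> Some ` B"
      then have "L s \<noteq> 0" using B(3) by (auto simp: Z_def)
      then show "1 \<le> L s" using L0[of s] by linarith
    qed
    also have "\<dots> \<le> int d ^ 2 - 1" using B by (intro bound) simp
    finally show False by simp
  qed
  \<comment> \<open>\<open>P1_sum\<close> runs over the support of its own summand. The four
    invariants vanish wherever L does, so all of them can be summed over one finite set.\<close>
  have P1: "P1_sum (\<lambda>a b. h (pencil f g a b)) = (\<Sum>s\<in>insert None (Some ` Z). h (mem s))"
    if "\<And>s. L s = 0 \<Longrightarrow> h (mem s) = 0" for h :: "'k poly poly poly \<Rightarrow> int"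
  proof -
    have "(\<Sum>t\<in>{t. h (mem (Some t)) \<noteq> 0}. h (mem (Some t))) = (\<Sum>t\<in>Z. h (mem (Some t)))"
      using \<open>finite Z\<close> that by (intro sum.mono_neutral_left) (auto simp: Z_def simp del: mem_simps)
    then show ?thesis unfolding P1_sum_def pencil using \<open>finite Z\<close> by (simp add: sum.reindex image_iff del: mem_simps)
  qed
  have zero: "n_inv (mem s) - 1 = 0" "m_inv (mem s) - 1 = 0" "omega_inv (mem s) = 0" "theta_inv (mem s) = 0"
    if "L s = 0" for s
    using that n1[of s] nm[of s] om[of s] th[of s] unfolding L_def by linarith+
  let ?S = "insert None (Some ` Z)"
  have rho: "rho_fg f g = (\<Sum>s\<in>?S. n_inv (mem s) - 1)"
    unfolding rho_fg_def by (rule P1[of "\<lambda>H. n_inv H - 1"]) (rule zero)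
  have "m_fg f g = (\<Sum>s\<in>?S. m_inv (mem s) - 1)"
    unfolding m_fg_def by (rule P1[of "\<lambda>H. m_inv H - 1"]) (rule zero)
  moreover have "omega_fg f g = (\<Sum>s\<in>?S. omega_inv (mem s))"
    unfolding omega_fg_def by (rule P1[of omega_inv]) (rule zero)
  moreover have "theta_fg f g = (\<Sum>s\<in>?S. theta_inv (mem s))"
    unfolding theta_fg_def by (rule P1[of theta_inv]) (rule zero)
  ultimately have tot: "m_fg f g + omega_fg f g + theta_fg f g = (\<Sum>s\<in>?S. L s)"
    unfolding L_def by (simp only: sum.distrib)
  show ?thesis unfolding tot unfolding rho using \<open>finite Z\<close>
    by (intro conjI sum_nonneg sum_mono bound n1 nL) simp
qed

end
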